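(* Let $\alpha\in\{0,1,2,3\}$ and $(l,m)\in\mathbb{Z}^2$. There exist rational functions $g_{l,m,\alpha}$ and $h_{l,m,\alpha}$ in one variable such that for every integer $p\ge1$ for which the $2\times2$ square centred at $(l,m)$ lies in the Aztec diamond of size $4p+\alpha$ (equivalently $|l|+|m|\le 4p+\alpha-1$), both functions are defined at $p$ and the number of domino tilings of the Aztec diamond of size $4p+\alpha$ with the $2\times2$ square $[l-1,l+1]\times[m-1,m+1]$ removed is equal to $$2^{(4p+\alpha+1)(4p+\alpha)/2}\left(\frac18+2^{-4p-\alpha-2}\binom{2p-1}{p}^2 g_{l,m,\alpha}(p)+2^{-8p-2\alpha}\binom{2p-1}{p}^4 h_{l,m,\alpha}(p)\right).$$
   Context: The Aztec diamond of size $n\ge1$ is the union of all unit squares $[i,i+1]\times[j,j+1]$ ($i,j\in\mathbb{Z}$) contained in $\{(x,y): |x|+|y|\le n+1\}$. A domino is a union of two edge-adjacent unit squares; a domino tiling of a region made of unit squares is a covering of the region by dominoes contained in it with pairwise disjoint interiors. *)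

theory Defs
  imports
    "HOL-Analysis.Analysis"
    "HOL-Computational_Algebra.Computational_Algebra"
begin

definition unit_square :: "int \<Rightarrow> int \<Rightarrow> (real \<times> real) set" where
  "unit_square i j = {of_int i..of_int i + 1} \<times> {of_int j..of_int j + 1}"

definition aztec_diamond :: "nat \<Rightarrow> (real \<times> real) set" where
  "aztec_diamond n =
     \<Union> {unit_square i j | i j. unit_square i j \<subseteq> {(x, y). \<bar>x\<bar> + \<bar>y\<bar> \<le> real n + 1}}"

definition domino :: "(real \<times> real) set \<Rightarrow> bool" where
  "domino D \<longleftrightarrow> (\<exists>i j. D = unit_square i j \<union> unit_square (i + 1) j \<or>
                      D = unit_square i j \<union> unit_square i (j + 1))"

definition domino_tilings :: "(real \<times> real) set \<Rightarrow> (real \<times> real) set set set" where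
  "domino_tilings R =
     {T. (\<forall>D\<in>T. domino D \<and> D \<subseteq> R) \<and>
         (\<forall>D\<in>T. \<forall>E\<in>T. D \<noteq> E \<longrightarrow> interior D \<inter> interior E = {}) \<and>
         \<Union>T = R}"

definition block :: "int \<Rightarrow> int \<Rightarrow> (real \<times> real) set" where
  "block l m = {of_int l - 1..of_int l + 1} \<times> {of_int m - 1..of_int m + 1}"

text \<open>The closure restores the part of the boundary of the removed block that belongs to the
  remaining unit squares; a plain set difference would not be a union of closed squares.\<close>

definition holey_aztec_diamond :: "nat \<Rightarrow> int \<Rightarrow> int \<Rightarrow> (real \<times> real) set" where
  "holey_aztec_diamond n l m = closure (aztec_diamond n - block l m)"

text \<open>A rational function is an element of the fraction field of the polynomial ring. It is
  defined at \<open>x\<close> if some representation as a fraction has a denominator not vanishing at \<open>x\<close>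
  (equivalently, the denominator in lowest terms does not vanish at \<open>x\<close>).\<close>

definition ratfun_defined_at :: "'a::field poly fract \<Rightarrow> 'a \<Rightarrow> bool" where
  "ratfun_defined_at f x \<longleftrightarrow> (\<exists>a b. f = Fract a b \<and> poly b x \<noteq> 0)"

definition ratfun_eval :: "'a::field poly fract \<Rightarrow> 'a \<Rightarrow> 'a" where
  "ratfun_eval f x = (THE y. \<exists>a b. f = Fract a b \<and> poly b x \<noteq> 0 \<and> y = poly a x / poly b x)"

lemma ratfun_eval_Fract:
  assumes "poly b x \<noteq> 0"
  shows "ratfun_eval (Fract a b) x = poly a x / poly b x"
  unfolding ratfun_eval_def
proof (rule the_equality)
  show "\<exists>a' b'. Fract a b = Fract a' b' \<and> poly b' x \<noteq> 0 \<and>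
          poly a x / poly b x = poly a' x / poly b' x"
    using assms by blast
next
  fix y
  assume "\<exists>a' b'. Fract a b = Fract a' b' \<and> poly b' x \<noteq> 0 \<and> y = poly a' x / poly b' x"
  then obtain a' b' where eq: "Fract a b = Fract a' b'" and nz: "poly b' x \<noteq> 0"
    and y: "y = poly a' x / poly b' x" by blast
  have "b \<noteq> 0" "b' \<noteq> 0" using assms nz by auto
  with eq have "a * b' = a' * b" by (simp add: eq_fract)
  then have "poly a x * poly b' x = poly a' x * poly b x" by (metis poly_mult)
  then show "y = poly a x / poly b x" using assms nz y by (simp add: frac_eq_eq)
qed

end

theory Submission
  imports Defs "Jordan_Normal_Form.Determinant"
begin

text \<open>Colour the unit squares of the Aztec diamond of order \<open>n\<close> like a chessboard and number them along
the two diagonal directions: there are \<open>n\<close> by \<open>n + 1\<close> black squares \<open>(i, j)\<close> and \<open>n + 1\<close> by \<open>n\<close>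
white squares \<open>(x, y)\<close>, and \<open>(i, j)\<close> has the neighbours \<open>(i, j)\<close>, \<open>(i + 1, j)\<close>, \<open>(i, j - 1)\<close>
and \<open>(i + 1, j - 1)\<close>. Domino tilings are perfect matchings of this graph.

Give the neighbours the weights \<open>1, 1, 1, -1\<close> and let \<open>K\<close> be the resulting matrix. An inversion count
(\<open>sign_weight_constant\<close>) shows that every perfect matching contributes the same sign to \<open>det K\<close>. Hence
\<open>\<bar>det K\<bar>\<close> is the number of tilings, and the number of tilings that contain two given dominoes is
\<open>\<bar>det K\<bar>\<close> times a 2 by 2 minor of the inverse of \<open>K\<close>, up to the weights of the two dominoes
(\<open>card_matchings_two_edges\<close>). The tilings of the diamond without a 2 by 2 block are the
tilings of the whole diamond in which the block is covered by two horizontal dominoes, so the region with the hole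
needs no sign analysis of its own. The weights around a block are such that the minor becomes
\<open>E1 * E2 + E3 * E4\<close>, where the \<open>E\<close>'s are the probabilities of the four dominoes that fit into the block.

The matrix \<open>K\<close> can be inverted explicitly. Reading a row of coefficients as a polynomial, \<open>K\<close> sends the
sequence of polynomials \<open>f j\<close> to the sequence \<open>(1 + x) * f j + (1 - x) * f (j + 1)\<close>. In the bases
\<open>(1 - x) ^ a * (1 + x) ^ (m - a)\<close> this is a sum of two shifts, whose inverse is an alternating sum along
antidiagonals, and the change of basis is the Krawtchouk matrix, whose square is \<open>2 ^ m\<close>. This gives
\<open>(det K)\<^sup>2 = 2 ^ (n * (n + 1))\<close> and each \<open>E\<close> as a half-range sum of products of two Krawtchouk coefficients.

Neighbouring \<open>E\<close>'s differ by a single product of two Krawtchouk coefficients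
(\<open>edge_prob_step_right\<close>, \<open>edge_prob_step_up\<close>). At a bounded distance from the centre of the diamond of order
\<open>4 * p + \<alpha>\<close> each such coefficient is, up to the sign \<open>(-1) ^ p\<close>, the binomial coefficient
\<open>(2 * p - 1) choose p\<close> times a rational function of \<open>p\<close>, because
\<open>(1 - x) ^ a * (1 + x) ^ (m - a)\<close> is a power of \<open>1 - x\<^sup>2\<close> times a fixed polynomial (\<open>krawtchouk_central\<close>).
The four dominoes at a black square have probabilities \<open>E\<close> at four mirror images of one
position, and these add up to \<open>1\<close>. So each \<open>E\<close> is \<open>1 / 4\<close> plus a rational multiple of
\<open>2 ^ (- 4 * p) * ((2 * p - 1) choose p)\<^sup>2\<close>, and expanding \<open>E1 * E2 + E3 * E4\<close> gives the formula.\<close>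

hide_const (open) Determinants.det Finite_Cartesian_Product.mat module.smult

(* The size n * Suc n of the matrices has to keep this form, in which div and mod can be evaluated. *)
declare mult_Suc_right [simp del]

section \<open>Krawtchouk coefficients\<close>

definition krawtchouk :: "nat \<Rightarrow> nat \<Rightarrow> nat \<Rightarrow> rat" where
  "krawtchouk m i a = coeff ([:1, -1:] ^ a * [:1, 1:] ^ (m - a)) i"

lemma krawtchouk_Suc_same:
  assumes "a \<le> m"
  shows "krawtchouk (Suc m) i a = krawtchouk m i a + (if i = 0 then 0 else krawtchouk m (i - 1) a)"
proof -
  have "[:1, -1:] ^ a * [:1, 1:] ^ (Suc m - a) = [:1, 1:] * ([:1, -1:] ^ a * [:1, 1::rat:] ^ (m - a))"
    using assms by (simp only: Suc_diff_le power_Suc mult.left_commute)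
  then show ?thesis by (cases i) (simp_all add: krawtchouk_def)
qed

lemma krawtchouk_Suc_Suc:
  "krawtchouk (Suc m) i (Suc a) = krawtchouk m i a - (if i = 0 then 0 else krawtchouk m (i - 1) a)"
proof -
  have "[:1, -1:] ^ Suc a * [:1, 1:] ^ (Suc m - Suc a) = [:1, -1:] * ([:1, -1:] ^ a * [:1, 1::rat:] ^ (m - a))"
    by (simp only: diff_Suc_Suc power_Suc mult.assoc)
  then show ?thesis by (cases i) (simp_all add: krawtchouk_def)
qed

lemma degree_krawtchouk_poly: "a \<le> m \<Longrightarrow> degree ([:1, -1:] ^ a * [:1, 1::rat:] ^ (m - a)) = m"
  by (subst degree_mult_eq) (auto simp: degree_power_eq)

lemma krawtchouk_eq_0: "a \<le> m \<Longrightarrow> m < i \<Longrightarrow> krawtchouk m i a = 0"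
  unfolding krawtchouk_def using degree_krawtchouk_poly[of a m] by (intro coeff_eq_0) auto

text \<open>Reversing the order of the coefficients fixes \<open>1 + x\<close> and negates \<open>1 - x\<close>.\<close>

lemma krawtchouk_reflect_index:
  assumes "i \<le> m" "a \<le> m"
  shows "krawtchouk m (m - i) a = (-1) ^ a * krawtchouk m i a"
proof -
  let ?f = "[:1, -1:] ^ a * [:1, 1::rat:] ^ (m - a)"
  have "reflect_poly ?f = [:-1, 1:] ^ a * [:1, 1:] ^ (m - a)"
    by (simp add: reflect_poly_mult reflect_poly_power reflect_poly_pCons' monom_Suc monom_0)
  also have "[:-1, 1::rat:] = smult (-1) [:1, -1:]" by simp
  finally have "reflect_poly ?f = smult ((-1) ^ a) ?f"
    by (simp only: smult_power mult_smult_left)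
  then have "coeff (reflect_poly ?f) i = (-1) ^ a * krawtchouk m i a"
    by (simp add: krawtchouk_def)
  then show ?thesis
    using assms degree_krawtchouk_poly[of a m] by (simp add: coeff_reflect_poly krawtchouk_def)
qed

lemma pcompose_power: "pcompose (p ^ n) q = pcompose p q ^ n" for p :: "rat poly"
  by (induction n) (simp_all add: pcompose_mult pcompose_1)

text \<open>The substitution of \<open>-x\<close> for \<open>x\<close> exchanges \<open>1 - x\<close> and \<open>1 + x\<close>.\<close>

lemma krawtchouk_reflect_param:
  assumes "a \<le> m"
  shows "krawtchouk m i (m - a) = (-1) ^ i * krawtchouk m i a"
proof -
  let ?f = "[:1, -1:] ^ a * [:1, 1::rat:] ^ (m - a)"
  have "pcompose ?f [:0, -1:] = [:1, -1:] ^ (m - a) * [:1, 1:] ^ (m - (m - a))"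
    using assms by (simp add: pcompose_mult pcompose_power pcompose_pCons)
  then have "krawtchouk m i (m - a) = coeff (pcompose ?f [:0, -1:]) i" by (simp add: krawtchouk_def)
  then show ?thesis by (simp add: coeff_pcompose_linear krawtchouk_def)
qed

text \<open>With \<open>v = 1 - x\<close> and \<open>u = 1 + x\<close> the left-hand side is the homogenisation
\<open>(u - v) ^ j * (u + v) ^ (m - j)\<close> of the polynomial that defines the coefficients, and \<open>u - v = 2 * x\<close>,
\<open>u + v = 2\<close>. This expresses the monomials in the basis \<open>(1 - x) ^ a * (1 + x) ^ (m - a)\<close>.\<close>

lemma krawtchouk_homogeneous:
  assumes "j \<le> m"
  shows "(\<Sum>a\<le>m. smult (krawtchouk m a j) ([:1, -1:] ^ a * [:1, 1:] ^ (m - a))) = monom (2 ^ m) j"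
  using assms
proof (induction m arbitrary: j)
  case 0
  then show ?case by (simp add: krawtchouk_def monom_0)
next
  case (Suc m)
  define H where "H j = (\<Sum>a\<le>m. smult (krawtchouk m a j) ([:1, -1:] ^ a * [:1, 1:] ^ (m - a)))" for j
  have top: "(\<Sum>a\<le>Suc m. smult (krawtchouk m a j) ([:1, -1:] ^ a * [:1, 1:] ^ (Suc m - a))) = [:1, 1:] * H j"
    if "j \<le> m" for j
  proof -
    have "(\<Sum>a\<le>m. smult (krawtchouk m a j) ([:1, -1:] ^ a * [:1, 1:] ^ (Suc m - a))) = [:1, 1:] * H j"
      unfolding H_def sum_distrib_left
      by (intro sum.cong refl) (simp only: Suc_diff_le power_Suc atMost_iff mult_smult_right mult.left_commute)
    then show ?thesis using krawtchouk_eq_0[OF that, of "Suc m"] by simp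
  qed
  have low: "(\<Sum>a\<le>Suc m. smult (if a = 0 then 0 else krawtchouk m (a - 1) j) ([:1, -1:] ^ a * [:1, 1:] ^ (Suc m - a)))
      = [:1, -1:] * H j" for j
    unfolding H_def sum_distrib_left sum.atMost_Suc_shift
    by (simp add: mult_smult_right mult.assoc del: mult_pCons_left)
  show ?case
  proof (cases "j \<le> m")
    case True
    have "(\<Sum>a\<le>Suc m. smult (krawtchouk (Suc m) a j) ([:1, -1:] ^ a * [:1, 1:] ^ (Suc m - a)))
        = [:1, 1:] * H j + [:1, -1:] * H j"
      by (simp only: krawtchouk_Suc_same[OF True] smult_add_left sum.distrib top[OF True] low)
    also have "\<dots> = [:2:] * H j" unfolding distrib_right[symmetric] by simp
    also have "\<dots> = smult 2 (H j)" by simp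
    finally show ?thesis using Suc.IH[OF True] by (simp add: H_def smult_monom)
  next
    case False
    with Suc.prems obtain i where j: "j = Suc i" and i: "i \<le> m" by (cases j) auto
    have "(\<Sum>a\<le>Suc m. smult (krawtchouk (Suc m) a j) ([:1, -1:] ^ a * [:1, 1:] ^ (Suc m - a)))
        = [:1, 1:] * H i - [:1, -1:] * H i"
      by (simp only: j krawtchouk_Suc_Suc smult_diff_left sum_subtractf top[OF i] low)
    also have "\<dots> = [:0, 2:] * H i" unfolding left_diff_distrib[symmetric] by simp
    also have "\<dots> = pCons 0 (smult 2 (H i))" by simp
    finally show ?thesis using Suc.IH[OF i] by (simp add: H_def smult_monom monom_Suc j)
  qed
qed

lemma krawtchouk_involution:
  assumes "j \<le> m"
  shows "(\<Sum>a\<le>m. krawtchouk m i a * krawtchouk m a j) = (if i = j then 2 ^ m else 0)"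
proof -
  have "(\<Sum>a\<le>m. krawtchouk m i a * krawtchouk m a j)
      = coeff (\<Sum>a\<le>m. smult (krawtchouk m a j) ([:1, -1:] ^ a * [:1, 1:] ^ (m - a))) i"
    by (simp add: coeff_sum krawtchouk_def mult.commute)
  then show ?thesis by (simp add: krawtchouk_homogeneous[OF assms] eq_commute)
qed

section \<open>Placement probabilities\<close>

text \<open>The probability that a uniformly random tiling of the diamond of order \<open>n\<close> pairs the black square
\<open>(i, j)\<close> with the white square \<open>(i, j)\<close>. The formula is the corresponding entry of the inverse of the
weighted adjacency matrix. It is also meaningful for \<open>j = n\<close>, where that white square does not
exist and the sum is empty.\<close>

definition edge_prob :: "nat \<Rightarrow> nat \<Rightarrow> nat \<Rightarrow> rat" where
  "edge_prob n i j = (\<Sum>a<n - j. krawtchouk n a i * krawtchouk (n - 1) i a) / 2 ^ n"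

lemma edge_prob_step_right:
  assumes "j < n"
  shows "edge_prob n i j - edge_prob n i (Suc j) = krawtchouk n (n - Suc j) i * krawtchouk (n - 1) i (n - Suc j) / 2 ^ n"
proof -
  have "n - j = Suc (n - Suc j)" using assms by simp
  then show ?thesis by (simp add: edge_prob_def diff_divide_distrib[symmetric])
qed

text \<open>The change of the summand of \<open>edge_prob\<close> under \<open>i \<mapsto> i + 1\<close> is a difference in \<open>a\<close>: if the
coefficients of order \<open>N + 1\<close> are expanded by the recursions, both sides become the same polynomial in
the coefficients of order \<open>N\<close>. The reflection of the diamond that exchanges the two
diagonal directions predicts such a closed form, since a step in \<open>j\<close> changes the sum by a single summand.\<close>

lemma krawtchouk_telescope:
  assumes "a \<le> N" "Suc i \<le> N"
  shows "krawtchouk (Suc N) a (Suc i) * krawtchouk N (Suc i) a - krawtchouk (Suc N) a i * krawtchouk N i a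
    = krawtchouk (Suc N) (Suc i) (Suc a) * krawtchouk N a i
      - krawtchouk (Suc N) (Suc i) a * (if a = 0 then 0 else krawtchouk N (a - 1) i)"
proof -
  have "krawtchouk (Suc N) a (Suc i) = krawtchouk N a i - (if a = 0 then 0 else krawtchouk N (a - 1) i)"
    by (rule krawtchouk_Suc_Suc)
  moreover have "krawtchouk (Suc N) a i = krawtchouk N a i + (if a = 0 then 0 else krawtchouk N (a - 1) i)"
    using assms by (intro krawtchouk_Suc_same) simp
  moreover have "krawtchouk (Suc N) (Suc i) (Suc a) = krawtchouk N (Suc i) a - krawtchouk N i a"
    by (simp add: krawtchouk_Suc_Suc)
  moreover have "krawtchouk (Suc N) (Suc i) a = krawtchouk N (Suc i) a + krawtchouk N i a"
    by (simp add: krawtchouk_Suc_same assms)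
  ultimately show ?thesis by (simp only:) (simp add: algebra_simps)
qed

lemma edge_prob_step_up:
  assumes "Suc i < n"
  shows "edge_prob n (Suc i) j - edge_prob n i j =
    krawtchouk n (Suc i) (n - j) * (if n \<le> j then 0 else krawtchouk (n - 1) (n - j - 1) i) / 2 ^ n"
proof -
  obtain N where n: "n = Suc N" using assms by (cases n) auto
  have "(\<Sum>a<k. krawtchouk n a (Suc i) * krawtchouk (n - 1) (Suc i) a) - (\<Sum>a<k. krawtchouk n a i * krawtchouk (n - 1) i a)
     = krawtchouk n (Suc i) k * (if k = 0 then 0 else krawtchouk N (k - 1) i)" if "k \<le> Suc N" for k
    using that
  proof (induction k)
    case (Suc k)
    then show ?case using krawtchouk_telescope[of k N i] assms by (simp add: n)
  qed simp
  from this[of "n - j"] show ?thesis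
    by (simp add: edge_prob_def n diff_divide_distrib[symmetric])
qed

section \<open>Row-by-row numbering of the two colour classes\<close>

lemma sum_mod_div:
  fixes f :: "nat \<Rightarrow> nat \<Rightarrow> 'a :: comm_monoid_add"
  shows "(\<Sum>c = 0..<m * n. f (c mod n) (c div n)) = (\<Sum>j<m. \<Sum>i<n. f i j)"
proof -
  have "(\<Sum>i<n. f i j) = (\<Sum>c = j * n..<j * n + n. f (c mod n) (c div n))" for j
    using sum.shift_bounds_nat_ivl[of "\<lambda>c. f (c mod n) (c div n)" 0 "j * n" n]
    by (simp add: lessThan_atLeast0 add.commute)
  then show ?thesis
    by (simp only: sum.nat_group lessThan_atLeast0[symmetric])
qed

lemma mod_div_eqI:
  fixes r c n :: nat
  shows "r mod n = c mod n \<Longrightarrow> r div n = c div n \<Longrightarrow> r = c"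
  by (metis div_mult_mod_eq)

lemma black_index:
  assumes "c < n * Suc n"
  shows "c mod n < n" "c div n < Suc n"
proof -
  have "0 < n" using assms by (cases n) auto
  then show "c mod n < n" by simp
  show "c div n < Suc n" using assms by (intro less_mult_imp_div_less) (simp add: mult.commute)
qed

lemma white_index:
  assumes "r < n * Suc n"
  shows "r mod Suc n < Suc n" "r div Suc n < n"
  using assms by (auto simp: less_mult_imp_div_less)

text \<open>Numbering row by row turns the order of the numbers into the lexicographic order of the positions.\<close>

lemma lex_less_iff:
  fixes r s m :: nat
  assumes "0 < m"
  shows "r < s \<longleftrightarrow> r div m < s div m \<or> (r div m = s div m \<and> r mod m < s mod m)"
proof -
  have "r div m < s div m \<Longrightarrow> r < s" by (meson div_le_mono not_le)
  moreover have "s div m < r div m \<Longrightarrow> s < r" by (meson div_le_mono not_le)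
  moreover have "r < s \<longleftrightarrow> r mod m < s mod m" if "r div m = s div m"
    by (metis div_mult_mod_eq nat_add_left_cancel_less that)
  ultimately show ?thesis by (cases "r div m" "s div m" rule: linorder_cases) auto
qed

lemma mod_div_row: "i < (n::nat) \<Longrightarrow> (j * n + i) mod n = i" "i < n \<Longrightarrow> (j * n + i) div n = j"
  by simp_all

lemma row_index_less:
  assumes "i < n" "j < m"
  shows "j * n + i < m * (n :: nat)"
proof -
  have "j * n + i < Suc j * n" using assms by simp
  also have "\<dots> \<le> m * n" using assms by (intro mult_right_mono) auto
  finally show ?thesis .
qed

lemma black_row_index_less:
  assumes "i < n" "j < Suc n"
  shows "j * n + i < n * Suc n"
  using row_index_less[OF assms] by (simp only: mult.commute)

section \<open>The Kasteleyn matrix, its determinant and its inverse\<close>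

text \<open>Weight of the edge between the white square \<open>(x, y)\<close> and the black square \<open>(i, j)\<close>, and \<open>0\<close> if they
are not neighbours. The negative direction is chosen such that around each 2 by 2 block exactly one of the
four edges is negative, which is Kasteleyn's condition for faces of length four.\<close>

definition kast_weight :: "nat \<Rightarrow> nat \<Rightarrow> nat \<Rightarrow> nat \<Rightarrow> rat" where
  "kast_weight x y i j = (if (x = i \<or> x = Suc i) \<and> (j = y \<or> j = Suc y)
     then (if x = Suc i \<and> j = Suc y then -1 else 1) else 0)"

text \<open>The weighted adjacency matrix in the bases \<open>(1 - x) ^ a * (1 + x) ^ (m - a)\<close>: multiplication by \<open>1 + x\<close>
keeps \<open>a\<close> and the row, and multiplication by \<open>1 - x\<close> raises \<open>a\<close> and leads to the preceding row. Only
positions on a common antidiagonal are related, in a path.\<close>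

definition chain :: "nat \<Rightarrow> nat \<Rightarrow> nat \<Rightarrow> nat \<Rightarrow> rat" where
  "chain x y a j = (if (x = a \<and> y = j) \<or> (x = Suc a \<and> j = Suc y) then 1 else 0)"

text \<open>To reach the single white basis vector \<open>(x, y)\<close> one cancels the unwanted second term step by step
along the antidiagonal \<open>a + j = x + y\<close>. The cancellation has to stop at a black basis vector that has one image
only. This happens at \<open>j = 0\<close> if \<open>x + y < n\<close>, and at \<open>j = n\<close> otherwise.\<close>

definition chain_inv :: "nat \<Rightarrow> nat \<Rightarrow> nat \<Rightarrow> nat \<Rightarrow> nat \<Rightarrow> rat" where
  "chain_inv n a j x y = (if a + j \<noteq> x + y then 0
     else if x + y < n then (if j \<le> y then (-1) ^ (y - j) else 0)
     else (if y < j then (-1) ^ (j - Suc y) else 0))"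

text \<open>Rows are white squares, \<open>r = y * (n + 1) + x\<close>, and columns are black squares, \<open>c = j * n + i\<close>.\<close>

definition white_black_mat :: "nat \<Rightarrow> (nat \<Rightarrow> nat \<Rightarrow> nat \<Rightarrow> nat \<Rightarrow> rat) \<Rightarrow> rat mat" where
  "white_black_mat n f = Matrix.mat (n * Suc n) (n * Suc n)
     (\<lambda>(r, c). f (r mod Suc n) (r div Suc n) (c mod n) (c div n))"

definition kast_mat :: "nat \<Rightarrow> rat mat" where "kast_mat n = white_black_mat n kast_weight"

definition chain_mat :: "nat \<Rightarrow> rat mat" where "chain_mat n = white_black_mat n chain"

definition chain_inv_mat :: "nat \<Rightarrow> rat mat" where
  "chain_inv_mat n = Matrix.mat (n * Suc n) (n * Suc n)
     (\<lambda>(c, r). chain_inv n (c mod n) (c div n) (r mod Suc n) (r div Suc n))"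

definition black_kraw_mat :: "nat \<Rightarrow> rat mat" where
  "black_kraw_mat n = Matrix.mat (n * Suc n) (n * Suc n)
     (\<lambda>(c, d). if c div n = d div n then krawtchouk (n - 1) (c mod n) (d mod n) else 0)"

definition white_kraw_mat :: "nat \<Rightarrow> rat mat" where
  "white_kraw_mat n = Matrix.mat (n * Suc n) (n * Suc n)
     (\<lambda>(r, s). if r div Suc n = s div Suc n then krawtchouk n (r mod Suc n) (s mod Suc n) else 0)"

lemma mats_carrier [simp]:
  "kast_mat n \<in> carrier_mat (n * Suc n) (n * Suc n)" "chain_mat n \<in> carrier_mat (n * Suc n) (n * Suc n)"
  "chain_inv_mat n \<in> carrier_mat (n * Suc n) (n * Suc n)" "black_kraw_mat n \<in> carrier_mat (n * Suc n) (n * Suc n)"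
  "white_kraw_mat n \<in> carrier_mat (n * Suc n) (n * Suc n)"
  by (simp_all add: kast_mat_def chain_mat_def chain_inv_mat_def black_kraw_mat_def white_kraw_mat_def white_black_mat_def)

lemma times_entry:
  assumes "A \<in> carrier_mat N N" "B \<in> carrier_mat N N" "r < N" "c < N"
  shows "(A * B) $$ (r, c) = (\<Sum>k = 0..<N. A $$ (r, k) * B $$ (k, c))"
  using assms by (simp add: scalar_prod_def)

text \<open>The adjacency matrix sends a sequence of polynomials \<open>f j\<close> to \<open>(1 + x) * f j + (1 - x) * f (j + 1)\<close>. Both
factors map the basis of order \<open>n - 1\<close> into the basis of order \<open>n\<close>; in terms of coefficients these are
the two recursions for \<open>krawtchouk\<close>.\<close>

lemma kast_mat_black_kraw_mat:
  assumes "0 < n"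
  shows "kast_mat n * black_kraw_mat n = white_kraw_mat n * chain_mat n"
proof (rule eq_matI)
  fix r c assume "r < dim_row (white_kraw_mat n * chain_mat n)" "c < dim_col (white_kraw_mat n * chain_mat n)"
  then have rc: "r < n * Suc n" "c < n * Suc n" by (simp_all add: white_kraw_mat_def chain_mat_def white_black_mat_def)
  obtain N where N: "n = Suc N" using assms by (cases n) auto
  define x y a j where xy: "x = r mod Suc n" "y = r div Suc n" "a = c mod n" "j = c div n"
  have b: "x \<le> n" "y < n" "a < n" "j \<le> n"
    using white_index[OF rc(1)] black_index[OF rc(2)] by (simp_all add: xy)
  have "(kast_mat n * black_kraw_mat n) $$ (r, c) = (\<Sum>k = 0..<Suc n * n. kast_weight x y (k mod n) (k div n) *
      (if k div n = j then krawtchouk N (k mod n) a else 0))"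
    using rc by (subst times_entry[of _ "n * Suc n"]) (auto simp: kast_mat_def black_kraw_mat_def white_black_mat_def xy N mult.commute intro!: sum.cong)
  also have "\<dots> = (\<Sum>j'<Suc n. \<Sum>i<n. kast_weight x y i j' * (if j' = j then krawtchouk N i a else 0))"
    by (rule sum_mod_div[of "\<lambda>i j'. kast_weight x y i j' * (if j' = j then krawtchouk N i a else 0)"])
  also have "\<dots> = (\<Sum>i<n. kast_weight x y i j * krawtchouk N i a)"
    using b by (subst sum.swap) (simp add: if_distrib[of "\<lambda>z. _ * z"] del: sum.lessThan_Suc cong: if_cong)
  also have "\<dots> = (\<Sum>i<n. (if i = x then (if j = y \<or> j = Suc y then krawtchouk N i a else 0) else 0) +
      (if Suc i = x then (if j = y then krawtchouk N i a else if j = Suc y then - krawtchouk N i a else 0) else 0))"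
    by (intro sum.cong refl) (auto simp: kast_weight_def)
  also have "\<dots> = (if j = y \<or> j = Suc y then krawtchouk N x a else 0) + (if x = 0 then 0 else
      if j = y then krawtchouk N (x - 1) a else if j = Suc y then - krawtchouk N (x - 1) a else 0)"
  proof -
    have "(\<Sum>i<n. if i = x then (if j = y \<or> j = Suc y then krawtchouk N i a else 0) else 0)
        = (if j = y \<or> j = Suc y then krawtchouk N x a else 0)"
      using b krawtchouk_eq_0[of a N x] by (auto simp: N)
    moreover have "(\<Sum>i<n. if Suc i = x then f i else 0) = (if x = 0 then 0 else f (x - 1))" for f :: "nat \<Rightarrow> rat"
      using b(1) by (cases x) auto
    ultimately show ?thesis by (simp only: sum.distrib)
  qed
  also have "\<dots> = (if j = y then krawtchouk n x a else if j = Suc y then krawtchouk n x (Suc a) else 0)"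
    using b krawtchouk_Suc_same[of a N x] krawtchouk_Suc_Suc[of N x a] by (auto simp: N)
  also have "\<dots> = (\<Sum>b<Suc n. krawtchouk n x b * chain b y a j)"
    using b by (auto simp: chain_def if_distrib[of "\<lambda>z. _ * z"] simp del: sum.lessThan_Suc cong: if_cong)
  also have "\<dots> = (\<Sum>y'<n. \<Sum>b<Suc n. (if y = y' then krawtchouk n x b else 0) * chain b y' a j)"
    using b by (subst sum.swap) (simp add: if_distrib[of "\<lambda>z. z * _"] del: sum.lessThan_Suc cong: if_cong)
  also have "\<dots> = (\<Sum>k = 0..<n * Suc n. (if y = k div Suc n then krawtchouk n x (k mod Suc n) else 0) *
      chain (k mod Suc n) (k div Suc n) a j)"
    by (rule sum_mod_div[of "\<lambda>b y'. (if y = y' then krawtchouk n x b else 0) * chain b y' a j", symmetric])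
  also have "\<dots> = (white_kraw_mat n * chain_mat n) $$ (r, c)"
    using rc by (subst times_entry[of _ "n * Suc n"]) (auto simp: chain_mat_def white_kraw_mat_def white_black_mat_def xy intro!: sum.cong)
  finally show "(kast_mat n * black_kraw_mat n) $$ (r, c) = (white_kraw_mat n * chain_mat n) $$ (r, c)" .
qed (simp_all add: kast_mat_def chain_mat_def black_kraw_mat_def white_kraw_mat_def white_black_mat_def)

lemma chain_mat_chain_inv_mat:
  assumes "0 < n"
  shows "chain_mat n * chain_inv_mat n = 1\<^sub>m (n * Suc n)"
proof (rule eq_matI)
  fix r c assume "r < dim_row (1\<^sub>m (n * Suc n) :: rat mat)" "c < dim_col (1\<^sub>m (n * Suc n) :: rat mat)"
  then have rc: "r < n * Suc n" "c < n * Suc n" by simp_all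
  define x y x' y' where xy: "x = r mod Suc n" "y = r div Suc n" "x' = c mod Suc n" "y' = c div Suc n"
  have b: "x \<le> n" "y < n" "x' \<le> n" "y' < n"
    using white_index[OF rc(1)] white_index[OF rc(2)] by (simp_all add: xy)
  have "(chain_mat n * chain_inv_mat n) $$ (r, c) = (\<Sum>k = 0..<Suc n * n. chain x y (k mod n) (k div n) *
      chain_inv n (k mod n) (k div n) x' y')"
    using rc by (subst times_entry[of _ "n * Suc n"]) (auto simp: chain_mat_def chain_inv_mat_def white_black_mat_def xy mult.commute intro!: sum.cong)
  also have "\<dots> = (\<Sum>j<Suc n. \<Sum>a<n. chain x y a j * chain_inv n a j x' y')"
    by (rule sum_mod_div[of "\<lambda>a j. chain x y a j * chain_inv n a j x' y'"])
  also have "\<dots> = (\<Sum>a<n. \<Sum>j<Suc n. (if j = y then (if x = a then chain_inv n a y x' y' else 0) else 0) +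
      (if j = Suc y then (if x = Suc a then chain_inv n a (Suc y) x' y' else 0) else 0))"
    by (subst sum.swap, intro sum.cong refl) (auto simp: chain_def)
  also have "\<dots> = (\<Sum>a<n. (if a = x then chain_inv n a y x' y' else 0) +
      (if Suc a = x then chain_inv n a (Suc y) x' y' else 0))"
    using b by (simp add: sum.distrib eq_commute[of x] del: sum.lessThan_Suc cong: if_cong)
  also have "\<dots> = (if x < n then chain_inv n x y x' y' else 0) +
      (if x = 0 then 0 else chain_inv n (x - 1) (Suc y) x' y')"
  proof -
    have "(\<Sum>a<n. if Suc a = x then f a else 0) = (if x = 0 then 0 else f (x - 1))" for f :: "nat \<Rightarrow> rat"
      using b(1) by (cases x) auto
    then show ?thesis using b by (simp add: sum.distrib)
  qed
  also have "\<dots> = (if x = x' \<and> y = y' then 1 else 0)"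
  proof (cases "x + y = x' + y'")
    case False
    then show ?thesis by (auto simp: chain_inv_def)
  next
    case True
    consider "y < y'" | "y = y'" | "y' < y" by linarith
    then show ?thesis
    proof cases
      case 1
      then have "y' - y = Suc (y' - Suc y)" by simp
      then show ?thesis using 1 True b by (auto simp: chain_inv_def)
    next
      case 2
      then show ?thesis using True b by (auto simp: chain_inv_def)
    next
      case 3
      then have "y - y' = Suc (y - Suc y')" by simp
      then show ?thesis using 3 True b by (auto simp: chain_inv_def)
    qed
  qed
  also have "\<dots> = 1\<^sub>m (n * Suc n) $$ (r, c)"
    using rc mod_div_eqI[of r "Suc n" c] by (auto simp: xy)
  finally show "(chain_mat n * chain_inv_mat n) $$ (r, c) = 1\<^sub>m (n * Suc n) $$ (r, c)" .
qed (simp_all add: chain_mat_def chain_inv_mat_def white_black_mat_def)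

lemma black_kraw_mat_square:
  assumes "0 < n"
  shows "black_kraw_mat n * black_kraw_mat n = 2 ^ (n - 1) \<cdot>\<^sub>m 1\<^sub>m (n * Suc n)"
proof (rule eq_matI)
  fix r c assume "r < dim_row (2 ^ (n - 1) \<cdot>\<^sub>m 1\<^sub>m (n * Suc n) :: rat mat)"
    "c < dim_col (2 ^ (n - 1) \<cdot>\<^sub>m 1\<^sub>m (n * Suc n) :: rat mat)"
  then have rc: "r < n * Suc n" "c < n * Suc n" by simp_all
  obtain N where N: "n = Suc N" using assms by (cases n) auto
  define x y x' y' where xy: "x = r mod n" "y = r div n" "x' = c mod n" "y' = c div n"
  have b: "x < n" "y \<le> n" "x' < n" "y' \<le> n"
    using black_index[OF rc(1)] black_index[OF rc(2)] by (simp_all add: xy)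
  have "(black_kraw_mat n * black_kraw_mat n) $$ (r, c) = (\<Sum>k = 0..<Suc n * n.
      (if y = k div n then krawtchouk (n - 1) x (k mod n) else 0) * (if k div n = y' then krawtchouk (n - 1) (k mod n) x' else 0))"
    using rc by (subst times_entry[of _ "n * Suc n"]) (auto simp: black_kraw_mat_def xy mult.commute intro!: sum.cong)
  also have "\<dots> = (\<Sum>j<Suc n. \<Sum>a<n. (if y = j then krawtchouk (n - 1) x a else 0) * (if j = y' then krawtchouk (n - 1) a x' else 0))"
    by (rule sum_mod_div[of "\<lambda>a j. (if y = j then krawtchouk (n - 1) x a else 0) * (if j = y' then krawtchouk (n - 1) a x' else 0)"])
  also have "\<dots> = (\<Sum>a<n. if y = y' then krawtchouk (n - 1) x a * krawtchouk (n - 1) a x' else 0)"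
    using b by (subst sum.swap, cases "y = y'") (simp_all add: if_distrib[of "\<lambda>z. z * _"] if_distrib[of "\<lambda>z. _ * z"] del: sum.lessThan_Suc cong: if_cong)
  also have "\<dots> = (if x = x' \<and> y = y' then 2 ^ (n - 1) else 0)"
    using b krawtchouk_involution[of x' N x] by (cases "y = y'") (simp_all add: N lessThan_Suc_atMost)
  also have "\<dots> = (2 ^ (n - 1) \<cdot>\<^sub>m 1\<^sub>m (n * Suc n)) $$ (r, c)"
    using rc mod_div_eqI[of r n c] by (auto simp: xy)
  finally show "(black_kraw_mat n * black_kraw_mat n) $$ (r, c) = (2 ^ (n - 1) \<cdot>\<^sub>m 1\<^sub>m (n * Suc n)) $$ (r, c)" .
qed (simp_all add: black_kraw_mat_def)

lemma white_kraw_mat_square: "white_kraw_mat n * white_kraw_mat n = 2 ^ n \<cdot>\<^sub>m 1\<^sub>m (n * Suc n)"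
proof (rule eq_matI)
  fix r c assume "r < dim_row (2 ^ n \<cdot>\<^sub>m 1\<^sub>m (n * Suc n) :: rat mat)"
    "c < dim_col (2 ^ n \<cdot>\<^sub>m 1\<^sub>m (n * Suc n) :: rat mat)"
  then have rc: "r < n * Suc n" "c < n * Suc n" by simp_all
  define x y x' y' where xy: "x = r mod Suc n" "y = r div Suc n" "x' = c mod Suc n" "y' = c div Suc n"
  have b: "x \<le> n" "y < n" "x' \<le> n" "y' < n"
    using white_index[OF rc(1)] white_index[OF rc(2)] by (simp_all add: xy)
  have "(white_kraw_mat n * white_kraw_mat n) $$ (r, c) = (\<Sum>k = 0..<n * Suc n.
      (if y = k div Suc n then krawtchouk n x (k mod Suc n) else 0) * (if k div Suc n = y' then krawtchouk n (k mod Suc n) x' else 0))"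
    using rc by (subst times_entry[of _ "n * Suc n"]) (auto simp: white_kraw_mat_def xy intro!: sum.cong)
  also have "\<dots> = (\<Sum>j<n. \<Sum>a<Suc n. (if y = j then krawtchouk n x a else 0) * (if j = y' then krawtchouk n a x' else 0))"
    by (rule sum_mod_div[of "\<lambda>a j. (if y = j then krawtchouk n x a else 0) * (if j = y' then krawtchouk n a x' else 0)"])
  also have "\<dots> = (\<Sum>a<Suc n. if y = y' then krawtchouk n x a * krawtchouk n a x' else 0)"
    using b by (subst sum.swap, cases "y = y'") (simp_all add: if_distrib[of "\<lambda>z. z * _"] if_distrib[of "\<lambda>z. _ * z"] del: sum.lessThan_Suc cong: if_cong)
  also have "\<dots> = (if x = x' \<and> y = y' then 2 ^ n else 0)"
    using b krawtchouk_involution[of x' n x] by (cases "y = y'") (simp_all add: lessThan_Suc_atMost del: sum.lessThan_Suc)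
  also have "\<dots> = (2 ^ n \<cdot>\<^sub>m 1\<^sub>m (n * Suc n)) $$ (r, c)"
    using rc mod_div_eqI[of r "Suc n" c] by (auto simp: xy)
  finally show "(white_kraw_mat n * white_kraw_mat n) $$ (r, c) = (2 ^ n \<cdot>\<^sub>m 1\<^sub>m (n * Suc n)) $$ (r, c)" .
qed (simp_all add: white_kraw_mat_def)

lemma det_in_Ints:
  assumes "\<And>r c. r < N \<Longrightarrow> c < N \<Longrightarrow> A $$ (r, c) \<in> \<int>" "A \<in> carrier_mat N N"
  shows "det A \<in> \<int>"
proof -
  have "A $$ (i, p i) \<in> \<int>" if "p permutes {0..<N}" "i \<in> {0..<N}" for p i
    using that assms(1) permutes_in_image[of p "{0..<N}" i] by auto
  then show ?thesis
    unfolding det_def'[OF assms(2)] by (intro Ints_sum Ints_mult Ints_prod) auto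
qed

text \<open>The chain matrix and its inverse are integral, so the determinant of the former is a unit. The change of
basis contributes \<open>2 ^ n\<close> for each white and \<open>2 ^ (n - 1)\<close> for each black square.\<close>

lemma det_kast_mat_square:
  assumes "0 < n"
  shows "det (kast_mat n) ^ 2 = 2 ^ (n * Suc n)"
proof -
  let ?N = "n * Suc n"
  obtain m where m: "n = Suc m" using assms by (cases n) auto
  have mult: "det (A * B) = det A * det B" if "A \<in> carrier_mat ?N ?N" "B \<in> carrier_mat ?N ?N" for A B :: "rat mat"
    using det_mult[OF that] .
  have L: "det (chain_mat n) * det (chain_inv_mat n) = 1"
    using mult[of "chain_mat n" "chain_inv_mat n"] chain_mat_chain_inv_mat[OF assms] by simp
  have LMi: "det (chain_mat n) \<in> \<int>"
    by (intro det_in_Ints[of ?N]) (auto simp: chain_mat_def white_black_mat_def chain_def)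
  have LIi: "det (chain_inv_mat n) \<in> \<int>"
    by (intro det_in_Ints[of ?N]) (auto simp: chain_inv_mat_def chain_inv_def)
  from LMi LIi obtain u v where "det (chain_mat n) = of_int u" "det (chain_inv_mat n) = of_int v" by (auto elim!: Ints_cases)
  then have "u * v = 1" using L by (metis of_int_1 of_int_eq_iff of_int_mult)
  then have "u ^ 2 = 1" by (auto simp: zmult_eq_1_iff)
  then have L2: "det (chain_mat n) ^ 2 = 1" using \<open>det (chain_mat n) = of_int u\<close> by (metis of_int_1 of_int_power)
  have B: "det (black_kraw_mat n) ^ 2 = (2 ^ (n - 1)) ^ ?N"
    using mult[of "black_kraw_mat n" "black_kraw_mat n"] black_kraw_mat_square[OF assms] by (simp add: power2_eq_square)
  have W: "det (white_kraw_mat n) ^ 2 = (2 ^ n) ^ ?N"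
    using mult[of "white_kraw_mat n" "white_kraw_mat n"] white_kraw_mat_square[of n] by (simp add: power2_eq_square)
  have "det (kast_mat n) * det (black_kraw_mat n) = det (white_kraw_mat n) * det (chain_mat n)"
    using mult[of "kast_mat n" "black_kraw_mat n"] mult[of "white_kraw_mat n" "chain_mat n"] kast_mat_black_kraw_mat[OF assms] by simp
  then have "det (kast_mat n) ^ 2 * det (black_kraw_mat n) ^ 2 = det (white_kraw_mat n) ^ 2 * det (chain_mat n) ^ 2"
    by (metis power_mult_distrib)
  then have "det (kast_mat n) ^ 2 * (2 ^ m) ^ ?N = (2 * 2 ^ m) ^ ?N"
    unfolding B W L2 by (simp add: m)
  then have "det (kast_mat n) ^ 2 * (2 ^ m) ^ ?N = 2 ^ ?N * (2 ^ m) ^ ?N"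
    by (simp only: power_mult_distrib)
  then show ?thesis by simp
qed

definition kast_inv_mat :: "nat \<Rightarrow> rat mat" where
  "kast_inv_mat n = (1 / 2 ^ n) \<cdot>\<^sub>m (black_kraw_mat n * (chain_inv_mat n * white_kraw_mat n))"

lemma kast_inv_mat_carrier [simp]: "kast_inv_mat n \<in> carrier_mat (n * Suc n) (n * Suc n)"
  unfolding kast_inv_mat_def by (intro smult_carrier_mat mult_carrier_mat[of _ _ "n * Suc n"]) simp_all

lemma kast_mat_inverse:
  assumes "0 < n"
  shows "kast_mat n * kast_inv_mat n = 1\<^sub>m (n * Suc n)"
proof -
  let ?N = "n * Suc n"
  have assoc: "(A * B) * C = A * (B * C)" if "A \<in> carrier_mat ?N ?N" "B \<in> carrier_mat ?N ?N" "C \<in> carrier_mat ?N ?N"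
    for A B C :: "rat mat" using assoc_mult_mat[OF that] .
  have c: "A * B \<in> carrier_mat ?N ?N" if "A \<in> carrier_mat ?N ?N" "B \<in> carrier_mat ?N ?N" for A B :: "rat mat"
    using that by simp
  have "kast_mat n * (black_kraw_mat n * (chain_inv_mat n * white_kraw_mat n)) = (kast_mat n * black_kraw_mat n) * (chain_inv_mat n * white_kraw_mat n)"
    by (rule assoc[symmetric]) (auto intro: c)
  also have "\<dots> = white_kraw_mat n * (chain_mat n * (chain_inv_mat n * white_kraw_mat n))"
    unfolding kast_mat_black_kraw_mat[OF assms] by (rule assoc) (auto intro: c)
  also have "chain_mat n * (chain_inv_mat n * white_kraw_mat n) = (chain_mat n * chain_inv_mat n) * white_kraw_mat n"
    by (rule assoc[symmetric]) (auto intro: c)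
  also have "white_kraw_mat n * ((chain_mat n * chain_inv_mat n) * white_kraw_mat n) = white_kraw_mat n * white_kraw_mat n"
    by (simp only: chain_mat_chain_inv_mat[OF assms] left_mult_one_mat[OF mats_carrier(5)])
  finally have "kast_mat n * (black_kraw_mat n * (chain_inv_mat n * white_kraw_mat n)) = 2 ^ n \<cdot>\<^sub>m 1\<^sub>m ?N" by (simp only: white_kraw_mat_square)
  then show ?thesis unfolding kast_inv_mat_def
    by (subst mult_smult_distrib[of _ ?N ?N _ ?N]) (auto intro!: eq_matI c)
qed

lemma kast_inv_mat_entry:
  assumes "c < n * Suc n" "r < n * Suc n"
  shows "kast_inv_mat n $$ (c, r) = (\<Sum>a<n. \<Sum>b<Suc n. krawtchouk (n - 1) (c mod n) a *
      chain_inv n a (c div n) b (r div Suc n) * krawtchouk n b (r mod Suc n)) / 2 ^ n"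
proof -
  let ?N = "n * Suc n"
  define x y i j where xy: "x = r mod Suc n" "y = r div Suc n" "i = c mod n" "j = c div n"
  have b: "x \<le> n" "y < n" "i < n" "j \<le> n"
    using white_index[OF assms(2)] black_index[OF assms(1)] by (simp_all add: xy)
  have LP: "(chain_inv_mat n * white_kraw_mat n) $$ (d, r) = (\<Sum>b<Suc n. chain_inv n (d mod n) (d div n) b y * krawtchouk n b x)"
    if "d < ?N" for d
  proof -
    have "(chain_inv_mat n * white_kraw_mat n) $$ (d, r) = (\<Sum>k = 0..<n * Suc n. chain_inv n (d mod n) (d div n) (k mod Suc n) (k div Suc n)
       * (if k div Suc n = y then krawtchouk n (k mod Suc n) x else 0))"
      using that assms by (subst times_entry[of _ ?N]) (auto simp: chain_inv_mat_def white_kraw_mat_def xy intro!: sum.cong)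
    also have "\<dots> = (\<Sum>y'<n. \<Sum>b<Suc n. chain_inv n (d mod n) (d div n) b y'
       * (if y' = y then krawtchouk n b x else 0))"
      by (rule sum_mod_div[of "\<lambda>b y'. chain_inv n (d mod n) (d div n) b y' * (if y' = y then krawtchouk n b x else 0)"])
    also have "\<dots> = (\<Sum>b<Suc n. chain_inv n (d mod n) (d div n) b y * krawtchouk n b x)"
      using b by (subst sum.swap) (simp add: if_distrib[of "\<lambda>z. _ * z"] del: sum.lessThan_Suc cong: if_cong)
    finally show ?thesis .
  qed
  have "(black_kraw_mat n * (chain_inv_mat n * white_kraw_mat n)) $$ (c, r) = (\<Sum>k = 0..<Suc n * n. (if j = k div n then krawtchouk (n - 1) i (k mod n) else 0) *
      (\<Sum>b<Suc n. chain_inv n (k mod n) (k div n) b y * krawtchouk n b x))"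
  proof -
    have carr: "chain_inv_mat n * white_kraw_mat n \<in> carrier_mat ?N ?N" by (rule mult_carrier_mat[OF mats_carrier(3) mats_carrier(5)])
    have "(black_kraw_mat n * (chain_inv_mat n * white_kraw_mat n)) $$ (c, r) = (\<Sum>k = 0..<?N. (if j = k div n then krawtchouk (n - 1) i (k mod n) else 0) *
        (\<Sum>b<Suc n. chain_inv n (k mod n) (k div n) b y * krawtchouk n b x))"
      unfolding times_entry[OF mats_carrier(4) carr assms]
      by (intro sum.cong refl) (use assms in \<open>simp add: LP, simp add: black_kraw_mat_def xy\<close>)
    then show ?thesis by (simp only: mult.commute[of n])
  qed
  also have "\<dots> = (\<Sum>j'<Suc n. \<Sum>a<n. (if j = j' then krawtchouk (n - 1) i a else 0) *
      (\<Sum>b<Suc n. chain_inv n a j' b y * krawtchouk n b x))"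
    by (rule sum_mod_div[of "\<lambda>a j'. (if j = j' then krawtchouk (n - 1) i a else 0) *
      (\<Sum>b<Suc n. chain_inv n a j' b y * krawtchouk n b x)"])
  also have "\<dots> = (\<Sum>a<n. krawtchouk (n - 1) i a * (\<Sum>b<Suc n. chain_inv n a j b y * krawtchouk n b x))"
    using b by (subst sum.swap) (simp add: if_distrib[of "\<lambda>z. z * _"] del: sum.lessThan_Suc cong: if_cong)
  also have "\<dots> = (\<Sum>a<n. \<Sum>b<Suc n. krawtchouk (n - 1) i a * chain_inv n a j b y * krawtchouk n b x)"
    unfolding sum_distrib_left by (intro sum.cong refl) (simp add: mult.assoc)
  finally show ?thesis
    using assms by (simp add: kast_inv_mat_def xy black_kraw_mat_def white_kraw_mat_def)
qed

text \<open>An edge weight times the entry of the inverse matrix is the probability of that edge. For the three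
other directions the sum is brought into the form of \<open>edge_prob\<close> by the two reflections of Krawtchouk
coefficients, which correspond to the reflections of the diamond in the lines of slope \<open>1\<close> and \<open>-1\<close> through its centre; the signs produced on
the way cancel the edge weight.\<close>

lemma kast_times_inverse_entry:
  assumes c: "c < n * Suc n" and r: "r < n * Suc n" and
    adj: "kast_weight (r mod Suc n) (r div Suc n) (c mod n) (c div n) \<noteq> 0"
  shows "kast_weight (r mod Suc n) (r div Suc n) (c mod n) (c div n) * kast_inv_mat n $$ (c, r) =
     edge_prob n (if r mod Suc n = c mod n then c mod n else n - 1 - c mod n)
            (if c div n = r div Suc n then c div n else n - c div n)"
proof -
  define x y i j where xy: "x = r mod Suc n" "y = r div Suc n" "i = c mod n" "j = c div n"
  have b: "x \<le> n" "y < n" "i < n" "j \<le> n"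
    using white_index[OF r] black_index[OF c] by (simp_all add: xy)
  have xi: "x = i \<or> x = Suc i" and jy: "j = y \<or> j = Suc y"
    using adj by (auto simp: kast_weight_def xy split: if_splits)
  have refl1: "krawtchouk n a (Suc i) * krawtchouk (n - 1) i a = krawtchouk n a (n - 1 - i) * krawtchouk (n - 1) (n - 1 - i) a" if "a < n" for a
    using b that krawtchouk_reflect_param[of "Suc i" n a] krawtchouk_reflect_index[of i "n - 1" a]
    by (simp add: power_add[symmetric] mult.left_commute )
  show ?thesis
  proof (cases "j = y")
    case True
    have "kast_inv_mat n $$ (c, r) = (\<Sum>a<n. \<Sum>b<Suc n. if b = a then (if a + j < n then krawtchouk (n - 1) i a * krawtchouk n a x else 0) else 0) / 2 ^ n"
      unfolding kast_inv_mat_entry[OF c r] xy[symmetric]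
      by (intro arg_cong2[of _ _ _ _ "(/)"] sum.cong refl) (auto simp: chain_inv_def True)
    also have "\<dots> = (\<Sum>a<n. if a < n - j then krawtchouk n a x * krawtchouk (n - 1) i a else 0) / 2 ^ n"
      by (intro arg_cong2[of _ _ _ _ "(/)"] sum.cong refl) (auto simp: mult.commute)
    also have "\<dots> = (\<Sum>a<n - j. krawtchouk n a x * krawtchouk (n - 1) i a) / 2 ^ n"
      by (intro arg_cong2[of _ _ _ _ "(/)"] refl sum.mono_neutral_cong_right) auto
    also have "\<dots> = edge_prob n (if x = i then i else n - 1 - i) j"
      using xi refl1 by (auto simp: edge_prob_def)
    finally show ?thesis using xi True by (auto simp: kast_weight_def xy[symmetric])
  next
    case False
    then have jy: "j = Suc y" using jy by simp
    have "kast_inv_mat n $$ (c, r) = (\<Sum>a<n. \<Sum>b<Suc n. if b = Suc a then (if n \<le> a + j then krawtchouk (n - 1) i a * krawtchouk n (Suc a) x else 0) else 0) / 2 ^ n"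
      unfolding kast_inv_mat_entry[OF c r] xy[symmetric]
      by (intro arg_cong2[of _ _ _ _ "(/)"] sum.cong refl) (auto simp: chain_inv_def jy)
    also have "\<dots> = (\<Sum>a<n. if n \<le> a + j then krawtchouk n (Suc a) x * krawtchouk (n - 1) i a else 0) / 2 ^ n"
      by (intro arg_cong2[of _ _ _ _ "(/)"] sum.cong refl) (auto simp: mult.commute)
    also have "\<dots> = (\<Sum>a\<in>{n - j..<n}. krawtchouk n (Suc a) x * krawtchouk (n - 1) i a) / 2 ^ n"
      by (intro arg_cong2[of _ _ _ _ "(/)"] refl sum.mono_neutral_cong_right) auto
    also have "\<dots> = (\<Sum>a<j. krawtchouk n (n - a) x * krawtchouk (n - 1) i (n - 1 - a)) / 2 ^ n"
      using b by (intro arg_cong2[of _ _ _ _ "(/)"] refl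
         sum.reindex_bij_witness[of _ "\<lambda>a. n - 1 - a" "\<lambda>a. n - 1 - a"]) auto
    also have "\<dots> = (\<Sum>a<j. (-1) ^ x * (-1) ^ i * (krawtchouk n a x * krawtchouk (n - 1) i a)) / 2 ^ n"
    proof -
      have "krawtchouk n (n - a) x = (-1) ^ x * krawtchouk n a x" "krawtchouk (n - 1) i (n - 1 - a) = (-1) ^ i * krawtchouk (n - 1) i a"
        if "a < j" for a
        using that b krawtchouk_reflect_index[of a n x] krawtchouk_reflect_param[of a "n - 1" i] by simp_all
      then show ?thesis
        by (intro arg_cong2[of _ _ _ _ "(/)"] refl sum.cong) (simp_all del: diff_diff_left)
    qed
    also have "\<dots> = (if x = i then 1 else -1) * edge_prob n (if x = i then i else n - 1 - i) (n - j)"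
      using xi refl1 b by (auto simp: edge_prob_def sum_negf power_add[symmetric])
    finally show ?thesis using xi False jy by (auto simp: kast_weight_def xy[symmetric])
  qed
qed

text \<open>A black square is covered by exactly one of the dominoes that contain it. In terms of matrices this is a
diagonal entry of the inverse times the matrix. For \<open>j = 0\<close> and \<open>j = n\<close> only two dominoes exist and two of
the terms vanish.\<close>

lemma edge_prob_sum:
  assumes "i < n" "j \<le> n"
  shows "edge_prob n i j + edge_prob n (n - 1 - i) j + edge_prob n i (n - j) + edge_prob n (n - 1 - i) (n - j) = 1"
proof -
  let ?N = "n * Suc n"
  have n: "0 < n" using assms by simp
  have c: "j * n + i < ?N" using assms by (intro black_row_index_less) simp_all
  have cm: "(j * n + i) mod n = i" "(j * n + i) div n = j" using assms by simp_all
  have "kast_inv_mat n * kast_mat n = 1\<^sub>m ?N"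
    by (rule mat_mult_left_right_inverse[OF _ _ kast_mat_inverse[OF n]]) simp_all
  then have "1 = (kast_inv_mat n * kast_mat n) $$ (j * n + i, j * n + i)" using c by simp
  also have "\<dots> = (\<Sum>r = 0..<?N. kast_inv_mat n $$ (j * n + i, r) * kast_weight (r mod Suc n) (r div Suc n) i j)"
    using c assms by (subst times_entry[of _ ?N]) (auto simp: kast_mat_def white_black_mat_def intro!: sum.cong)
  also have "\<dots> = (\<Sum>r = 0..<?N. if kast_weight (r mod Suc n) (r div Suc n) i j = 0 then 0 else
       edge_prob n (if r mod Suc n = i then i else n - 1 - i) (if j = r div Suc n then j else n - j))"
    using kast_times_inverse_entry[OF c, unfolded cm] by (intro sum.cong refl) (simp add: mult.commute[of "kast_inv_mat _ $$ _"])
  also have "\<dots> = (\<Sum>y<n. \<Sum>x<Suc n. if kast_weight x y i j = 0 then 0 else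
       edge_prob n (if x = i then i else n - 1 - i) (if j = y then j else n - j))"
    by (rule sum_mod_div[of "\<lambda>x y. if kast_weight x y i j = 0 then 0 else
       edge_prob n (if x = i then i else n - 1 - i) (if j = y then j else n - j)"])
  also have "\<dots> = (\<Sum>y<n. \<Sum>x<Suc n. (if x = i then (if y = j \<or> Suc y = j then edge_prob n i (if j = y then j else n - j) else 0) else 0) +
      (if x = Suc i then (if y = j \<or> Suc y = j then edge_prob n (n - 1 - i) (if j = y then j else n - j) else 0) else 0))"
    by (intro sum.cong refl) (auto simp: kast_weight_def)
  also have "\<dots> = (\<Sum>y<n. if y = j \<or> Suc y = j then edge_prob n i (if j = y then j else n - j)
      + edge_prob n (n - 1 - i) (if j = y then j else n - j) else 0)"
    using assms by (intro sum.cong refl) (simp add: sum.distrib del: sum.lessThan_Suc)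
  also have "\<dots> = (\<Sum>y<n. (if y = j then edge_prob n i j + edge_prob n (n - 1 - i) j else 0) +
     (if Suc y = j then edge_prob n i (n - j) + edge_prob n (n - 1 - i) (n - j) else 0))"
    by (intro sum.cong refl) auto
  also have "\<dots> = (if j < n then edge_prob n i j + edge_prob n (n - 1 - i) j else 0) +
     (if j = 0 then 0 else edge_prob n i (n - j) + edge_prob n (n - 1 - i) (n - j))"
  proof -
    have "(\<Sum>y<n. if Suc y = j then z else 0) = (if j = 0 then 0 else z)" for z :: rat
      using assms by (cases j) auto
    then show ?thesis by (simp add: sum.distrib)
  qed
  also have "\<dots> = edge_prob n i j + edge_prob n (n - 1 - i) j + (edge_prob n i (n - j) + edge_prob n (n - 1 - i) (n - j))"
    by (auto simp: edge_prob_def)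
  finally show ?thesis by simp
qed

section \<open>Signs of perfect matchings\<close>

definition inversions :: "nat \<Rightarrow> (nat \<Rightarrow> nat) \<Rightarrow> (nat \<times> nat) set" where
  "inversions N p = {(i, j). i < j \<and> j < N \<and> p j < p i}"

lemma prod_pairs_permutes:
  fixes f :: "nat \<Rightarrow> nat \<Rightarrow> int"
  assumes p: "p permutes {0..<N}" and sym: "\<And>x y. f x y = f y x"
  shows "(\<Prod>(i, j)\<in>{(i, j). i < j \<and> j < N}. f (p i) (p j)) = (\<Prod>(i, j)\<in>{(i, j). i < j \<and> j < N}. f i j)"
proof -
  let ?ip = "inv_into UNIV p"
  let ?sort = "\<lambda>(q :: nat \<Rightarrow> nat) (i, j). if q i < q j then (q i, q j) else (q j, q i)"
  have lt: "q i < N" if "q permutes {0..<N}" "i < N" for q i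
    using permutes_in_image[OF that(1), of i] that(2) by simp
  have inj: "q i = q j \<longleftrightarrow> i = j" if "q permutes {0..<N}" for q i j
    using permutes_inj[OF that] by (auto simp: inj_def)
  note pi = permutes_inv[OF p]
  have "?ip (p i) = i" "p (?ip i) = i" for i
    using permutes_inverses[OF p] by simp_all
  note pp = this lt[OF p] lt[OF pi] inj[OF p] inj[OF pi]
  let ?P = "{(i, j). i < j \<and> j < N}"
  have "(\<Prod>z\<in>?P. f (p (fst z)) (p (snd z))) = (\<Prod>z\<in>?P. f (fst z) (snd z))"
  proof (rule prod.reindex_bij_witness[of _ "?sort ?ip" "?sort p"])
    fix z assume "z \<in> ?P"
    then obtain i j where z: "z = (i, j)" "i < j" "j < N" by auto
    then have "p i \<noteq> p j" "?ip i \<noteq> ?ip j" using pp by auto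
    then have ne: "p i < p j \<or> p j < p i" "?ip i < ?ip j \<or> ?ip j < ?ip i" by auto
    show "?sort ?ip (?sort p z) = z" "?sort p (?sort ?ip z) = z"
      using z pp by auto
    show "?sort p z \<in> ?P" "?sort ?ip z \<in> ?P"
      using z pp ne by auto
    show "f (fst (?sort p z)) (snd (?sort p z)) = f (p (fst z)) (p (snd z))"
      using z by (auto intro: sym)
  qed
  then show ?thesis by (simp add: case_prod_beta)
qed

text \<open>The product of the signs of all pairs is multiplicative, because the change that a permutation makes to
the order of a pair depends on the unordered pair only. So it suffices to know that a transposition of
\<open>a < b\<close> has the odd number \<open>2 * (b - a) - 1\<close> of inversions.\<close>

lemma sign_eq_inversions:
  assumes "p permutes {0..<N}"
  shows "sign p = (-1) ^ card (inversions N p)"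
proof -
  define P where "P = {(i, j). i < j \<and> j < N}"
  have finP: "finite P" by (rule finite_subset[of _ "{..<N} \<times> {..<N}"]) (auto simp: P_def)
  \<comment> \<open>\<open>s q x y\<close> tells whether \<open>q\<close> preserves the order of \<open>x\<close> and \<open>y\<close>; it is symmetric in \<open>x\<close> and \<open>y\<close> for injective \<open>q\<close>.\<close>
  define s where "s q x y = (if (x < y) = (q x < q y) then 1 else -1 :: int)" for q :: "nat \<Rightarrow> nat" and x y
  define e where "e q = (\<Prod>(i, j)\<in>P. s q i j)" for q
  have e_eq: "e q = (-1) ^ card (inversions N q)" if "q permutes {0..<N}" for q
  proof -
    have inj: "q i = q j \<longleftrightarrow> i = j" for i j
      using permutes_inj[OF that] by (auto simp: inj_def)
    have "e q = (\<Prod>z\<in>P. if z \<in> inversions N q then -1 else 1)"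
      unfolding e_def by (intro prod.cong refl)
        (auto simp: s_def P_def inversions_def not_less order.order_iff_strict inj split: if_splits)
    also have "\<dots> = (\<Prod>z\<in>inversions N q. -1)"
      using finP by (intro prod.mono_neutral_cong_right) (auto simp: P_def inversions_def)
    finally show ?thesis by simp
  qed
  have "sign p = e p"
    using assms finite_atLeastLessThan[of 0 N]
  proof (induction rule: permutes_induct)
    case id
    then show ?case by (simp add: e_def s_def)
  next
    case (swap a b q)
    let ?t = "Transposition.transpose a b"
    have t: "?t permutes {0..<N}" using swap by (intro permutes_swap_id) auto
    have inj: "q i = q j \<longleftrightarrow> i = j" for i j
      using permutes_inj[OF swap(4)] by (auto simp: inj_def)
    have tinj: "?t i = ?t j \<longleftrightarrow> i = j" for i j
      by (rule inj_eq[OF permutes_inj[OF t]])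
    have "e (?t \<circ> q) = (\<Prod>(i, j)\<in>P. s ?t (q i) (q j) * s q i j)"
      unfolding e_def by (intro prod.cong refl) (auto simp: s_def P_def)
    also have "\<dots> = (\<Prod>(i, j)\<in>P. s ?t (q i) (q j)) * e q"
      unfolding e_def by (simp add: case_prod_beta prod.distrib)
    also have "(\<Prod>(i, j)\<in>P. s ?t (q i) (q j)) = e ?t"
      unfolding e_def P_def
      by (rule prod_pairs_permutes[OF swap(4)])
         (auto simp: s_def not_less order.order_iff_strict tinj)
    also have "e ?t = -1"
    proof -
      have main: "odd (card (inversions N (Transposition.transpose a b)))" if "a < b" "b < N" for a b
      proof -
        have "inversions N (Transposition.transpose a b) = Pair a ` {a<..b} \<union> (\<lambda>i. (i, b)) ` {a<..<b}"
          using that by (auto simp: inversions_def Transposition.transpose_def split: if_splits)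
        also have "card \<dots> = (b - a) + (b - a - 1)"
          by (subst card_Un_disjoint) (auto simp: card_image inj_on_def)
        finally show ?thesis using that by presburger
      qed
      have "odd (card (inversions N ?t))"
      proof (cases "a < b")
        case True
        then show ?thesis using main[of a b] swap by simp
      next
        case False
        then show ?thesis using main[of b a] swap by (simp add: transpose_commute)
      qed
      then show ?thesis using e_eq[OF t] by simp
    qed
    finally have "e (?t \<circ> q) = - e q" by (simp only: mult_minus1)
    moreover have "sign (?t \<circ> q) = - sign q"
      using swap t by (subst sign_compose) (auto intro: permutes_imp_permutation simp: sign_swap_id)
    ultimately show ?case using swap by (simp only:)
  qed
  then show ?thesis using e_eq[OF assms] by simp
qed

text \<open>Here \<open>p r\<close> is the black partner of the white square \<open>r\<close>. Call \<open>r\<close> a down square if its partner lies in the black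
row numbered one higher than its own, and an up square if the row numbers agree. Matched pairs can be inverted only if
one white square \<open>d\<close> is down, the other one \<open>u\<close> is up, and they share the black row of \<open>d\<close> or the white row
of \<open>d\<close>. In the black row, the up partners before the partner \<open>I d\<close> of \<open>d\<close> number \<open>I d\<close> minus the down partners before it.
In the white row, the up squares after \<open>X d\<close> number \<open>n - X d\<close> minus the down squares after it. The down
squares of a row and their partners come in the same order, so the two corrections have equal sums and cancel
modulo 2. What remains is the sum of \<open>I d + n - X d\<close> over the down squares, which is \<open>n\<close> times their number
minus the number of edges of weight \<open>-1\<close>. Finally, the number of down squares is the difference of the sums of the
row numbers of all black and of all white squares, hence the same for all matchings.\<close>

lemma sign_weight_constant:
  assumes p: "p permutes {0..<n * Suc n}"
    and adj: "\<And>r. r < n * Suc n \<Longrightarrow>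
       (r mod Suc n = p r mod n \<or> r mod Suc n = Suc (p r mod n)) \<and>
       (p r div n = r div Suc n \<or> p r div n = Suc (r div Suc n))"
  shows "even (card (inversions (n * Suc n) p) +
     card {r. r < n * Suc n \<and> p r div n = Suc (r div Suc n) \<and> r mod Suc n = Suc (p r mod n)}) \<longleftrightarrow>
     even (n * ((\<Sum>r<n * Suc n. r div n) - (\<Sum>r<n * Suc n. r div Suc n)))"
proof (cases "n = 0")
  case True
  then show ?thesis by (simp add: inversions_def)
next
  case False
  define N where "N = n * Suc n"
  define X Y I J where "X r = r mod Suc n" and "Y r = r div Suc n" and "I r = p r mod n" and "J r = p r div n" for r
  note defs = X_def Y_def I_def J_def
  have pN: "p r < N" if "r < N" for r
    using permutes_in_image[OF p, of r] that by (simp add: N_def)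
  have a1: "X r = I r \<or> X r = Suc (I r)" and a2: "J r = Y r \<or> J r = Suc (Y r)" if "r < N" for r
    using adj[of r] that by (auto simp: defs N_def)
  have Xn: "X r \<le> n" and Iln: "I r < n" for r using False by (simp_all add: defs less_Suc_eq_le[symmetric])
  have lessW: "r < s \<longleftrightarrow> Y r < Y s \<or> (Y r = Y s \<and> X r < X s)" for r s
    using lex_less_iff[of "Suc n" r s] by (simp add: defs)
  have lessB: "p r < p s \<longleftrightarrow> J r < J s \<or> (J r = J s \<and> I r < I s)" for r s
    using lex_less_iff[of n "p r" "p s"] False by (simp add: defs)
  have injp: "p r = p s \<longleftrightarrow> r = s" for r s
    using permutes_inj[OF p] by (auto simp: inj_def)
  have injB: "r = s" if "J r = J s" "I r = I s" for r s
    using mod_div_eqI[of "p r" n "p s"] that unfolding defs injp by blast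
  have injW: "r = s" if "Y r = Y s" "X r = X s" for r s
    using mod_div_eqI[of r "Suc n" s] that unfolding defs by blast
  define D where "D = {r. r < N \<and> J r = Suc (Y r)}"
  define Z where "Z = {r. r < N \<and> J r = Suc (Y r) \<and> X r = Suc (I r)}"
  have finD: "finite D" by (simp add: D_def)
  have ZD: "Z = {d \<in> D. X d = Suc (I d)}" by (auto simp: Z_def D_def)
  \<comment> \<open>\<open>A d\<close> and \<open>B d\<close> collect the inversions of \<open>d\<close> within its black row and within its white row.\<close>
  define A B where "A d = {u. u < N \<and> J u = Y u \<and> Y u = Suc (Y d) \<and> I u < I d}"
    and "B d = {u. u < N \<and> J u = Y u \<and> Y u = Y d \<and> X d < X u}" for d
  have inv: "inversions N p = Sigma D (\<lambda>d. A d \<union> B d)"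
  proof -
    have "(r, s) \<in> Sigma D (\<lambda>d. A d \<union> B d)" if "(r, s) \<in> inversions N p" for r s
    proof -
    have rs: "r < s" "s < N" "p s < p r" using that by (simp_all add: inversions_def)
    then have "r < N" by simp
    then show ?thesis
      using rs a1[of r] a1[of s] a2[of r] a2[of s] lessW[of r s] lessB[of s r]
      by (auto simp: D_def A_def B_def)
    qed
    moreover have "(d, u) \<in> inversions N p" if "d \<in> D" "u \<in> A d \<union> B d" for d u
    proof -
      have "d < u" by (rule iffD2[OF lessW]) (use that in \<open>auto simp: A_def B_def\<close>)
      moreover have "p u < p d" by (rule iffD2[OF lessB]) (use that in \<open>auto simp: D_def A_def B_def\<close>)
      moreover have "u < N" using that by (auto simp: A_def B_def)
      ultimately show ?thesis by (simp add: inversions_def)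
    qed
    ultimately show ?thesis by auto
  qed
  \<comment> \<open>The down squares that the two counts have to exclude.\<close>
  define A' B' where "A' d = {e\<in>D. Y e = Y d \<and> I e < I d}" and "B' d = {e\<in>D. Y e = Y d \<and> X d < X e}" for d
  have fin: "finite (A d)" "finite (B d)" "finite (A' d)" "finite (B' d)" for d
    using finD by (simp_all add: A_def B_def A'_def B'_def)
  have cardA: "card (A d) + card (A' d) = I d" if d: "d \<in> D" for d
  proof -
    have dN: "d < N" using d by (simp add: D_def)
    have "bij_betw I {r. r < N \<and> J r = J d \<and> I r < I d} {..<I d}"
    proof (rule bij_betw_imageI)
      show "inj_on I {r. r < N \<and> J r = J d \<and> I r < I d}"
        using injB by (auto intro!: inj_onI)
      show "I ` {r. r < N \<and> J r = J d \<and> I r < I d} = {..<I d}"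
      proof (intro equalityI subsetI)
        fix i assume "i \<in> {..<I d}"
        then have i: "i < I d" by simp
        define c where "c = J d * n + i"
        have cm: "c mod n = i" "c div n = J d" using i Iln[of d] by (simp_all add: c_def)
        have "c < p d" using lex_less_iff[of n c "p d"] False i by (simp add: cm) (simp add: defs)
        then have "c < N" using pN[OF dN] by simp
        then obtain r where r: "r < N" "p r = c"
        proof -
          have "c \<in> p ` {0..<N}" using \<open>c < N\<close> permutes_image[OF p] by (simp add: N_def)
          then show thesis using that by auto
        qed
        then have "I r = i" "J r = J d" using cm by (simp_all only: defs)
        then show "i \<in> I ` {r. r < N \<and> J r = J d \<and> I r < I d}"
          using r(1) i by (intro image_eqI[of _ _ r]) simp_all
      qed auto
    qed
    then have "card {r. r < N \<and> J r = J d \<and> I r < I d} = I d"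
      by (simp add: bij_betw_same_card[of I])
    moreover have "{r. r < N \<and> J r = J d \<and> I r < I d} = A d \<union> A' d"
    proof -
      have "J r = J d \<longleftrightarrow> (J r = Y r \<and> Y r = Suc (Y d)) \<or> (J r = Suc (Y r) \<and> Y r = Y d)" if "r < N" for r
        using a2[OF that] d by (auto simp: D_def)
      then show ?thesis unfolding A_def A'_def D_def by blast
    qed
    moreover have "A d \<inter> A' d = {}" by (auto simp: A_def A'_def D_def)
    ultimately show ?thesis using fin by (simp add: card_Un_disjoint)
  qed
  have cardB: "card (B d) + card (B' d) = n - X d" if d: "d \<in> D" for d
  proof -
    have dN: "d < N" using d by (simp add: D_def)
    have "bij_betw X {r. r < N \<and> Y r = Y d \<and> X d < X r} {X d<..n}"
    proof (rule bij_betw_imageI)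
      show "inj_on X {r. r < N \<and> Y r = Y d \<and> X d < X r}"
        using injW by (auto intro!: inj_onI)
      show "X ` {r. r < N \<and> Y r = Y d \<and> X d < X r} = {X d<..n}"
      proof (intro equalityI subsetI)
        fix x assume x: "x \<in> {X d<..n}"
        define r where "r = Y d * Suc n + x"
        have rm: "X r = x" "Y r = Y d" using x by (simp_all add: r_def defs)
        have "Y d < n" using dN unfolding defs N_def by (rule less_mult_imp_div_less)
        then have "Suc (Y d) * Suc n \<le> n * Suc n" by (intro mult_right_mono) auto
        then have "r < N" using x by (simp add: r_def N_def)
        then show "x \<in> X ` {r. r < N \<and> Y r = Y d \<and> X d < X r}"
          using rm x by (intro image_eqI[of _ _ r]) simp_all
      qed (use Xn in auto)
    qed
    then have "card {r. r < N \<and> Y r = Y d \<and> X d < X r} = n - X d"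
      by (simp add: bij_betw_same_card[of X])
    moreover have "{r. r < N \<and> Y r = Y d \<and> X d < X r} = B d \<union> B' d"
      using a2 unfolding B_def B'_def D_def by blast
    moreover have "B d \<inter> B' d = {}" by (auto simp: B_def B'_def D_def)
    ultimately show ?thesis using fin by (simp add: card_Un_disjoint)
  qed
  have order: "I e < I d \<longleftrightarrow> X e < X d" if "d \<in> D" "e \<in> D" "Y e = Y d" for d e
  proof -
    have "J e = J d" "d < N" "e < N" using that by (simp_all add: D_def)
    then have "I e = I d \<Longrightarrow> e = d" "X e = X d \<Longrightarrow> e = d"
      using injB[of e d] injW[of e d] that by auto
    moreover note a1[OF \<open>d < N\<close>] a1[OF \<open>e < N\<close>]
    ultimately show ?thesis by (cases "e = d") (simp, linarith)
  qed
  have S: "(\<Sum>d\<in>D. card (A' d)) = (\<Sum>d\<in>D. card (B' d))"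
  proof -
    have "(\<Sum>d\<in>D. card (A' d)) = card (Sigma D A')" using finD fin by simp
    also have "\<dots> = card (Sigma D B')"
      by (rule bij_betw_same_card[of prod.swap], rule bij_betw_byWitness[of _ prod.swap])
         (auto simp: A'_def B'_def order)
    also have "\<dots> = (\<Sum>d\<in>D. card (B' d))" using finD fin by simp
    finally show ?thesis .
  qed
  have "card (inversions N p) = (\<Sum>d\<in>D. card (A d) + card (B d))"
    unfolding inv using finD fin by (subst card_SigmaI) (auto intro!: sum.cong card_Un_disjoint simp: A_def B_def)
  then have "card (inversions N p) + 2 * (\<Sum>d\<in>D. card (A' d))
      = (\<Sum>d\<in>D. (card (A d) + card (A' d)) + (card (B d) + card (B' d)))"
    using S by (simp add: sum.distrib)
  also have "\<dots> = (\<Sum>d\<in>D. I d + (n - X d))" using cardA cardB by simp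
  finally have "card (inversions N p) + 2 * (\<Sum>d\<in>D. card (A' d)) + card Z
      = (\<Sum>d\<in>D. I d + (n - X d)) + (\<Sum>d\<in>D. if X d = Suc (I d) then 1 else 0)"
    using finD by (simp add: ZD sum.If_cases Int_def)
  also have "\<dots> = (\<Sum>d\<in>D. n)"
  proof -
    have "I d + (n - X d) + (if X d = Suc (I d) then 1 else 0) = n" if "d \<in> D" for d
      using that a1[of d] Xn[of d] by (auto simp: D_def)
    then show ?thesis unfolding sum.distrib[symmetric] by (intro sum.cong refl)
  qed
  finally have 1: "card (inversions N p) + 2 * (\<Sum>d\<in>D. card (A' d)) + card Z = n * card D" by simp
  have "(\<Sum>r<N. p r div n) = (\<Sum>r<N. Y r + (if r \<in> D then 1 else 0))"
  proof (intro sum.cong refl)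
    fix r assume "r \<in> {..<N}"
    then show "p r div n = Y r + (if r \<in> D then 1 else 0)"
      using a2[of r] by (auto simp: D_def J_def[symmetric])
  qed
  also have "\<dots> = (\<Sum>r<N. Y r) + card D"
    by (simp add: sum.distrib sum.If_cases D_def Int_def)
  also have "(\<Sum>r<N. p r div n) = (\<Sum>r<N. r div n)"
    using sum.permute[OF p, of "\<lambda>c. c div n"] by (simp add: N_def o_def lessThan_atLeast0)
  finally have "card D = (\<Sum>r<N. r div n) - (\<Sum>r<N. r div Suc n)" by (simp add: Y_def)
  moreover have "even (card (inversions N p) + card Z) \<longleftrightarrow> even (n * card D)"
    unfolding 1[symmetric] by simp
  ultimately show ?thesis unfolding N_def Z_def defs by simp
qed

section \<open>Counting perfect matchings by determinants\<close>

text \<open>Replace the rows \<open>r1\<close> and \<open>r2\<close> of \<open>A\<close> by the unit vectors at \<open>c1\<close> and \<open>c2\<close>. The determinant of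
the new matrix is the sum over the permutations with the two prescribed values, without the two prescribed factors.
Multiplied by \<open>B\<close>, the new matrix agrees with the identity outside the two rows, so its determinant is a
2 by 2 minor of \<open>B\<close>.\<close>

lemma sum_permutations_two_entries:
  fixes A B :: "rat mat"
  assumes A: "A \<in> carrier_mat N N" and B: "B \<in> carrier_mat N N" and AB: "A * B = 1\<^sub>m N"
    and r: "r1 < N" "r2 < N" "r1 \<noteq> r2" and c: "c1 < N" "c2 < N"
  shows "(\<Sum>p | p permutes {0..<N} \<and> p r1 = c1 \<and> p r2 = c2. signof p * (\<Prod>i = 0..<N. A $$ (i, p i)))
    = det A * (A $$ (r1, c1) * A $$ (r2, c2) * (B $$ (c1, r1) * B $$ (c2, r2) - B $$ (c1, r2) * B $$ (c2, r1)))"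
proof -
  define A' where "A' = Matrix.mat N N (\<lambda>(i, j). if i = r1 then (if j = c1 then 1 else 0)
      else if i = r2 then (if j = c2 then 1 else 0) else A $$ (i, j))"
  \<comment> \<open>This is the product of \<open>A'\<close> and \<open>B\<close>.\<close>
  define C where "C = Matrix.mat N N (\<lambda>(i, j). if i = r1 then B $$ (c1, j)
      else if i = r2 then B $$ (c2, j) else if i = j then 1 else 0)"
  have A': "A' \<in> carrier_mat N N" and C: "C \<in> carrier_mat N N" by (simp_all add: A'_def C_def)
  have times: "(X * Y) $$ (i, j) = (\<Sum>k = 0..<N. X $$ (i, k) * Y $$ (k, j))"
    if "X \<in> carrier_mat N N" "Y \<in> carrier_mat N N" "i < N" "j < N" for X Y :: "rat mat" and i j
    using that by (simp add: scalar_prod_def)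
  have "A' * B = C"
  proof (rule eq_matI)
    fix i j assume "i < dim_row C" "j < dim_col C"
    then have ij: "i < N" "j < N" by (simp_all add: C_def)
    have "(\<Sum>k = 0..<N. A $$ (i, k) * B $$ (k, j)) = (if i = j then 1 else 0)"
      using times[OF A B ij] ij by (simp add: AB)
    then show "(A' * B) $$ (i, j) = C $$ (i, j)"
      unfolding times[OF A' B ij] using ij c
      by (simp add: A'_def C_def if_distrib[of "\<lambda>z. z * _"] cong: if_cong)
  qed (use A B in \<open>simp_all add: A'_def C_def\<close>)
  then have "det A' * det B = det C" using det_mult[OF A' B] by simp
  moreover have "det A * det B = 1" using det_mult[OF A B] by (simp add: AB)
  ultimately have "det A' = det C * det A"
    by (metis mult.assoc mult.commute mult.right_neutral)
  moreover have "det C = B $$ (c1, r1) * B $$ (c2, r2) - B $$ (c1, r2) * B $$ (c2, r1)"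
  proof -
    let ?t = "Transposition.transpose r1 r2"
    have t: "?t permutes {0..<N}" using r by (intro permutes_swap_id) auto
    have zero: "(\<Prod>i = 0..<N. C $$ (i, p i)) = 0" if p: "p permutes {0..<N}" "p \<noteq> id" "p \<noteq> ?t" for p
    proof -
      have "\<exists>i\<in>{0..<N}. i \<noteq> r1 \<and> i \<noteq> r2 \<and> p i \<noteq> i"
      proof (rule ccontr)
        assume "\<not> ?thesis"
        then have "p permutes {r1, r2}"
          by (intro permutes_superset[OF p(1)]) auto
        then show False using p by (auto simp: permutes_doubleton_iff)
      qed
      then obtain i where i: "i < N" "i \<noteq> r1" "i \<noteq> r2" "p i \<noteq> i" by auto
      have "p i < N" using permutes_in_image[OF p(1), of i] i by simp
      then have "C $$ (i, p i) = 0" using i by (simp add: C_def)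
      then show ?thesis using i(1) by (intro prod_zero) auto
    qed
    have split: "(\<Prod>i = 0..<N. f i) = f r1 * f r2 * (\<Prod>i\<in>{0..<N} - {r1} - {r2}. f i)" for f :: "nat \<Rightarrow> rat"
      using r by (subst prod.remove[of _ r1], simp, simp, subst prod.remove[of _ r2]) (auto simp: mult.assoc)
    have one: "(\<Prod>i\<in>{0..<N} - {r1} - {r2}. C $$ (i, q i)) = 1" if "\<And>i. i \<noteq> r1 \<Longrightarrow> i \<noteq> r2 \<Longrightarrow> q i = i" for q
      using that by (intro prod.neutral) (auto simp: C_def)
    have "id \<noteq> ?t" using r by (metis id_apply transpose_apply_first)
    have "det C = (\<Sum>p\<in>{id, ?t}. signof p * (\<Prod>i = 0..<N. C $$ (i, p i)))"
      unfolding det_def'[OF C] using zero t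
      by (intro sum.mono_neutral_right) (auto simp: finite_permutations permutes_id)
    also have "\<dots> = (\<Prod>i = 0..<N. C $$ (i, id i)) - (\<Prod>i = 0..<N. C $$ (i, ?t i))"
      using \<open>id \<noteq> ?t\<close> r by (simp add: sign_swap_id)
    also have "(\<Prod>i = 0..<N. C $$ (i, id i)) = B $$ (c1, r1) * B $$ (c2, r2)"
      unfolding split one[of id, simplified] using r one[of id] by (simp add: C_def)
    also have "(\<Prod>i = 0..<N. C $$ (i, ?t i)) = B $$ (c1, r2) * B $$ (c2, r1)"
      unfolding split using r one[of ?t] by (simp add: C_def)
    finally show ?thesis .
  qed
  moreover have "A $$ (r1, c1) * A $$ (r2, c2) * det A' =
    (\<Sum>p | p permutes {0..<N} \<and> p r1 = c1 \<and> p r2 = c2. signof p * (\<Prod>i = 0..<N. A $$ (i, p i)))"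
  proof -
    have split: "(\<Prod>i = 0..<N. f i) = f r1 * f r2 * (\<Prod>i\<in>{0..<N} - {r1} - {r2}. f i)" for f :: "nat \<Rightarrow> rat"
      using r by (subst prod.remove[of _ r1], simp, simp, subst prod.remove[of _ r2]) (auto simp: mult.assoc)
    have pN: "p i < N" if "p permutes {0..<N}" "i < N" for p i
      using permutes_in_image[OF that(1), of i] that by simp
    have "det A' = (\<Sum>p | p permutes {0..<N} \<and> p r1 = c1 \<and> p r2 = c2. signof p * (\<Prod>i = 0..<N. A' $$ (i, p i)))"
      unfolding det_def'[OF A']
    proof (rule sum.mono_neutral_right)
      show "\<forall>p\<in>{p. p permutes {0..<N}} - {p. p permutes {0..<N} \<and> p r1 = c1 \<and> p r2 = c2}.
          signof p * (\<Prod>i = 0..<N. A' $$ (i, p i)) = 0"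
      proof
        fix p assume "p \<in> {p. p permutes {0..<N}} - {p. p permutes {0..<N} \<and> p r1 = c1 \<and> p r2 = c2}"
        then have "A' $$ (r1, p r1) = 0 \<or> A' $$ (r2, p r2) = 0"
          using r pN[of p] by (auto simp: A'_def)
        then show "signof p * (\<Prod>i = 0..<N. A' $$ (i, p i)) = 0" unfolding split by auto
      qed
    qed (auto simp: finite_permutations)
    moreover have "A $$ (r1, c1) * A $$ (r2, c2) * (\<Prod>i = 0..<N. A' $$ (i, p i)) = (\<Prod>i = 0..<N. A $$ (i, p i))"
      if p: "p permutes {0..<N}" "p r1 = c1" "p r2 = c2" for p
    proof -
      have "(\<Prod>i\<in>{0..<N} - {r1} - {r2}. A' $$ (i, p i)) = (\<Prod>i\<in>{0..<N} - {r1} - {r2}. A $$ (i, p i))"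
        using pN[OF p(1)] by (intro prod.cong refl) (auto simp: A'_def)
      then show ?thesis unfolding split using p r c by (simp add: A'_def)
    qed
    ultimately show ?thesis
      unfolding sum_distrib_left by (auto simp: sum_distrib_left mult.left_commute intro!: sum.cong)
  qed
  ultimately show ?thesis by (simp add: mult_ac)
qed

text \<open>A matching is encoded by the permutation that sends the number of a white square to the number of its
black partner.\<close>

definition matchings :: "nat \<Rightarrow> (nat \<Rightarrow> nat) set" where
  "matchings n = {p. p permutes {0..<n * Suc n} \<and>
     (\<forall>r<n * Suc n. kast_weight (r mod Suc n) (r div Suc n) (p r mod n) (p r div n) \<noteq> 0)}"

definition kast_sign :: "nat \<Rightarrow> rat" where
  "kast_sign n = (if even (n * ((\<Sum>r<n * Suc n. r div n) - (\<Sum>r<n * Suc n. r div Suc n))) then 1 else -1)"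

lemma kast_mat_entry: "r < n * Suc n \<Longrightarrow> c < n * Suc n \<Longrightarrow>
    kast_mat n $$ (r, c) = kast_weight (r mod Suc n) (r div Suc n) (c mod n) (c div n)"
  by (simp add: kast_mat_def white_black_mat_def)

lemma signed_weight_matching:
  assumes "p \<in> matchings n"
  shows "signof p * (\<Prod>r = 0..<n * Suc n. kast_mat n $$ (r, p r)) = kast_sign n"
proof -
  let ?N = "n * Suc n"
  have p: "p permutes {0..<?N}" and nz: "\<And>r. r < ?N \<Longrightarrow> kast_weight (r mod Suc n) (r div Suc n) (p r mod n) (p r div n) \<noteq> 0"
    using assms by (auto simp: matchings_def)
  have pN: "p r < ?N" if "r < ?N" for r
    using permutes_in_image[OF p, of r] that by simp
  define Z where "Z = {r. r < ?N \<and> p r div n = Suc (r div Suc n) \<and> r mod Suc n = Suc (p r mod n)}"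
  have "(\<Prod>r = 0..<?N. kast_mat n $$ (r, p r)) = (\<Prod>r = 0..<?N. if r \<in> Z then -1 else 1)"
  proof (intro prod.cong refl)
    fix r assume "r \<in> {0..<?N}"
    then have r: "r < ?N" by simp
    show "kast_mat n $$ (r, p r) = (if r \<in> Z then -1 else 1)"
      unfolding kast_mat_entry[OF r pN[OF r]] using nz[OF r] r by (auto simp: kast_weight_def Z_def split: if_splits)
  qed
  also have "\<dots> = (-1) ^ card Z"
    by (subst prod.mono_neutral_cong_right[of _ Z _ "\<lambda>_. -1"]) (auto simp: Z_def)
  finally have "signof p * (\<Prod>r = 0..<?N. kast_mat n $$ (r, p r)) = (-1) ^ (card (inversions ?N p) + card Z)"
    by (simp add: sign_eq_inversions[OF p] power_add)
  moreover have "even (card (inversions ?N p) + card Z) \<longleftrightarrow>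
      even (n * ((\<Sum>r<n * Suc n. r div n) - (\<Sum>r<n * Suc n. r div Suc n)))"
    unfolding Z_def
  proof (rule sign_weight_constant[OF p])
    show "(r mod Suc n = p r mod n \<or> r mod Suc n = Suc (p r mod n)) \<and>
       (p r div n = r div Suc n \<or> p r div n = Suc (r div Suc n))" if "r < ?N" for r
      using nz[OF that] by (simp add: kast_weight_def split: if_splits)
  qed
  ultimately show ?thesis by (simp only: kast_sign_def minus_one_power_iff)
qed

lemma signed_sum_matchings:
  "(\<Sum>p | p permutes {0..<n * Suc n} \<and> Q p. signof p * (\<Prod>r = 0..<n * Suc n. kast_mat n $$ (r, p r)))
     = kast_sign n * of_nat (card {p \<in> matchings n. Q p})"
proof -
  have "(\<Sum>p | p permutes {0..<n * Suc n} \<and> Q p. signof p * (\<Prod>r = 0..<n * Suc n. kast_mat n $$ (r, p r)))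
     = (\<Sum>p\<in>{p \<in> matchings n. Q p}. kast_sign n)"
  proof (rule sum.mono_neutral_cong_right)
    show "\<forall>p\<in>{p. p permutes {0..<n * Suc n} \<and> Q p} - {p \<in> matchings n. Q p}.
        signof p * (\<Prod>r = 0..<n * Suc n. kast_mat n $$ (r, p r)) = 0"
    proof
      fix p assume "p \<in> {p. p permutes {0..<n * Suc n} \<and> Q p} - {p \<in> matchings n. Q p}"
      then obtain r where p: "p permutes {0..<n * Suc n}" and r: "r < n * Suc n"
         "kast_weight (r mod Suc n) (r div Suc n) (p r mod n) (p r div n) = 0"
        by (auto simp: matchings_def)
      have "p r < n * Suc n" using permutes_in_image[OF p, of r] r by simp
      then have "kast_mat n $$ (r, p r) = 0" using r by (simp add: kast_mat_entry)
      then have "(\<Prod>r = 0..<n * Suc n. kast_mat n $$ (r, p r)) = 0"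
        using r by (intro prod_zero) auto
      then show "signof p * (\<Prod>r = 0..<n * Suc n. kast_mat n $$ (r, p r)) = 0" by simp
    qed
  qed (auto simp: finite_permutations signed_weight_matching matchings_def)
  then show ?thesis by simp
qed

lemma det_kast_mat_matchings: "det (kast_mat n) = kast_sign n * of_nat (card (matchings n))"
  using signed_sum_matchings[of n "\<lambda>_. True"] det_def'[OF mats_carrier(1)] by simp

lemma card_matchings:
  assumes "0 < n"
  shows "card (matchings n) = 2 ^ (n * Suc n div 2)"
proof -
  have "(of_nat (card (matchings n)) :: rat) ^ 2 = det (kast_mat n) ^ 2"
    by (simp add: det_kast_mat_matchings kast_sign_def)
  also have "\<dots> = of_nat ((2 ^ (n * Suc n div 2)) ^ 2)"
    by (simp add: det_kast_mat_square[OF assms] power_mult[symmetric])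
  finally have "card (matchings n) ^ 2 = (2 ^ (n * Suc n div 2)) ^ 2"
    by (metis of_nat_eq_iff of_nat_power)
  then show ?thesis by (rule power_eq_imp_eq_base) simp_all
qed

text \<open>The common sign of the matchings occurs on both sides of the identity for determinants and cancels.\<close>

lemma card_matchings_two_edges:
  assumes "0 < n" "r1 < n * Suc n" "r2 < n * Suc n" "r1 \<noteq> r2" "c1 < n * Suc n" "c2 < n * Suc n"
  shows "of_nat (card {p \<in> matchings n. p r1 = c1 \<and> p r2 = c2}) = (2 :: rat) ^ (n * Suc n div 2) *
    (kast_mat n $$ (r1, c1) * kast_mat n $$ (r2, c2) * (kast_inv_mat n $$ (c1, r1) * kast_inv_mat n $$ (c2, r2) - kast_inv_mat n $$ (c1, r2) * kast_inv_mat n $$ (c2, r1)))"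
proof -
  have "kast_sign n * of_nat (card {p \<in> matchings n. p r1 = c1 \<and> p r2 = c2}) = kast_sign n * (2 ^ (n * Suc n div 2) *
    (kast_mat n $$ (r1, c1) * kast_mat n $$ (r2, c2) * (kast_inv_mat n $$ (c1, r1) * kast_inv_mat n $$ (c2, r2) - kast_inv_mat n $$ (c1, r2) * kast_inv_mat n $$ (c2, r1))))"
    using sum_permutations_two_entries[OF mats_carrier(1) kast_inv_mat_carrier kast_mat_inverse assms(2-6)] assms(1)
    by (simp add: signed_sum_matchings det_kast_mat_matchings card_matchings mult.assoc)
  then show ?thesis by (simp add: kast_sign_def split: if_splits)
qed

section \<open>Unit squares and tilings of their unions\<close>

definition cell :: "int \<times> int \<Rightarrow> (real \<times> real) set" where
  "cell c = unit_square (fst c) (snd c)"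

text \<open>A point that lies in the interior of one cell and in no other cell, used to recover a cell from a union of
cells.\<close>

definition center :: "int \<times> int \<Rightarrow> real \<times> real" where
  "center c = (of_int (fst c) + 1 / 2, of_int (snd c) + 1 / 2)"

definition adjacent :: "int \<times> int \<Rightarrow> int \<times> int \<Rightarrow> bool" where
  "adjacent c d \<longleftrightarrow> \<bar>fst c - fst d\<bar> + \<bar>snd c - snd d\<bar> = 1"

lemma adjacent_commute: "adjacent c d \<longleftrightarrow> adjacent d c"
  by (auto simp: adjacent_def)

lemma center_in_cell_iff: "center c \<in> cell d \<longleftrightarrow> c = d"
proof
  assume "center c \<in> cell d"
  then have "fst c = fst d" "snd c = snd d"
    by (simp_all add: center_def cell_def unit_square_def)
  then show "c = d" by (simp add: prod_eq_iff)
qed (simp add: center_def cell_def unit_square_def)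

lemma center_in_interior: "center c \<in> interior (cell c)"
  by (simp add: center_def cell_def unit_square_def interior_Times)

lemma interior_cell_Int:
  assumes "c \<noteq> d"
  shows "interior (cell c \<inter> cell d) = {}"
proof -
  have *: "interior ({of_int a..of_int a + 1} \<inter> {of_int b..of_int b + 1 :: real}) = {}" if "a \<noteq> b" for a b :: int
  proof -
    have "interior ({of_int a..of_int a + 1} \<inter> {of_int b..of_int b + 1 :: real})
        = {max (of_int a) (of_int b)<..<min (of_int a + 1) (of_int b + 1)}"
      by (simp add: Int_atLeastAtMost)
    also have "\<dots> = {}" using that by auto
    finally show ?thesis .
  qed
  show ?thesis
    using assms *[of "fst c" "fst d"] *[of "snd c" "snd d"]
    by (cases "fst c = fst d") (auto simp: cell_def unit_square_def Times_Int_Times interior_Times prod_eq_iff)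
qed

lemma closed_cell: "closed (cell c)"
  by (auto simp: cell_def unit_square_def intro: closed_Times)

lemma interior_Int_cells:
  assumes "{c, c'} \<inter> {d, d'} = {}"
  shows "interior (cell c \<union> cell c') \<inter> interior (cell d \<union> cell d') = {}"
proof -
  have "(cell c \<union> cell c') \<inter> (cell d \<union> cell d')
      = (cell c \<inter> cell d) \<union> ((cell c \<inter> cell d') \<union> ((cell c' \<inter> cell d) \<union> (cell c' \<inter> cell d')))" by blast
  moreover have two: "interior (S \<union> S') = {}" if "closed S" "interior S = {}" "interior S' = {}"
    for S S' :: "(real \<times> real) set"
    using interior_closed_Un_empty_interior[OF that(1,3)] that(2) by simp
  ultimately have "interior ((cell c \<union> cell c') \<inter> (cell d \<union> cell d')) = {}"
    using assms by (simp only:) (intro two closed_Int closed_cell interior_cell_Int, auto)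
  then show ?thesis by (simp only: interior_Int)
qed

lemma cell_subset_Union_iff: "cell c \<subseteq> (\<Union>d\<in>A. cell d) \<longleftrightarrow> c \<in> A"
proof
  assume "cell c \<subseteq> (\<Union>d\<in>A. cell d)"
  moreover have "center c \<in> cell c" by (simp only: center_in_cell_iff)
  ultimately have "center c \<in> (\<Union>d\<in>A. cell d)" by (rule subsetD)
  then show "c \<in> A" by (simp only: UN_iff center_in_cell_iff) blast
qed blast

lemma domino_iff: "domino D \<longleftrightarrow> (\<exists>c d. adjacent c d \<and> D = cell c \<union> cell d)"
proof
  assume "domino D"
  then obtain i j where "D = cell (i, j) \<union> cell (i + 1, j) \<or> D = cell (i, j) \<union> cell (i, j + 1)"
    by (auto simp: domino_def cell_def)
  moreover have "adjacent (i, j) (i + 1, j)" "adjacent (i, j) (i, j + 1)" by (simp_all add: adjacent_def)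
  ultimately show "\<exists>c d. adjacent c d \<and> D = cell c \<union> cell d" by blast
next
  assume "\<exists>c d. adjacent c d \<and> D = cell c \<union> cell d"
  then obtain a b x y where adj: "adjacent (a, b) (x, y)" and D: "D = cell (a, b) \<union> cell (x, y)" by auto
  from adj have "x = a + 1 \<and> y = b \<or> a = x + 1 \<and> y = b \<or> x = a \<and> y = b + 1 \<or> x = a \<and> b = y + 1"
    by (simp add: adjacent_def) linarith
  then show "domino D" unfolding domino_def D cell_def by (auto simp: Un_commute)
qed

text \<open>The index sets let the same list of squares serve for the full diamond and for the diamond with a hole.
Outside \<open>R\<close> the values are fixed, so that matchings can be counted.\<close>

definition indexed_matchings ::
    "nat set \<Rightarrow> nat set \<Rightarrow> (nat \<Rightarrow> int \<times> int) \<Rightarrow> (nat \<Rightarrow> int \<times> int) \<Rightarrow> (nat \<Rightarrow> nat) set" where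
  "indexed_matchings R C w b =
     {f. f \<in> extensional R \<and> bij_betw f R C \<and> (\<forall>r\<in>R. adjacent (w r) (b (f r)))}"

text \<open>A tiling is recovered from the tile at the centre of each white cell: tiles with disjoint interiors cannot
share a cell, and the colours tell the two cells of a tile apart.\<close>

lemma card_domino_tilings:
  assumes w: "inj_on w R" and b: "inj_on b C"
    and wcol: "\<And>r. r \<in> R \<Longrightarrow> even (fst (w r) + snd (w r) + k)"
    and bcol: "\<And>s. s \<in> C \<Longrightarrow> odd (fst (b s) + snd (b s) + k)"
  shows "card (domino_tilings (\<Union>c \<in> w ` R \<union> b ` C. cell c)) = card (indexed_matchings R C w b)"
proof -
  let ?reg = "\<Union>c \<in> w ` R \<union> b ` C. cell c"
  define dom where "dom r s = cell (w r) \<union> cell (b s)" for r s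
  define T where "T f = (\<lambda>r. dom r (f r)) ` R" for f
  have col: "w r \<noteq> b s" if "r \<in> R" "s \<in> C" for r s
    using wcol[OF that(1)] bcol[OF that(2)] by metis
  have dom_cases: "\<exists>r\<in>R. \<exists>s\<in>C. adjacent (w r) (b s) \<and> D = dom r s"
    if "domino D" "D \<subseteq> ?reg" for D
  proof -
    from that(1) obtain c d where adj: "adjacent c d" and D: "D = cell c \<union> cell d" by (auto simp: domino_iff)
    have cd: "c \<in> w ` R \<union> b ` C" "d \<in> w ` R \<union> b ` C"
      using that(2) unfolding cell_subset_Union_iff[symmetric] D by blast+
    have par: "even (fst c + snd c + k) \<longleftrightarrow> odd (fst d + snd d + k)"
    proof -
      have "odd ((fst c + snd c + k) - (fst d + snd d + k))" using adj unfolding adjacent_def by presburger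
      then show ?thesis by (simp only: even_diff) presburger
    qed
    show ?thesis
    proof (cases "c \<in> w ` R")
      case True
      then obtain r where r: "r \<in> R" "c = w r" by blast
      then have "odd (fst d + snd d + k)" using par wcol by blast
      then have "d \<notin> w ` R" using wcol by blast
      then obtain s where "s \<in> C" "d = b s" using cd by blast
      then show ?thesis using r adj D by (auto simp: dom_def)
    next
      case False
      then obtain s where s: "s \<in> C" "c = b s" using cd by blast
      then have "even (fst d + snd d + k)" using par bcol by blast
      then have "d \<notin> b ` C" using bcol by blast
      then obtain r where "r \<in> R" "d = w r" using cd by blast
      then show ?thesis using s adj D by (auto simp: dom_def adjacent_commute)
    qed
  qed
  have dom_eq: "r = r' \<and> s = s'" if "dom r s = dom r' s'" "r \<in> R" "r' \<in> R" "s \<in> C" "s' \<in> C" for r s r' s'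
  proof -
    have "center (w r) \<in> dom r' s'" "center (b s) \<in> dom r' s'"
      unfolding that(1)[symmetric] by (simp_all add: dom_def center_in_cell_iff)
    then have "w r = w r'" "b s = b s'"
      using col[OF that(2,5)] col[OF that(3,4)] by (auto simp: dom_def center_in_cell_iff)
    then show ?thesis using w b that by (auto dest: inj_onD)
  qed
  have disj: "interior (dom r s) \<inter> interior (dom r' s') = {}"
    if "r \<noteq> r'" "s \<noteq> s'" "r \<in> R" "r' \<in> R" "s \<in> C" "s' \<in> C" for r s r' s'
  proof -
    have "w r \<noteq> w r'" "b s \<noteq> b s'" using w b that by (auto dest: inj_onD)
    then show ?thesis unfolding dom_def using col that by (intro interior_Int_cells) auto
  qed
  have center_dom: "center (w r) \<in> interior (dom r s)" "center (b s) \<in> interior (dom r s)" for r s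
    using center_in_interior[of "w r"] center_in_interior[of "b s"]
      interior_mono[of "cell (w r)" "dom r s"] interior_mono[of "cell (b s)" "dom r s"]
    by (auto simp: dom_def)
  have "bij_betw T (indexed_matchings R C w b) (domino_tilings ?reg)"
  proof (rule bij_betw_imageI)
    show "inj_on T (indexed_matchings R C w b)"
    proof (rule inj_onI)
      fix f g assume f: "f \<in> indexed_matchings R C w b" and g: "g \<in> indexed_matchings R C w b" and eq: "T f = T g"
      have fC: "f r \<in> C" "g r \<in> C" if "r \<in> R" for r
        using f g that by (auto simp: indexed_matchings_def bij_betw_def)
      show "f = g"
      proof (rule extensionalityI[of _ R])
        fix r assume r: "r \<in> R"
        then have "dom r (f r) \<in> T f" unfolding T_def by blast
        then have "dom r (f r) \<in> T g" unfolding eq .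
        then obtain r' where "r' \<in> R" "dom r (f r) = dom r' (g r')" by (auto simp: T_def)
        then show "f r = g r" using dom_eq[of r "f r" r' "g r'"] fC r by auto
      qed (use f g in \<open>auto simp: indexed_matchings_def\<close>)
    qed
    show "T ` indexed_matchings R C w b = domino_tilings ?reg"
    proof (intro equalityI subsetI)
      fix X assume "X \<in> T ` indexed_matchings R C w b"
      then obtain f where f: "f \<in> indexed_matchings R C w b" and X: "X = T f" by blast
      then have fim: "f ` R = C" "inj_on f R" and adj: "\<And>r. r \<in> R \<Longrightarrow> adjacent (w r) (b (f r))"
        by (auto simp: indexed_matchings_def bij_betw_def)
      have "domino D \<and> D \<subseteq> ?reg" if DX: "D \<in> X" for D
      proof -
        obtain r where r: "r \<in> R" "D = cell (w r) \<union> cell (b (f r))"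
          using DX by (auto simp: X T_def dom_def)
        then have "domino D" using adj unfolding domino_iff by blast
        moreover have "w r \<in> w ` R \<union> b ` C" "b (f r) \<in> w ` R \<union> b ` C" using r(1) fim by auto
        ultimately show ?thesis unfolding r(2) by blast
      qed
      moreover have "interior D \<inter> interior E = {}" if DE: "D \<in> X" "E \<in> X" "D \<noteq> E" for D E
      proof -
        obtain r r' where rr: "r \<in> R" "r' \<in> R" "D = dom r (f r)" "E = dom r' (f r')"
          using DE by (auto simp: X T_def)
        then have "r \<noteq> r'" using DE by auto
        then have "f r \<noteq> f r'" using fim rr by (auto dest: inj_onD)
        then show ?thesis using disj[of r r' "f r" "f r'"] \<open>r \<noteq> r'\<close> rr fim by auto
      qed
      moreover have "\<Union> X = ?reg"
        unfolding X T_def dom_def fim(1)[symmetric] by auto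
      ultimately show "X \<in> domino_tilings ?reg" by (simp add: domino_tilings_def)
    next
      fix X assume "X \<in> domino_tilings ?reg"
      then have Xd: "\<And>D. D \<in> X \<Longrightarrow> domino D \<and> D \<subseteq> ?reg"
        and Xi: "\<And>D E. D \<in> X \<Longrightarrow> E \<in> X \<Longrightarrow> D \<noteq> E \<Longrightarrow> interior D \<inter> interior E = {}"
        and XU: "\<Union> X = ?reg" by (auto simp: domino_tilings_def)
      have form: "\<exists>r\<in>R. \<exists>s\<in>C. adjacent (w r) (b s) \<and> D = dom r s" if "D \<in> X" for D
        using dom_cases Xd[OF that] by blast
      have exw: "\<exists>s\<in>C. dom r s \<in> X \<and> adjacent (w r) (b s)" if r: "r \<in> R" for r
      proof -
        have "center (w r) \<in> ?reg" using r by (auto simp: center_in_cell_iff)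
        then obtain D where D: "D \<in> X" "center (w r) \<in> D" unfolding XU[symmetric] by blast
        then obtain r' s where rs: "r' \<in> R" "s \<in> C" "adjacent (w r') (b s)" "D = dom r' s" using form by blast
        then have "w r = w r'" using D(2) col[OF r] by (auto simp: dom_def center_in_cell_iff)
        then have "r' = r" using w r rs by (auto dest: inj_onD)
        then show ?thesis using rs D by blast
      qed
      have exb: "\<exists>r\<in>R. dom r s \<in> X" if s: "s \<in> C" for s
      proof -
        have "center (b s) \<in> ?reg" using s by (auto simp: center_in_cell_iff)
        then obtain D where D: "D \<in> X" "center (b s) \<in> D" unfolding XU[symmetric] by blast
        then obtain r s' where rs: "r \<in> R" "s' \<in> C" "D = dom r s'" using form by blast
        then have "b s = b s'" using D(2) col[OF rs(1) s] by (auto simp: dom_def center_in_cell_iff)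
        then have "s' = s" using b s rs by (auto dest: inj_onD)
        then show ?thesis using rs D by blast
      qed
      have uniq: "D = E" if "D \<in> X" "E \<in> X" "z \<in> interior D" "z \<in> interior E" for D E z
        using Xi[OF that(1,2)] that(3,4) by blast
      define f where "f = restrict (\<lambda>r. SOME s. s \<in> C \<and> dom r s \<in> X \<and> adjacent (w r) (b s)) R"
      have f: "f r \<in> C \<and> dom r (f r) \<in> X \<and> adjacent (w r) (b (f r))" if "r \<in> R" for r
        using someI_ex[of "\<lambda>s. s \<in> C \<and> dom r s \<in> X \<and> adjacent (w r) (b s)"] exw[OF that] that
        by (auto simp: f_def)
      have f_eq: "f r = s" if "r \<in> R" "s \<in> C" "dom r s \<in> X" for r s
      proof -
        have "dom r s = dom r (f r)" by (rule uniq[OF that(3) _ center_dom(1) center_dom(1)]) (use f that in blast)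
        then show ?thesis using dom_eq[of r s r "f r"] that f by simp
      qed
      have "inj_on f R"
      proof (rule inj_onI)
        fix r r' assume rr: "r \<in> R" "r' \<in> R" "f r = f r'"
        have "dom r (f r) = dom r' (f r')"
        proof (rule uniq)
          show "center (b (f r)) \<in> interior (dom r' (f r'))" unfolding rr(3) by (rule center_dom(2))
        qed (use f rr(1,2) center_dom(2) in blast)+
        then show "r = r'" using dom_eq[of r "f r" r' "f r'"] f rr by simp
      qed
      moreover have "f ` R = C"
        using f f_eq exb by (auto simp: image_iff) metis
      ultimately have fm: "f \<in> indexed_matchings R C w b"
        using f by (auto simp: indexed_matchings_def bij_betw_def f_def)
      have "T f = X"
      proof (intro equalityI subsetI)
        fix D assume "D \<in> X"
        then obtain r s where rs: "r \<in> R" "s \<in> C" "D = dom r s" using form by blast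
        then have "f r = s" using f_eq \<open>D \<in> X\<close> by blast
        then show "D \<in> T f" using rs by (auto simp: T_def)
      qed (use f in \<open>auto simp: T_def\<close>)
      then show "X \<in> T ` indexed_matchings R C w b" using fm by blast
    qed
  qed
  then show ?thesis by (simp add: bij_betw_same_card)
qed

text \<open>Removing cells of \<open>Q\<close> leaves the interior of any other cell untouched, and the closure of this interior
is the cell.\<close>

lemma closure_cells_diff:
  assumes "finite A"
  shows "closure ((\<Union>c\<in>A. cell c) - (\<Union>c\<in>Q. cell c)) = (\<Union>c\<in>A - Q. cell c)"
proof
  have "(\<Union>c\<in>A. cell c) - (\<Union>c\<in>Q. cell c) \<subseteq> (\<Union>c\<in>A - Q. cell c)" by auto
  moreover have "closed (\<Union>c\<in>A - Q. cell c)"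
    using assms by (intro closed_UN) (auto simp: closed_cell)
  ultimately show "closure ((\<Union>c\<in>A. cell c) - (\<Union>c\<in>Q. cell c)) \<subseteq> (\<Union>c\<in>A - Q. cell c)"
    by (rule closure_minimal)
  show "(\<Union>c\<in>A - Q. cell c) \<subseteq> closure ((\<Union>c\<in>A. cell c) - (\<Union>c\<in>Q. cell c))"
  proof (rule UN_least)
    fix c assume c: "c \<in> A - Q"
    have box: "interior (cell c) \<inter> cell d = {}" if "d \<in> Q" for d
    proof -
      have "cell d = closure (interior (cell d))"
        by (simp add: cell_def unit_square_def interior_Times closure_Times)
      moreover have "interior (cell c) \<inter> interior (cell d) = {}"
        using interior_cell_Int[of c d] c that unfolding interior_Int by blast
      ultimately show ?thesis by (metis open_interior open_Int_closure_eq_empty)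
    qed
    have "cell c = closure (interior (cell c))"
      by (simp add: cell_def unit_square_def interior_Times closure_Times)
    also have "\<dots> \<subseteq> closure ((\<Union>c\<in>A. cell c) - (\<Union>c\<in>Q. cell c))"
      using c box interior_subset[of "cell c"] by (intro closure_mono) blast
    finally show "cell c \<subseteq> closure ((\<Union>c\<in>A. cell c) - (\<Union>c\<in>Q. cell c))" .
  qed
qed

definition aztec_cells :: "nat \<Rightarrow> (int \<times> int) set" where
  "aztec_cells n = {(x, y). \<bar>2 * x + 1\<bar> + \<bar>2 * y + 1\<bar> \<le> 2 * int n}"

lemma finite_aztec_cells: "finite (aztec_cells n)"
  by (rule finite_subset[of _ "{-int n..int n} \<times> {-int n..int n}"]) (auto simp: aztec_cells_def)

lemma cell_in_diamond_iff:
  "cell c \<subseteq> {(x, y). \<bar>x\<bar> + \<bar>y\<bar> \<le> real n + 1} \<longleftrightarrow> c \<in> aztec_cells n"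
proof (cases c)
  case (Pair x y)
  show ?thesis
  proof
    assume *: "cell c \<subseteq> {(x, y). \<bar>x\<bar> + \<bar>y\<bar> \<le> real n + 1}"
    have corner: "\<bar>u\<bar> + \<bar>v\<bar> \<le> int n + 1" if "u = x \<or> u = x + 1" "v = y \<or> v = y + 1" for u v
    proof -
      have "(of_int u, of_int v) \<in> cell c" using that by (auto simp: Pair cell_def unit_square_def)
      then have "\<bar>of_int u\<bar> + \<bar>of_int v\<bar> \<le> real n + 1" using * by auto
      then have "real_of_int (\<bar>u\<bar> + \<bar>v\<bar>) \<le> real_of_int (int n + 1)" by simp
      then show ?thesis by (simp only: of_int_le_iff)
    qed
    show "c \<in> aztec_cells n"
      using corner[of x y] corner[of "x + 1" y] corner[of x "y + 1"] corner[of "x + 1" "y + 1"]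
      by (simp add: aztec_cells_def Pair) linarith
  next
    assume "c \<in> aztec_cells n"
    then have "\<bar>2 * x + 1\<bar> + \<bar>2 * y + 1\<bar> \<le> 2 * int n" by (simp add: aztec_cells_def Pair)
    then have "real_of_int (\<bar>2 * x + 1\<bar> + \<bar>2 * y + 1\<bar>) \<le> real_of_int (2 * int n)" by (simp only: of_int_le_iff)
    then have h: "\<bar>2 * real_of_int x + 1\<bar> + \<bar>2 * real_of_int y + 1\<bar> \<le> 2 * real n" by simp
    show "cell c \<subseteq> {(x, y). \<bar>x\<bar> + \<bar>y\<bar> \<le> real n + 1}"
    proof
      fix z assume "z \<in> cell c"
      then obtain u v where z: "z = (u, v)" and "of_int x \<le> u" "u \<le> of_int x + 1" "of_int y \<le> v" "v \<le> of_int y + 1"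
        by (auto simp: Pair cell_def unit_square_def)
      then have "\<bar>u\<bar> + \<bar>v\<bar> \<le> real n + 1" using h by linarith
      then show "z \<in> {(x, y). \<bar>x\<bar> + \<bar>y\<bar> \<le> real n + 1}" by (simp add: z)
    qed
  qed
qed

lemma aztec_diamond_cells: "aztec_diamond n = (\<Union>c\<in>aztec_cells n. cell c)"
  unfolding aztec_diamond_def
proof -
  have "{unit_square i j |i j. unit_square i j \<subseteq> {(x, y). \<bar>x\<bar> + \<bar>y\<bar> \<le> real n + 1}} = cell ` aztec_cells n"
  proof (intro equalityI subsetI)
    fix S assume "S \<in> {unit_square i j |i j. unit_square i j \<subseteq> {(x, y). \<bar>x\<bar> + \<bar>y\<bar> \<le> real n + 1}}"
    then obtain i j where "S = cell (i, j)" "cell (i, j) \<subseteq> {(x, y). \<bar>x\<bar> + \<bar>y\<bar> \<le> real n + 1}" by (auto simp: cell_def)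
    then show "S \<in> cell ` aztec_cells n" unfolding cell_in_diamond_iff by blast
  next
    fix S assume "S \<in> cell ` aztec_cells n"
    then obtain c where "S = cell c" "cell c \<subseteq> {(x, y). \<bar>x\<bar> + \<bar>y\<bar> \<le> real n + 1}" unfolding cell_in_diamond_iff by blast
    then show "S \<in> {unit_square i j |i j. unit_square i j \<subseteq> {(x, y). \<bar>x\<bar> + \<bar>y\<bar> \<le> real n + 1}}"
      unfolding cell_def by blast
  qed
  then show "\<Union> {unit_square i j |i j. unit_square i j \<subseteq> {(x, y). \<bar>x\<bar> + \<bar>y\<bar> \<le> real n + 1}} = (\<Union>c\<in>aztec_cells n. cell c)" by simp
qed

definition block_cells :: "int \<Rightarrow> int \<Rightarrow> (int \<times> int) set" where
  "block_cells l m = {(l - 1, m - 1), (l, m - 1), (l - 1, m), (l, m)}"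

lemma block_eq_cells: "block l m = (\<Union>c\<in>block_cells l m. cell c)"
proof -
  have split: "{of_int a - 1..of_int a + 1} = {of_int (a - 1)..of_int (a - 1) + 1} \<union> {of_int a..of_int a + 1 :: real}" for a :: int
    by auto
  show ?thesis unfolding block_def split block_cells_def cell_def unit_square_def by auto
qed

lemma block_subset_iff: "block l m \<subseteq> aztec_diamond n \<longleftrightarrow> block_cells l m \<subseteq> aztec_cells n"
  unfolding block_eq_cells aztec_diamond_cells
  by (auto simp: UN_subset_iff cell_subset_Union_iff)

lemma holey_aztec_diamond_cells:
  "holey_aztec_diamond n l m = (\<Union>c\<in>aztec_cells n - block_cells l m. cell c)"
  unfolding holey_aztec_diamond_def aztec_diamond_cells block_eq_cells
  by (rule closure_cells_diff[OF finite_aztec_cells])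

section \<open>Tilings of the diamond with a hole\<close>

text \<open>The lower left corner \<open>(X, Y)\<close> of the white square \<open>(x, y)\<close>. Up to constants, \<open>2 * x\<close> is \<open>X + Y\<close> and
\<open>2 * y\<close> is \<open>X - Y\<close>; the same holds for black squares below.\<close>

definition white_cell :: "nat \<Rightarrow> nat \<Rightarrow> int \<times> int" where
  "white_cell n r = (int (r mod Suc n) + int (r div Suc n) - int n, int (r mod Suc n) - int (r div Suc n) - 1)"

definition black_cell :: "nat \<Rightarrow> nat \<Rightarrow> int \<times> int" where
  "black_cell n c = (int (c mod n) + int (c div n) - int n, int (c mod n) - int (c div n))"

lemma inj_on_white_cell: "inj_on (white_cell n) A"
proof (rule inj_onI)
  fix r s assume "white_cell n r = white_cell n s"
  then have "r mod Suc n = s mod Suc n" "r div Suc n = s div Suc n"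
    unfolding white_cell_def prod.inject by linarith+
  then show "r = s" by (rule mod_div_eqI)
qed

lemma inj_on_black_cell: "inj_on (black_cell n) A"
proof (rule inj_onI)
  fix r s assume "black_cell n r = black_cell n s"
  then have "r mod n = s mod n" "r div n = s div n"
    unfolding black_cell_def prod.inject by linarith+
  then show "r = s" by (rule mod_div_eqI)
qed

lemma white_cell_even: "even (fst (white_cell n r) + snd (white_cell n r) + (int n + 1))"
  by (simp add: white_cell_def)

lemma black_cell_odd: "odd (fst (black_cell n c) + snd (black_cell n c) + (int n + 1))"
  by (simp add: black_cell_def)

lemma adjacent_white_black_cell:
  "adjacent (white_cell n r) (black_cell n c) \<longleftrightarrow> kast_weight (r mod Suc n) (r div Suc n) (c mod n) (c div n) \<noteq> 0"
proof -
  let ?x = "r mod Suc n" and ?y = "r div Suc n" and ?i = "c mod n" and ?j = "c div n"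
  have "\<bar>a + b - k - (i + j - k)\<bar> + \<bar>a - b - 1 - (i - j)\<bar> = 1 \<longleftrightarrow> (a = i \<or> a = i + 1) \<and> (j = b \<or> j = b + 1)"
    for a b i j k :: int by linarith
  then have "adjacent (white_cell n r) (black_cell n c) \<longleftrightarrow>
      (int ?x = int ?i \<or> int ?x = int ?i + 1) \<and> (int ?j = int ?y \<or> int ?j = int ?y + 1)"
    unfolding adjacent_def white_cell_def black_cell_def fst_conv snd_conv .
  moreover have "int a = int b + 1 \<longleftrightarrow> a = Suc b" for a b by linarith
  ultimately show ?thesis unfolding kast_weight_def of_nat_eq_iff by simp
qed

lemma aztec_cells_index: "aztec_cells n = white_cell n ` {..<n * Suc n} \<union> black_cell n ` {..<n * Suc n}"
proof (intro equalityI subsetI)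
  fix z assume "z \<in> aztec_cells n"
  then obtain x y where z: "z = (x, y)" and xy: "\<bar>2 * x + 1\<bar> + \<bar>2 * y + 1\<bar> \<le> 2 * int n"
    by (auto simp: aztec_cells_def)
  show "z \<in> white_cell n ` {..<n * Suc n} \<union> black_cell n ` {..<n * Suc n}"
  proof (cases "even (x + y + 1 + int n)")
    case True
    define i where "i = nat ((x + y + 1 + int n) div 2)"
    define j where "j = nat ((x - y - 1 + int n) div 2)"
    from True have e: "even (x - y - 1 + int n)" by presburger
    have "0 \<le> x + y + 1 + int n" "0 \<le> x - y + int n" using xy by linarith+
    moreover from this(2) e have "0 \<le> x - y - 1 + int n" by presburger
    ultimately have i: "2 * int i = x + y + 1 + int n" and j: "2 * int j = x - y - 1 + int n"
      using True e by (simp_all add: i_def j_def)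
    have "i < Suc n" "j < n" using i j xy by linarith+
    note k = row_index_less[OF this] mod_div_row[OF this(1), of j]
    have "white_cell n (j * Suc n + i) = z" using i j unfolding white_cell_def k z prod.inject by linarith
    then show ?thesis using k(1) by blast
  next
    case False
    define i where "i = nat ((x + y + int n) div 2)"
    define j where "j = nat ((x - y + int n) div 2)"
    from False have e: "even (x + y + int n)" "even (x - y + int n)" by presburger+
    have "0 \<le> x + y + int n + 1" "0 \<le> x - y + int n" using xy by linarith+
    moreover from this(1) e(1) have "0 \<le> x + y + int n" by presburger
    ultimately have i: "2 * int i = x + y + int n" and j: "2 * int j = x - y + int n"
      using e by (simp_all add: i_def j_def)
    have "i < n" "j < Suc n" using i j xy e by linarith+
    note k = row_index_less[OF this] mod_div_row[OF this(1), of j]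
    have "black_cell n (j * n + i) = z" using i j unfolding black_cell_def k z prod.inject by linarith
    then show ?thesis using k(1) by (auto simp: mult.commute)
  qed
next
  fix z assume "z \<in> white_cell n ` {..<n * Suc n} \<union> black_cell n ` {..<n * Suc n}"
  then consider r where "r < n * Suc n" "z = white_cell n r" | c where "c < n * Suc n" "z = black_cell n c" by auto
  then show "z \<in> aztec_cells n"
  proof cases
    case 1
    have "\<bar>2 * (a + b - k) + 1\<bar> + \<bar>2 * (a - b - 1) + 1\<bar> \<le> 2 * k" if "0 \<le> a" "a \<le> k" "0 \<le> b" "b < k" for a b k :: int
      using that by (auto simp: abs_if)
    then show ?thesis
      unfolding 1(2) white_cell_def aztec_cells_def mem_Collect_eq prod.case
      using white_index[OF 1(1)] by (simp only: of_nat_0_le_iff of_nat_le_iff of_nat_less_iff less_Suc_eq_le)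
  next
    case 2
    have "\<bar>2 * (a + b - k) + 1\<bar> + \<bar>2 * (a - b) + 1\<bar> \<le> 2 * k" if "0 \<le> a" "a < k" "0 \<le> b" "b \<le> k" for a b k :: int
      using that by (auto simp: abs_if)
    then show ?thesis
      unfolding 2(2) black_cell_def aztec_cells_def mem_Collect_eq prod.case
      using black_index[OF 2(1)] by (simp only: of_nat_0_le_iff of_nat_le_iff of_nat_less_iff less_Suc_eq_le)
  qed
qed

text \<open>A tiling of the diamond with the hole is completed by the two dominoes that fill the hole.\<close>

lemma card_tilings_holey_matchings:
  assumes r: "r1 < n * Suc n" "r2 < n * Suc n" "r1 \<noteq> r2"
    and c: "c1 < n * Suc n" "c2 < n * Suc n" "c1 \<noteq> c2"
    and adj: "adjacent (white_cell n r1) (black_cell n c1)" "adjacent (white_cell n r2) (black_cell n c2)"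
    and block: "block_cells l m = {white_cell n r1, white_cell n r2, black_cell n c1, black_cell n c2}"
  shows "card (domino_tilings (holey_aztec_diamond n l m)) = card {p \<in> matchings n. p r1 = c1 \<and> p r2 = c2}"
proof -
  let ?N = "n * Suc n"
  define R where "R = {..<?N} - {r1, r2}"
  define C where "C = {..<?N} - {c1, c2}"
  have ne: "white_cell n r \<noteq> black_cell n c" for r c
    using white_cell_even[of n r] black_cell_odd[of n c] by metis
  have "aztec_cells n - block_cells l m = white_cell n ` R \<union> black_cell n ` C"
    unfolding aztec_cells_index block R_def C_def
    using inj_on_white_cell[of n UNIV] inj_on_black_cell[of n UNIV] ne ne[symmetric]
    by (auto simp: inj_eq)
  then have "card (domino_tilings (holey_aztec_diamond n l m)) = card (indexed_matchings R C (white_cell n) (black_cell n))"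
    unfolding holey_aztec_diamond_cells
    by (simp only:) (rule card_domino_tilings[OF inj_on_white_cell inj_on_black_cell white_cell_even black_cell_odd])
  also have "\<dots> = card {p \<in> matchings n. p r1 = c1 \<and> p r2 = c2}"
  proof (rule bij_betw_same_card[symmetric, of "\<lambda>p. restrict p R"], rule bij_betw_imageI)
    show "inj_on (\<lambda>p. restrict p R) {p \<in> matchings n. p r1 = c1 \<and> p r2 = c2}"
    proof (rule inj_onI)
      fix p q assume p: "p \<in> {p \<in> matchings n. p r1 = c1 \<and> p r2 = c2}" and q: "q \<in> {p \<in> matchings n. p r1 = c1 \<and> p r2 = c2}"
        and eq: "restrict p R = restrict q R"
      have pp: "p permutes {0..<?N}" "q permutes {0..<?N}" using p q by (auto simp: matchings_def)
      show "p = q"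
      proof
        fix r
        consider "r \<in> R" | "r = r1" | "r = r2" | "r \<notin> {0..<?N}" by (auto simp: R_def)
        then show "p r = q r"
          using p q fun_cong[OF eq, of r] pp[THEN permutes_not_in, of r] by cases auto
      qed
    qed
    show "(\<lambda>p. restrict p R) ` {p \<in> matchings n. p r1 = c1 \<and> p r2 = c2} = indexed_matchings R C (white_cell n) (black_cell n)"
    proof (intro equalityI subsetI)
      fix f assume "f \<in> (\<lambda>p. restrict p R) ` {p \<in> matchings n. p r1 = c1 \<and> p r2 = c2}"
      then obtain p where f: "f = restrict p R" and p: "p \<in> matchings n" "p r1 = c1" "p r2 = c2" by auto
      from p have perm: "p permutes {0..<?N}" by (simp add: matchings_def)
      have inj: "inj p" using permutes_inj[OF perm] .
      have "p ` R = C"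
      proof -
        have "p ` R = p ` {0..<?N} - p ` {r1, r2}"
          unfolding R_def lessThan_atLeast0 by (rule image_set_diff[OF inj])
        then show ?thesis
          unfolding permutes_image[OF perm] C_def lessThan_atLeast0 by (simp add: p)
      qed
      then have "bij_betw f R C"
        using inj by (auto simp: f bij_betw_def inj_on_def inj_def)
      moreover have "adjacent (white_cell n r) (black_cell n (f r))" if "r \<in> R" for r
        using that p(1) by (auto simp: f adjacent_white_black_cell matchings_def R_def)
      ultimately show "f \<in> indexed_matchings R C (white_cell n) (black_cell n)"
        by (simp add: indexed_matchings_def f)
    next
      fix f assume "f \<in> indexed_matchings R C (white_cell n) (black_cell n)"
      then have ext: "f \<in> extensional R" and bij: "bij_betw f R C"
        and fadj: "\<And>r. r \<in> R \<Longrightarrow> adjacent (white_cell n r) (black_cell n (f r))" by (auto simp: indexed_matchings_def)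
      define p where "p r = (if r \<in> R then f r else if r = r1 then c1 else if r = r2 then c2 else r)" for r
      have "bij_betw p (R \<union> {r1, r2}) (C \<union> {c1, c2})"
      proof (rule bij_betw_combine)
        show "bij_betw p R C" using bij by (rule bij_betw_cong[THEN iffD1, rotated]) (simp add: p_def)
        show "bij_betw p {r1, r2} {c1, c2}"
          using r c by (auto simp: bij_betw_def p_def R_def)
      qed (auto simp: C_def)
      moreover have "R \<union> {r1, r2} = {0..<?N}" "C \<union> {c1, c2} = {0..<?N}" using r c by (auto simp: R_def C_def)
      ultimately have "p permutes {0..<?N}"
        using r by (intro bij_imp_permutes) (auto simp: p_def R_def)
      moreover have "adjacent (white_cell n s) (black_cell n (p s))" if "s < ?N" for s
        using that fadj[of s] adj by (auto simp: p_def R_def)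
      moreover have "p r1 = c1" "p r2 = c2" using r by (auto simp: p_def R_def)
      moreover have "restrict p R = f"
        by (rule extensionalityI[OF _ ext]) (auto simp: p_def)
      ultimately have "p \<in> {p \<in> matchings n. p r1 = c1 \<and> p r2 = c2}" "restrict p R = f"
        unfolding adjacent_white_black_cell matchings_def by blast+
      then show "f \<in> (\<lambda>p. restrict p R) ` {p \<in> matchings n. p r1 = c1 \<and> p r2 = c2}" by blast
    qed
  qed
  finally show ?thesis .
qed

text \<open>The probability of the edge between white square \<open>r\<close> and black square \<open>c\<close>. An edge in another
direction is a mirror image of one of the kind that \<open>edge_prob\<close> describes.\<close>

definition edge_prob_at :: "nat \<Rightarrow> nat \<Rightarrow> nat \<Rightarrow> rat" where
  "edge_prob_at n r c = edge_prob n (if r mod Suc n = c mod n then c mod n else n - 1 - c mod n)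
            (if c div n = r div Suc n then c div n else n - c div n)"

text \<open>Since the weights of one pair of opposite edges of the block have product \<open>1\<close> and those of the other
pair have product \<open>-1\<close>, the difference in the 2 by 2 minor becomes a sum of products of
probabilities.\<close>

lemma card_tilings_holey_edge_probs:
  assumes n: "0 < n" and r: "r1 < n * Suc n" "r2 < n * Suc n" "r1 \<noteq> r2"
    and c: "c1 < n * Suc n" "c2 < n * Suc n" "c1 \<noteq> c2"
    and K: "kast_mat n $$ (r1, c1) = 1" "kast_mat n $$ (r2, c2) = 1" "kast_mat n $$ (r1, c2) = 1" "kast_mat n $$ (r2, c1) = -1"
    and block: "block_cells l m = {white_cell n r1, white_cell n r2, black_cell n c1, black_cell n c2}"
  shows "of_nat (card (domino_tilings (holey_aztec_diamond n l m))) = (2 :: rat) ^ (n * Suc n div 2) *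
    (edge_prob_at n r1 c1 * edge_prob_at n r2 c2 + edge_prob_at n r1 c2 * edge_prob_at n r2 c1)"
proof -
  have E: "kast_mat n $$ (s, d) * kast_inv_mat n $$ (d, s) = edge_prob_at n s d" if "kast_mat n $$ (s, d) \<noteq> 0" "s < n * Suc n" "d < n * Suc n" for s d
  proof -
    have "kast_weight (s mod Suc n) (s div Suc n) (d mod n) (d div n) \<noteq> 0"
      using that(1) unfolding kast_mat_entry[OF that(2,3)] .
    from kast_times_inverse_entry[OF that(3,2) this] show ?thesis
      unfolding kast_mat_entry[OF that(2,3)] edge_prob_at_def .
  qed
  have "kast_inv_mat n $$ (c1, r1) = edge_prob_at n r1 c1" "kast_inv_mat n $$ (c2, r2) = edge_prob_at n r2 c2"
    "kast_inv_mat n $$ (c2, r1) = edge_prob_at n r1 c2" "kast_inv_mat n $$ (c1, r2) = - edge_prob_at n r2 c1"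
    using E[OF _ r(1) c(1)] E[OF _ r(2) c(2)] E[OF _ r(1) c(2)] E[OF _ r(2) c(1)] unfolding K by simp_all
  moreover have "adjacent (white_cell n r1) (black_cell n c1)" "adjacent (white_cell n r2) (black_cell n c2)"
    unfolding adjacent_white_black_cell kast_mat_entry[OF r(1) c(1), symmetric] kast_mat_entry[OF r(2) c(2), symmetric] K by simp_all
  then have "card (domino_tilings (holey_aztec_diamond n l m)) = card {p \<in> matchings n. p r1 = c1 \<and> p r2 = c2}"
    by (intro card_tilings_holey_matchings r c block)
  ultimately show ?thesis
    using card_matchings_two_edges[OF n r c(1,2)] K by (simp add: algebra_simps)
qed

lemma block_cells_bound:
  assumes "block_cells l m \<subseteq> aztec_cells n"
  shows "\<bar>l\<bar> + \<bar>m\<bar> \<le> int n - 1"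
proof -
  have "{(l - 1, m - 1), (l, m - 1), (l - 1, m), (l, m)} \<subseteq> aztec_cells n"
    using assms by (simp add: block_cells_def)
  then have "\<bar>2 * l - 1\<bar> + \<bar>2 * m - 1\<bar> \<le> 2 * int n" "\<bar>2 * l + 1\<bar> + \<bar>2 * m - 1\<bar> \<le> 2 * int n"
    "\<bar>2 * l - 1\<bar> + \<bar>2 * m + 1\<bar> \<le> 2 * int n" "\<bar>2 * l + 1\<bar> + \<bar>2 * m + 1\<bar> \<le> 2 * int n"
    by (simp_all add: aztec_cells_def)
  then show ?thesis by linarith
qed

text \<open>In this parity class the block has its two white squares in a common row: with \<open>i = I\<close> and \<open>j = J\<close>
they are \<open>(i, j)\<close> and \<open>(i + 1, j)\<close>, and the black squares are \<open>(i, j)\<close> and \<open>(i, j + 1)\<close>.\<close>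

lemma card_tilings_holey_odd:
  assumes block: "\<bar>l\<bar> + \<bar>m\<bar> \<le> int n - 1" and odd: "odd (l + m + int n)"
  defines "I \<equiv> (l + m + int n - 1) div 2" and "J \<equiv> (l - m + int n - 1) div 2"
  shows "of_nat (card (domino_tilings (holey_aztec_diamond n l m))) = (2 :: rat) ^ (n * Suc n div 2) *
    (edge_prob n (nat I) (nat (int n - 1 - J)) * edge_prob n (nat (int n - 1 - I)) (nat J)
     + edge_prob n (nat I) (nat J) * edge_prob n (nat (int n - 1 - I)) (nat (int n - 1 - J)))"
proof -
  define i j where "i = nat I" and "j = nat J"
  have e: "even (l + m + int n - 1)" "even (l - m + int n - 1)" using odd by presburger+
  have I: "2 * I = l + m + int n - 1" and J: "2 * J = l - m + int n - 1" using e by (simp_all add: I_def J_def)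
  have ij: "I = int i" "J = int j" using I J block unfolding i_def j_def by linarith+
  have b: "i < n" "Suc i < Suc n" "i < Suc n" "j < n" "Suc j < Suc n" "j < Suc n" using I J block unfolding ij by linarith+
  define r1 r2 c1 c2 where "r1 = j * Suc n + i" and "r2 = j * Suc n + Suc i"
    and "c1 = Suc j * n + i" and "c2 = j * n + i"
  note defs = r1_def r2_def c1_def c2_def
  have md: "r1 mod Suc n = i" "r1 div Suc n = j" "r2 mod Suc n = Suc i" "r2 div Suc n = j"
    "c1 mod n = i" "c1 div n = Suc j" "c2 mod n = i" "c2 div n = j"
    unfolding defs using b by (simp_all only: mod_div_row)
  have less: "r1 < n * Suc n" "r2 < n * Suc n" "c1 < n * Suc n" "c2 < n * Suc n"
    unfolding defs by (intro row_index_less black_row_index_less b)+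
  have count: "of_nat (card (domino_tilings (holey_aztec_diamond n l m))) = (2 :: rat) ^ (n * Suc n div 2) *
    (edge_prob_at n r1 c1 * edge_prob_at n r2 c2 + edge_prob_at n r1 c2 * edge_prob_at n r2 c1)"
  proof (rule card_tilings_holey_edge_probs)
    show "r1 \<noteq> r2" "c1 \<noteq> c2" using md by auto
    show "block_cells l m = {white_cell n r1, white_cell n r2, black_cell n c1, black_cell n c2}"
    proof -
      have "white_cell n r1 = (l - 1, m - 1)" "white_cell n r2 = (l, m)" "black_cell n c1 = (l, m - 1)" "black_cell n c2 = (l - 1, m)"
        unfolding white_cell_def black_cell_def md prod.inject using I J unfolding ij by linarith+
      then show ?thesis by (auto simp: block_cells_def)
    qed
  qed (use less b in \<open>simp_all add: kast_mat_entry md kast_weight_def\<close>)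
  have edges: "edge_prob_at n r1 c1 = edge_prob n (nat I) (nat (int n - 1 - J))"
    "edge_prob_at n r2 c2 = edge_prob n (nat (int n - 1 - I)) (nat J)"
    "edge_prob_at n r1 c2 = edge_prob n (nat I) (nat J)"
    "edge_prob_at n r2 c1 = edge_prob n (nat (int n - 1 - I)) (nat (int n - 1 - J))"
  proof -
    have "nat (int n - 1 - int k) = n - Suc k" for k by linarith
    then show "edge_prob_at n r1 c1 = edge_prob n (nat I) (nat (int n - 1 - J))"
    "edge_prob_at n r2 c2 = edge_prob n (nat (int n - 1 - I)) (nat J)"
    "edge_prob_at n r1 c2 = edge_prob n (nat I) (nat J)"
    "edge_prob_at n r2 c1 = edge_prob n (nat (int n - 1 - I)) (nat (int n - 1 - J))"
      unfolding edge_prob_at_def md ij by simp_all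
  qed
  show ?thesis unfolding count edges ..
qed

text \<open>In this parity class the block has its two black squares in a common row. They are \<open>(I - 1, J)\<close>
and \<open>(I, J)\<close>, and the white squares are \<open>(I, J - 1)\<close> and \<open>(I, J)\<close>.\<close>

lemma card_tilings_holey_even:
  assumes block: "\<bar>l\<bar> + \<bar>m\<bar> \<le> int n - 1" and even: "even (l + m + int n)"
  defines "I \<equiv> (l + m + int n) div 2" and "J \<equiv> (l - m + int n) div 2"
  shows "of_nat (card (domino_tilings (holey_aztec_diamond n l m))) = (2 :: rat) ^ (n * Suc n div 2) *
    (edge_prob n (nat (int n - I)) (nat J) * edge_prob n (nat I) (nat (int n - J))
     + edge_prob n (nat I) (nat J) * edge_prob n (nat (int n - I)) (nat (int n - J)))"
proof -
  \<comment> \<open>Both \<open>I\<close> and \<open>J\<close> are positive here, so that \<open>I - 1\<close> and \<open>J - 1\<close> are proper coordinates.\<close>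
  define i j where "i = nat (I - 1)" and "j = nat (J - 1)"
  have e: "even (l - m + int n)" using even by presburger
  have I: "2 * I = l + m + int n" and J: "2 * J = l - m + int n" using even e by (simp_all add: I_def J_def)
  have ij: "I = int (Suc i)" "J = int (Suc j)" using I J block unfolding i_def j_def by linarith+
  have b: "i < n" "Suc i < n" "Suc i < Suc n" "j < n" "Suc j < n" "Suc j < Suc n"
  proof -
    have "l + m \<le> int n - 1" "l - m \<le> int n - 1" using block by linarith+
    then have "int i + 1 < int n" "int j + 1 < int n" using I J unfolding ij of_nat_Suc by presburger+
    then show "i < n" "Suc i < n" "Suc i < Suc n" "j < n" "Suc j < n" "Suc j < Suc n" by simp_all
  qed
  define r1 r2 c1 c2 where "r1 = Suc j * Suc n + Suc i" and "r2 = j * Suc n + Suc i"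
    and "c1 = Suc j * n + i" and "c2 = Suc j * n + Suc i"
  note defs = r1_def r2_def c1_def c2_def
  have md: "r1 mod Suc n = Suc i" "r1 div Suc n = Suc j" "r2 mod Suc n = Suc i" "r2 div Suc n = j"
    "c1 mod n = i" "c1 div n = Suc j" "c2 mod n = Suc i" "c2 div n = Suc j"
    unfolding defs using b by (simp_all only: mod_div_row)
  have less: "r1 < n * Suc n" "r2 < n * Suc n" "c1 < n * Suc n" "c2 < n * Suc n"
    unfolding defs by (intro row_index_less black_row_index_less b)+
  have count: "of_nat (card (domino_tilings (holey_aztec_diamond n l m))) = (2 :: rat) ^ (n * Suc n div 2) *
    (edge_prob_at n r1 c1 * edge_prob_at n r2 c2 + edge_prob_at n r1 c2 * edge_prob_at n r2 c1)"
  proof (rule card_tilings_holey_edge_probs)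
    show "r1 \<noteq> r2" "c1 \<noteq> c2" using md by auto
    show "block_cells l m = {white_cell n r1, white_cell n r2, black_cell n c1, black_cell n c2}"
    proof -
      have "white_cell n r1 = (l, m - 1)" "white_cell n r2 = (l - 1, m)" "black_cell n c1 = (l - 1, m - 1)" "black_cell n c2 = (l, m)"
        unfolding white_cell_def black_cell_def md prod.inject using I J unfolding ij by presburger+
      then show ?thesis by (auto simp: block_cells_def)
    qed
  qed (use less b in \<open>simp_all add: kast_mat_entry md kast_weight_def\<close>)
  have edges: "edge_prob_at n r1 c1 = edge_prob n (nat (int n - I)) (nat J)"
    "edge_prob_at n r2 c2 = edge_prob n (nat I) (nat (int n - J))"
    "edge_prob_at n r1 c2 = edge_prob n (nat I) (nat J)"
    "edge_prob_at n r2 c1 = edge_prob n (nat (int n - I)) (nat (int n - J))"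
  proof -
    have "nat (int n - int (Suc k)) = n - Suc k" "nat (1 + int k) = Suc k" for k by linarith+
    then show "edge_prob_at n r1 c1 = edge_prob n (nat (int n - I)) (nat J)"
    "edge_prob_at n r2 c2 = edge_prob n (nat I) (nat (int n - J))"
    "edge_prob_at n r1 c2 = edge_prob n (nat I) (nat J)"
    "edge_prob_at n r2 c1 = edge_prob n (nat (int n - I)) (nat (int n - J))"
      unfolding edge_prob_at_def md ij by simp_all
  qed
  show ?thesis unfolding count edges ..
qed

section \<open>Rational dependence near the centre\<close>

text \<open>One numerator and one denominator have to serve for all \<open>p\<close> in \<open>S\<close>, and the denominator must not
vanish on \<open>S\<close>; this is more than an identity of rational functions.\<close>

definition ratfun_on :: "nat set \<Rightarrow> (nat \<Rightarrow> rat) \<Rightarrow> bool" where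
  "ratfun_on S f \<longleftrightarrow> (\<exists>a b :: rat poly. \<forall>p\<in>S. poly b (of_nat p) \<noteq> 0 \<and> f p = poly a (of_nat p) / poly b (of_nat p))"

lemma ratfun_onI:
  "(\<And>p. p \<in> S \<Longrightarrow> poly b (of_nat p) \<noteq> 0 \<and> f p = poly a (of_nat p) / poly b (of_nat p)) \<Longrightarrow> ratfun_on S f"
  unfolding ratfun_on_def by blast

lemma ratfun_on_subset: "ratfun_on S f \<Longrightarrow> S' \<subseteq> S \<Longrightarrow> ratfun_on S' f"
  unfolding ratfun_on_def by blast

lemma ratfun_on_cong: "(\<And>p. p \<in> S \<Longrightarrow> f p = g p) \<Longrightarrow> ratfun_on S f \<longleftrightarrow> ratfun_on S g"
  unfolding ratfun_on_def by simp

lemma ratfun_on_const [simp]: "ratfun_on S (\<lambda>_. c)"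
  by (rule ratfun_onI[of _ 1 _ "[:c:]"]) simp

lemma ratfun_on_linear: "ratfun_on S (\<lambda>p. c * of_nat p + d)"
  by (rule ratfun_onI[of _ 1 _ "[:d, c:]"]) simp

lemma ratfun_on_add:
  assumes "ratfun_on S f" "ratfun_on S g"
  shows "ratfun_on S (\<lambda>p. f p + g p)"
proof -
  from assms obtain a b c d where "\<And>p. p \<in> S \<Longrightarrow> poly b (of_nat p) \<noteq> 0 \<and> f p = poly a (of_nat p) / poly b (of_nat p)"
     "\<And>p. p \<in> S \<Longrightarrow> poly d (of_nat p) \<noteq> 0 \<and> g p = poly c (of_nat p) / poly d (of_nat p)"
    unfolding ratfun_on_def by metis
  then show ?thesis
    by (intro ratfun_onI[of _ "b * d" _ "a * d + c * b"]) (simp add: field_simps)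
qed

lemma ratfun_on_mult:
  assumes "ratfun_on S f" "ratfun_on S g"
  shows "ratfun_on S (\<lambda>p. f p * g p)"
proof -
  from assms obtain a b c d where "\<And>p. p \<in> S \<Longrightarrow> poly b (of_nat p) \<noteq> 0 \<and> f p = poly a (of_nat p) / poly b (of_nat p)"
     "\<And>p. p \<in> S \<Longrightarrow> poly d (of_nat p) \<noteq> 0 \<and> g p = poly c (of_nat p) / poly d (of_nat p)"
    unfolding ratfun_on_def by metis
  then show ?thesis
    by (intro ratfun_onI[of _ "b * d" _ "a * c"]) (simp add: field_simps)
qed

lemma ratfun_on_inverse_linear:
  assumes "\<And>p. p \<in> S \<Longrightarrow> c * of_nat p + d \<noteq> (0 :: rat)"
  shows "ratfun_on S (\<lambda>p. 1 / (c * of_nat p + d))"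
  by (rule ratfun_onI[of _ "[:d, c:]" _ 1]) (use assms in \<open>simp add: add.commute mult.commute\<close>)

lemma ratfun_on_sum: "(\<And>i. i \<in> I \<Longrightarrow> ratfun_on S (f i)) \<Longrightarrow> ratfun_on S (\<lambda>p. \<Sum>i\<in>I. f i p)"
  by (induction I rule: infinite_finite_induct) (auto intro: ratfun_on_add)

definition central_binom :: "nat \<Rightarrow> rat" where "central_binom p = of_nat ((2 * p - 1) choose p)"

lemma central_binom_pos: "1 \<le> p \<Longrightarrow> central_binom p > 0"
  by (simp add: central_binom_def)

text \<open>The lower index is an integer because indices of the form \<open>p + e\<close> with fixed \<open>e\<close> become negative for small
\<open>p\<close>, where the value must be \<open>0\<close>.\<close>

definition zbinom :: "nat \<Rightarrow> int \<Rightarrow> rat" where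
  "zbinom N k = (if k < 0 then 0 else of_nat (N choose nat k))"

lemma zbinom_step:
  assumes "0 < N"
  shows "zbinom (N - 1) k = zbinom N k * (of_nat N - of_int k) / of_nat N"
proof (cases "0 \<le> k \<and> nat k \<le> N")
  case True
  then obtain j where k: "k = int j" and j: "j \<le> N" by (metis nat_0_le)
  have "(N - j) * (N choose j) = N * ((N - 1) choose j)" using binomial_absorb_comp[of N j] .
  then have "of_nat (N - j) * of_nat (N choose j) = (of_nat N * of_nat ((N - 1) choose j) :: rat)"
    by (metis of_nat_mult)
  then show ?thesis using assms j by (simp add: zbinom_def k of_nat_diff field_simps)
next
  case False
  then show ?thesis by (auto simp: zbinom_def binomial_eq_0)
qed

text \<open>The ratio of consecutive binomial coefficients is \<open>(p - e) / (p + e + 1)\<close>. Its denominator is positive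
because the lower index grows away from the middle.\<close>

lemma ratfun_on_binomial_upper:
  "ratfun_on {p. 1 \<le> p} (\<lambda>p. of_nat ((2 * p) choose (p + e)) / central_binom p)"
proof (induction e)
  case 0
  have "of_nat ((2 * p) choose (p + 0)) / central_binom p = 2" if p: "1 \<le> p" for p
  proof -
    obtain q where q: "p = Suc q" using p by (cases p) auto
    have "(2 * p) choose p = ((2 * p - 1) choose q) + ((2 * p - 1) choose p)"
      using choose_reduce_nat[of "2 * p" p] q by simp
    also have "(2 * p - 1) choose q = (2 * p - 1) choose p"
      using binomial_symmetric[of q "2 * p - 1"] by (simp add: q mult_Suc_right)
    finally show ?thesis using central_binom_pos[OF p] by (simp add: central_binom_def)
  qed
  then show ?case by (subst ratfun_on_cong[of _ _ "\<lambda>_. 2"]) auto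
next
  case (Suc e)
  have eq: "of_nat ((2 * p) choose (p + Suc e)) / central_binom p =
      (of_nat ((2 * p) choose (p + e)) / central_binom p) * ((1 * of_nat p + (- of_nat e)) * (1 / (1 * of_nat p + (of_nat e + 1))))" for p
  proof -
    have "Suc (p + e) * ((2 * p) choose Suc (p + e)) = (2 * p - (p + e)) * ((2 * p) choose (p + e))"
      using binomial_absorb_comp[of "2 * p" "p + e"] binomial_absorption[of "p + e" "2 * p"] by simp
    then have "of_nat (Suc (p + e)) * of_nat ((2 * p) choose Suc (p + e))
        = (of_nat (2 * p - (p + e)) * of_nat ((2 * p) choose (p + e)) :: rat)"
      by (metis of_nat_mult)
    moreover have "(of_nat (2 * p - (p + e)) * of_nat ((2 * p) choose (p + e)) :: rat)
       = (of_nat p - of_nat e) * of_nat ((2 * p) choose (p + e))"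
      by (cases "e \<le> p") (simp_all add: of_nat_diff binomial_eq_0)
    ultimately have "(of_nat p + (of_nat e + 1)) * of_nat ((2 * p) choose (p + Suc e))
       = ((of_nat p - of_nat e) * of_nat ((2 * p) choose (p + e)) :: rat)" by (simp add: algebra_simps)
    moreover have "(of_nat p + (of_nat e + 1) :: rat) > 0" by (intro add_nonneg_pos) auto
    ultimately have "of_nat ((2 * p) choose (p + Suc e))
       = ((of_nat p - of_nat e) * of_nat ((2 * p) choose (p + e)) / (of_nat p + (of_nat e + 1)) :: rat)"
      by (simp add: field_simps)
    then show ?thesis by (simp add: mult.commute)
  qed
  moreover have "ratfun_on {p. 1 \<le> p} (\<lambda>p. 1 / (1 * of_nat p + (of_nat e + 1)))"
  proof (rule ratfun_on_inverse_linear)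
    fix p :: nat
    have "(1 * of_nat p + (of_nat e + 1) :: rat) > 0" by (simp add: add_nonneg_pos)
    then show "1 * of_nat p + (of_nat e + 1) \<noteq> (0 :: rat)" by simp
  qed
  ultimately show ?case
    by (intro iffD2[OF ratfun_on_cong[OF eq]] ratfun_on_mult ratfun_on_linear Suc)
qed

text \<open>For \<open>t = 0\<close> the symmetry of binomial coefficients reduces the claim to lower indices above the middle. Lowering
the upper index costs the factor \<open>(N - k) / N\<close>, whose denominator does not vanish since \<open>t < 2 * p\<close>.\<close>

lemma ratfun_on_zbinom:
  "ratfun_on {p. 1 \<le> p \<and> t \<le> 2 * p} (\<lambda>p. zbinom (2 * p - t) (int p + e) / central_binom p)"
proof (induction t)
  case 0
  have "zbinom (2 * p) (int p + e) = of_nat ((2 * p) choose (p + nat \<bar>e\<bar>))" for p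
  proof (cases "0 \<le> int p + e")
    case True
    show ?thesis
    proof (cases "0 \<le> e")
      case True
      then show ?thesis by (simp add: zbinom_def nat_add_distrib)
    next
      case False
      then have "nat (int p + e) \<le> 2 * p" "2 * p - nat (int p + e) = p + nat \<bar>e\<bar>" using True by auto
      then show ?thesis using binomial_symmetric[of "nat (int p + e)" "2 * p"] True by (simp add: zbinom_def)
    qed
  next
    case False
    then show ?thesis by (simp add: zbinom_def binomial_eq_0)
  qed
  then show ?case using ratfun_on_binomial_upper by simp
next
  case (Suc t)
  let ?S = "{p. 1 \<le> p \<and> Suc t \<le> 2 * p}"
  have eq: "zbinom (2 * p - Suc t) (int p + e) / central_binom p = (zbinom (2 * p - t) (int p + e) / central_binom p) *
     ((1 * of_nat p + (- of_nat t - of_int e)) * (1 / (2 * of_nat p + (- of_nat t))))" if "p \<in> ?S" for p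
    using zbinom_step[of "2 * p - t" "int p + e"] that by (simp add: of_nat_diff algebra_simps)
  moreover have "ratfun_on ?S (\<lambda>p. zbinom (2 * p - t) (int p + e) / central_binom p)"
    by (rule ratfun_on_subset[OF Suc]) auto
  moreover have "ratfun_on ?S (\<lambda>p. 1 / (2 * of_nat p + (- of_nat t)))"
  proof (rule ratfun_on_inverse_linear)
    fix p assume "p \<in> ?S"
    then have "(of_nat t :: rat) < of_nat (2 * p)" unfolding of_nat_less_iff by auto
    then show "2 * of_nat p + - of_nat t \<noteq> (0 :: rat)" by simp
  qed
  ultimately show ?case
    by (intro iffD2[OF ratfun_on_cong[OF eq]] ratfun_on_mult ratfun_on_linear)
qed

lemma coeff_one_minus_square_power:
  "coeff ([:1, 0, -1 :: rat:] ^ N) i = (if even i then (-1) ^ (i div 2) * of_nat (N choose (i div 2)) else 0)"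
proof (induction N arbitrary: i)
  case 0
  show ?case by (cases "i = 0") (auto simp: binomial_eq_0 elim!: evenE)
next
  case (Suc N)
  consider "i = 0" | "i = 1" | k where "i = Suc (Suc k)" by (metis One_nat_def not0_implies_Suc)
  then show ?case by cases (simp_all add: Suc.IH algebra_simps)
qed

text \<open>The index is an integer for the same reason as in \<open>zbinom\<close>: at the boundary of the diamond it can be
\<open>-1\<close>.\<close>

definition krawtchouk_int :: "nat \<Rightarrow> int \<Rightarrow> nat \<Rightarrow> rat" where
  "krawtchouk_int m c a = (if c < 0 then 0 else krawtchouk m (nat c) a)"

text \<open>Both exponents in \<open>(1 - x) ^ a * (1 + x) ^ (m - a)\<close> are \<open>2 * p\<close> up to a constant. Splitting off
\<open>(1 - x\<^sup>2) ^ (2 * p - t)\<close> leaves a polynomial that does not depend on \<open>p\<close>, so the coefficient is a fixed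
linear combination of signed binomial coefficients with upper index \<open>2 * p - t\<close> and lower index near \<open>p\<close>.\<close>

lemma krawtchouk_central:
  assumes S: "\<And>p. p \<in> S \<Longrightarrow> 1 \<le> p \<and> 0 \<le> 2 * int p + \<iota> \<and> 2 * int p + \<iota> \<le> 4 * int p + \<mu>"
  shows "ratfun_on S (\<lambda>p. (-1) ^ p * krawtchouk_int (nat (4 * int p + \<mu>)) (2 * int p + \<gamma>) (nat (2 * int p + \<iota>)) / central_binom p)"
proof -
  \<comment> \<open>The least \<open>t\<close> for which the exponents \<open>u\<close> and \<open>v\<close> of the remaining factors are nonnegative.\<close>
  define t where "t = nat (max 0 (max (- \<iota>) (\<iota> - \<mu>)))"
  define u where "u = nat (\<iota> + int t)"
  define v where "v = nat (\<mu> - \<iota> + int t)"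
  define Q where "Q = [:1, -1:] ^ u * [:1, 1 :: rat:] ^ v"
  \<comment> \<open>The coefficient of a power of \<open>1 - x\<^sup>2\<close> at \<open>2 * p + \<gamma> - s\<close> vanishes unless this index is even, and then half of it is \<open>p + e s\<close>.\<close>
  define e where "e s = (\<gamma> - int s) div 2" for s
  have St: "1 \<le> p" "t \<le> 2 * p" if "p \<in> S" for p using S[OF that] by (auto simp: t_def)
  have eq: "(-1) ^ p * krawtchouk_int (nat (4 * int p + \<mu>)) (2 * int p + \<gamma>) (nat (2 * int p + \<iota>)) / central_binom p
     = (\<Sum>s\<le>u + v. (if even (\<gamma> - int s) then coeff Q s * (if even (e s) then 1 else -1) else 0) *
          (zbinom (2 * p - t) (int p + e s) / central_binom p))" if p: "p \<in> S" for p
  proof -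
    have exps: "nat (2 * int p + \<iota>) = (2 * p - t) + u"
      "nat (4 * int p + \<mu>) - nat (2 * int p + \<iota>) = (2 * p - t) + v"
    proof -
      have "int u = \<iota> + int t" "int v = \<mu> - \<iota> + int t" by (auto simp: t_def u_def v_def)
      then show "nat (2 * int p + \<iota>) = (2 * p - t) + u"
        "nat (4 * int p + \<mu>) - nat (2 * int p + \<iota>) = (2 * p - t) + v"
        using S[OF p] St[OF p] by linarith+
    qed
    have degQ: "degree Q \<le> u + v"
      unfolding Q_def by (rule order.trans[OF degree_mult_le]) (simp add: degree_power_eq)
    have "[:1, -1:] ^ nat (2 * int p + \<iota>) * [:1, 1 :: rat:] ^ (nat (4 * int p + \<mu>) - nat (2 * int p + \<iota>))
        = ([:1, -1:] * [:1, 1:]) ^ (2 * p - t) * Q"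
      unfolding exps(2) unfolding exps(1) Q_def by (simp only: power_add power_mult_distrib mult_ac)
    also have "[:1, -1:] * [:1, 1:] = [:1, 0, -1 :: rat:]" by simp
    also have "[:1, 0, -1:] ^ (2 * p - t) * Q = (\<Sum>s\<le>u + v. monom (coeff Q s) s * [:1, 0, -1:] ^ (2 * p - t))"
      by (simp only: sum_distrib_right[symmetric] poly_as_sum_of_monoms'[OF degQ] mult.commute)
    finally have "krawtchouk_int (nat (4 * int p + \<mu>)) (2 * int p + \<gamma>) (nat (2 * int p + \<iota>)) =
      (\<Sum>s\<le>u + v. if 2 * int p + \<gamma> < 0 then 0 else
         coeff (monom (coeff Q s) s * [:1, 0, -1:] ^ (2 * p - t)) (nat (2 * int p + \<gamma>)))"
      by (simp add: krawtchouk_int_def krawtchouk_def coeff_sum)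
    also have "\<dots> = (\<Sum>s\<le>u + v. (if even (\<gamma> - int s) then coeff Q s * (if even (e s) then 1 else -1) else 0) *
          ((-1) ^ p * zbinom (2 * p - t) (int p + e s)))"
    proof (intro sum.cong refl)
      fix s
      show "(if 2 * int p + \<gamma> < 0 then 0 else
         coeff (monom (coeff Q s) s * [:1, 0, -1:] ^ (2 * p - t)) (nat (2 * int p + \<gamma>)))
        = (if even (\<gamma> - int s) then coeff Q s * (if even (e s) then 1 else -1) else 0) *
          ((-1) ^ p * zbinom (2 * p - t) (int p + e s))"
      proof (cases "0 \<le> 2 * int p + \<gamma> - int s")
        case False
        then have "int p + e s < 0" if "even (\<gamma> - int s)" using that by (auto simp: e_def)
        then show ?thesis using False by (auto simp: coeff_monom_mult zbinom_def)
      next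
        case True
        define d where "d = nat (2 * int p + \<gamma>) - s"
        have d: "int d = 2 * int p + \<gamma> - int s" using True by (simp add: d_def)
        have lhs: "(if 2 * int p + \<gamma> < 0 then 0 else
           coeff (monom (coeff Q s) s * [:1, 0, -1:] ^ (2 * p - t)) (nat (2 * int p + \<gamma>)))
           = coeff Q s * (if even d then (-1) ^ (d div 2) * of_nat ((2 * p - t) choose (d div 2)) else 0)"
        proof -
          have "\<not> 2 * int p + \<gamma> < 0" "\<not> nat (2 * int p + \<gamma>) < s" using True by linarith+
          then show ?thesis by (simp only: coeff_monom_mult coeff_one_minus_square_power d_def if_False)
        qed
        show ?thesis
        proof (cases "even (\<gamma> - int s)")
          case ev: True
          then have "even (int d)" unfolding d by presburger
          then have "even d" by simp
          have dd: "int (d div 2) = int p + e s" using ev unfolding zdiv_int d e_def by simp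
          then have "d div 2 = nat (int p + e s)" "0 \<le> int p + e s" by simp_all
          moreover have "(-1 :: rat) ^ (d div 2) = (-1) ^ p * (if even (e s) then 1 else -1)"
          proof -
            have "even (int (d div 2)) \<longleftrightarrow> (even p \<longleftrightarrow> even (e s))" unfolding dd by simp
            then show ?thesis by (simp add: minus_one_power_iff)
          qed
          ultimately show ?thesis using \<open>even d\<close> ev unfolding lhs by (simp add: zbinom_def)
        next
          case False
          then have "odd (int d)" unfolding d by presburger
          then show ?thesis using False unfolding lhs by simp
        qed
      qed
    qed
    finally show ?thesis
      by (simp add: sum_distrib_left sum_divide_distrib mult_ac flip: power_add mult_2)
  qed
  have "ratfun_on S (\<lambda>p. zbinom (2 * p - t) (int p + e s) / central_binom p)" for s
    by (rule ratfun_on_subset[OF ratfun_on_zbinom]) (use St in auto)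
  then show ?thesis
    by (intro iffD2[OF ratfun_on_cong[OF eq]] ratfun_on_sum ratfun_on_mult[OF ratfun_on_const])
qed

definition decay :: "nat \<Rightarrow> rat" where "decay p = central_binom p ^ 2 / 2 ^ (4 * p)"

text \<open>The differences between placement probabilities near the centre and \<open>1 / 4\<close> are of this form.\<close>

definition decay_ratfun_on :: "nat set \<Rightarrow> (nat \<Rightarrow> rat) \<Rightarrow> bool" where
  "decay_ratfun_on S f \<longleftrightarrow> ratfun_on S (\<lambda>p. f p / decay p)"

lemma decay_ratfun_on_cong: "(\<And>p. p \<in> S \<Longrightarrow> f p = g p) \<Longrightarrow> decay_ratfun_on S f \<longleftrightarrow> decay_ratfun_on S g"
  unfolding decay_ratfun_on_def by (rule ratfun_on_cong) simp

lemma decay_ratfun_on_add: "decay_ratfun_on S f \<Longrightarrow> decay_ratfun_on S g \<Longrightarrow> decay_ratfun_on S (\<lambda>p. f p + g p)"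
  unfolding decay_ratfun_on_def add_divide_distrib by (rule ratfun_on_add)

lemma decay_ratfun_on_cmult: "decay_ratfun_on S f \<Longrightarrow> decay_ratfun_on S (\<lambda>p. c * f p)"
  unfolding decay_ratfun_on_def times_divide_eq_right[symmetric] by (rule ratfun_on_mult[OF ratfun_on_const])

lemma decay_ratfun_on_zero: "decay_ratfun_on S (\<lambda>_. 0)"
  by (simp add: decay_ratfun_on_def)

lemma decay_ratfun_on_swap: "decay_ratfun_on S (\<lambda>p. f p - g p) \<Longrightarrow> decay_ratfun_on S (\<lambda>p. g p - f p)"
  using decay_ratfun_on_cmult[of S "\<lambda>p. f p - g p" "-1"] by simp

text \<open>The two factors \<open>(-1) ^ p\<close> cancel.\<close>

lemma decay_ratfun_on_krawtchouk_product:
  assumes S1: "\<And>p. p \<in> S \<Longrightarrow> 1 \<le> p \<and> 0 \<le> 2 * int p + \<iota> \<and> 2 * int p + \<iota> \<le> 4 * int p + \<mu>"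
    and S2: "\<And>p. p \<in> S \<Longrightarrow> 0 \<le> 2 * int p + \<iota>' \<and> 2 * int p + \<iota>' \<le> 4 * int p + \<mu>'"
  shows "decay_ratfun_on S (\<lambda>p. krawtchouk_int (nat (4 * int p + \<mu>)) (2 * int p + \<gamma>) (nat (2 * int p + \<iota>)) *
     krawtchouk_int (nat (4 * int p + \<mu>')) (2 * int p + \<gamma>') (nat (2 * int p + \<iota>')) / 2 ^ (4 * p + \<alpha>))"
proof -
  define f where "f p = (-1) ^ p * krawtchouk_int (nat (4 * int p + \<mu>)) (2 * int p + \<gamma>) (nat (2 * int p + \<iota>)) / central_binom p" for p
  define g where "g p = (-1) ^ p * krawtchouk_int (nat (4 * int p + \<mu>')) (2 * int p + \<gamma>') (nat (2 * int p + \<iota>')) / central_binom p" for p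
  have "ratfun_on S f" "ratfun_on S g"
    unfolding f_def g_def using S1 S2 by (auto intro!: krawtchouk_central)
  then have "ratfun_on S (\<lambda>p. 1 / 2 ^ \<alpha> * (f p * g p))" by (intro ratfun_on_mult ratfun_on_const)
  moreover have "1 / 2 ^ \<alpha> * (f p * g p) = krawtchouk_int (nat (4 * int p + \<mu>)) (2 * int p + \<gamma>) (nat (2 * int p + \<iota>)) *
     krawtchouk_int (nat (4 * int p + \<mu>')) (2 * int p + \<gamma>') (nat (2 * int p + \<iota>')) / 2 ^ (4 * p + \<alpha>) / decay p" if "p \<in> S" for p
  proof -
    have "(-1 :: rat) ^ p * (-1) ^ p = 1" by (simp flip: power_mult_distrib)
    then have "f p * g p = krawtchouk_int (nat (4 * int p + \<mu>)) (2 * int p + \<gamma>) (nat (2 * int p + \<iota>)) *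
     krawtchouk_int (nat (4 * int p + \<mu>')) (2 * int p + \<gamma>') (nat (2 * int p + \<iota>')) / central_binom p ^ 2"
      by (simp add: f_def g_def power2_eq_square mult_ac)
    then show ?thesis using central_binom_pos[of p] S1[OF that] by (simp add: decay_def power_add field_simps)
  qed
  ultimately show ?thesis unfolding decay_ratfun_on_def by (subst (asm) ratfun_on_cong) auto
qed

lemma decay_ratfun_on_edge_right:
  assumes "\<And>p. p \<in> S \<Longrightarrow> 1 \<le> p \<and> 0 \<le> 2 * int p + u \<and> 2 * int p + u < 4 * int p + int \<alpha> \<and>
      0 \<le> 2 * int p + v \<and> 2 * int p + v + int k \<le> 4 * int p + int \<alpha>"
  shows "decay_ratfun_on S (\<lambda>p. edge_prob (4 * p + \<alpha>) (nat (2 * int p + u)) (nat (2 * int p + v))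
     - edge_prob (4 * p + \<alpha>) (nat (2 * int p + u)) (nat (2 * int p + v + int k)))"
  using assms
proof (induction k)
  case 0
  then show ?case by (simp add: decay_ratfun_on_zero)
next
  case (Suc k)
  define w where "w = int \<alpha> - v - int k - 1"
  have S: "1 \<le> p" "0 \<le> 2 * int p + u" "2 * int p + u < 4 * int p + int \<alpha>"
      "0 \<le> 2 * int p + v" "2 * int p + v + int k + 1 \<le> 4 * int p + int \<alpha>" if "p \<in> S" for p
    using Suc.prems[OF that] by auto
  have "decay_ratfun_on S (\<lambda>p. krawtchouk_int (nat (4 * int p + int \<alpha>)) (2 * int p + w) (nat (2 * int p + u)) *
     krawtchouk_int (nat (4 * int p + (int \<alpha> - 1))) (2 * int p + u) (nat (2 * int p + w)) / 2 ^ (4 * p + \<alpha>))"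
    by (rule decay_ratfun_on_krawtchouk_product) (use S in \<open>force simp: w_def\<close>)+
  moreover have "decay_ratfun_on S (\<lambda>p. edge_prob (4 * p + \<alpha>) (nat (2 * int p + u)) (nat (2 * int p + v))
     - edge_prob (4 * p + \<alpha>) (nat (2 * int p + u)) (nat (2 * int p + v + int k)))"
    using Suc.prems by (intro Suc.IH) force
  ultimately have "decay_ratfun_on S (\<lambda>p. krawtchouk_int (nat (4 * int p + int \<alpha>)) (2 * int p + w) (nat (2 * int p + u)) *
     krawtchouk_int (nat (4 * int p + (int \<alpha> - 1))) (2 * int p + u) (nat (2 * int p + w)) / 2 ^ (4 * p + \<alpha>) +
     (edge_prob (4 * p + \<alpha>) (nat (2 * int p + u)) (nat (2 * int p + v))
     - edge_prob (4 * p + \<alpha>) (nat (2 * int p + u)) (nat (2 * int p + v + int k))))"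
    by (rule decay_ratfun_on_add)
  moreover have "krawtchouk_int (nat (4 * int p + int \<alpha>)) (2 * int p + w) (nat (2 * int p + u)) *
     krawtchouk_int (nat (4 * int p + (int \<alpha> - 1))) (2 * int p + u) (nat (2 * int p + w)) / 2 ^ (4 * p + \<alpha>)
    = edge_prob (4 * p + \<alpha>) (nat (2 * int p + u)) (nat (2 * int p + v + int k))
     - edge_prob (4 * p + \<alpha>) (nat (2 * int p + u)) (nat (2 * int p + v + int (Suc k)))" if p: "p \<in> S" for p
  proof -
    note h = S[OF p]
    have e: "nat (2 * int p + v + int (Suc k)) = Suc (nat (2 * int p + v + int k))"
      "nat (2 * int p + w) = 4 * p + \<alpha> - Suc (nat (2 * int p + v + int k))"
      "nat (4 * int p + int \<alpha>) = 4 * p + \<alpha>" "nat (4 * int p + (int \<alpha> - 1)) = 4 * p + \<alpha> - 1"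
      using h by (auto simp: w_def)
    have "0 \<le> 2 * int p + w" "nat (2 * int p + v + int k) < 4 * p + \<alpha>" using h by (auto simp: w_def)
    then show ?thesis using h edge_prob_step_right[of "nat (2 * int p + v + int k)" "4 * p + \<alpha>" "nat (2 * int p + u)"]
      unfolding krawtchouk_int_def e by simp
  qed
  ultimately show ?case by (subst (asm) decay_ratfun_on_cong[of S]) (auto simp: algebra_simps)
qed

lemma decay_ratfun_on_edge_up:
  assumes "\<And>p. p \<in> S \<Longrightarrow> 1 \<le> p \<and> 0 \<le> 2 * int p + u \<and> 2 * int p + u + int k < 4 * int p + int \<alpha> \<and>
      0 \<le> 2 * int p + v \<and> 2 * int p + v \<le> 4 * int p + int \<alpha>"
  shows "decay_ratfun_on S (\<lambda>p. edge_prob (4 * p + \<alpha>) (nat (2 * int p + u + int k)) (nat (2 * int p + v))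
     - edge_prob (4 * p + \<alpha>) (nat (2 * int p + u)) (nat (2 * int p + v)))"
  using assms
proof (induction k)
  case 0
  then show ?case by (simp add: decay_ratfun_on_zero)
next
  case (Suc k)
  define w where "w = int \<alpha> - v"
  have S: "1 \<le> p" "0 \<le> 2 * int p + u" "2 * int p + u + int k + 1 < 4 * int p + int \<alpha>"
      "0 \<le> 2 * int p + v" "2 * int p + v \<le> 4 * int p + int \<alpha>" if "p \<in> S" for p
    using Suc.prems[OF that] by auto
  have "decay_ratfun_on S (\<lambda>p. krawtchouk_int (nat (4 * int p + int \<alpha>)) (2 * int p + (u + int k + 1)) (nat (2 * int p + w)) *
     krawtchouk_int (nat (4 * int p + (int \<alpha> - 1))) (2 * int p + (w - 1)) (nat (2 * int p + (u + int k))) / 2 ^ (4 * p + \<alpha>))"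
    by (rule decay_ratfun_on_krawtchouk_product) (use S in \<open>force simp: w_def\<close>)+
  moreover have "decay_ratfun_on S (\<lambda>p. edge_prob (4 * p + \<alpha>) (nat (2 * int p + u + int k)) (nat (2 * int p + v))
     - edge_prob (4 * p + \<alpha>) (nat (2 * int p + u)) (nat (2 * int p + v)))"
    using Suc.prems by (intro Suc.IH) force
  ultimately have "decay_ratfun_on S (\<lambda>p. krawtchouk_int (nat (4 * int p + int \<alpha>)) (2 * int p + (u + int k + 1)) (nat (2 * int p + w)) *
     krawtchouk_int (nat (4 * int p + (int \<alpha> - 1))) (2 * int p + (w - 1)) (nat (2 * int p + (u + int k))) / 2 ^ (4 * p + \<alpha>) +
     (edge_prob (4 * p + \<alpha>) (nat (2 * int p + u + int k)) (nat (2 * int p + v))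
     - edge_prob (4 * p + \<alpha>) (nat (2 * int p + u)) (nat (2 * int p + v))))"
    by (rule decay_ratfun_on_add)
  moreover have "krawtchouk_int (nat (4 * int p + int \<alpha>)) (2 * int p + (u + int k + 1)) (nat (2 * int p + w)) *
     krawtchouk_int (nat (4 * int p + (int \<alpha> - 1))) (2 * int p + (w - 1)) (nat (2 * int p + (u + int k))) / 2 ^ (4 * p + \<alpha>)
    = edge_prob (4 * p + \<alpha>) (nat (2 * int p + u + int (Suc k))) (nat (2 * int p + v))
     - edge_prob (4 * p + \<alpha>) (nat (2 * int p + u + int k)) (nat (2 * int p + v))" if p: "p \<in> S" for p
  proof -
    note h = S[OF p]
    define i where "i = nat (2 * int p + u + int k)"
    define j where "j = nat (2 * int p + v)"
    have e: "nat (2 * int p + (u + int k + 1)) = Suc i" "nat (2 * int p + u + int (Suc k)) = Suc i"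
      "nat (2 * int p + (u + int k)) = i" "nat (2 * int p + w) = 4 * p + \<alpha> - j"
      "nat (2 * int p + (w - 1)) = 4 * p + \<alpha> - j - 1"
      "nat (4 * int p + int \<alpha>) = 4 * p + \<alpha>" "nat (4 * int p + (int \<alpha> - 1)) = 4 * p + \<alpha> - 1"
      using h by (auto simp: w_def i_def j_def)
    have c: "\<not> 2 * int p + (u + int k + 1) < 0" "2 * int p + (w - 1) < 0 \<longleftrightarrow> 4 * p + \<alpha> \<le> j" "Suc i < 4 * p + \<alpha>"
      using h by (auto simp: w_def i_def j_def)
    show ?thesis using edge_prob_step_up[of i "4 * p + \<alpha>" j] c
      unfolding krawtchouk_int_def e i_def[symmetric] j_def[symmetric] by simp
  qed
  ultimately show ?case by (subst (asm) decay_ratfun_on_cong[of S]) (auto simp: algebra_simps)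
qed

lemma decay_ratfun_on_edge_diff:
  assumes S: "\<And>p. p \<in> S \<Longrightarrow> 1 \<le> p \<and> 0 \<le> 2 * int p + u \<and> 2 * int p + u < 4 * int p + int \<alpha> \<and>
      0 \<le> 2 * int p + v \<and> 2 * int p + v \<le> 4 * int p + int \<alpha> \<and>
      0 \<le> 2 * int p + u' \<and> 2 * int p + u' < 4 * int p + int \<alpha> \<and>
      0 \<le> 2 * int p + v' \<and> 2 * int p + v' \<le> 4 * int p + int \<alpha>"
  shows "decay_ratfun_on S (\<lambda>p. edge_prob (4 * p + \<alpha>) (nat (2 * int p + u)) (nat (2 * int p + v))
     - edge_prob (4 * p + \<alpha>) (nat (2 * int p + u')) (nat (2 * int p + v')))"
proof -
  let ?E = "\<lambda>u v p. edge_prob (4 * p + \<alpha>) (nat (2 * int p + u)) (nat (2 * int p + v))"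
  have right: "decay_ratfun_on S (\<lambda>p. ?E u' v p - ?E u' v' p)"
  proof (cases "v \<le> v'")
    case True
    then have "decay_ratfun_on S (\<lambda>p. ?E u' v p - edge_prob (4 * p + \<alpha>) (nat (2 * int p + u')) (nat (2 * int p + v + int (nat (v' - v)))))"
      by (intro decay_ratfun_on_edge_right) (use S in force)
    then show ?thesis using True by simp
  next
    case False
    then have "decay_ratfun_on S (\<lambda>p. ?E u' v' p - edge_prob (4 * p + \<alpha>) (nat (2 * int p + u')) (nat (2 * int p + v' + int (nat (v - v')))))"
      by (intro decay_ratfun_on_edge_right) (use S in force)
    then show ?thesis using False by (intro decay_ratfun_on_swap[of _ "?E u' v'"]) simp
  qed
  have up: "decay_ratfun_on S (\<lambda>p. ?E u v p - ?E u' v p)"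
  proof (cases "u' \<le> u")
    case True
    then have "decay_ratfun_on S (\<lambda>p. edge_prob (4 * p + \<alpha>) (nat (2 * int p + u' + int (nat (u - u')))) (nat (2 * int p + v)) - ?E u' v p)"
      by (intro decay_ratfun_on_edge_up) (use S in force)
    then show ?thesis using True by simp
  next
    case False
    then have "decay_ratfun_on S (\<lambda>p. edge_prob (4 * p + \<alpha>) (nat (2 * int p + u + int (nat (u' - u)))) (nat (2 * int p + v)) - ?E u v p)"
      by (intro decay_ratfun_on_edge_up) (use S in force)
    then show ?thesis using False by (intro decay_ratfun_on_swap[of _ "?E u' v"]) simp
  qed
  show ?thesis using decay_ratfun_on_add[OF up right] by simp
qed

text \<open>The four mirror images of a position add up to \<open>1\<close>, so \<open>4 * E - 1\<close> is the sum of the differences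
between \<open>E\<close> and its mirror images. These stay at bounded distance, so finitely many steps lead from one to
the other.\<close>

lemma decay_ratfun_on_edge_quarter:
  assumes S: "\<And>p. p \<in> S \<Longrightarrow> 1 \<le> p \<and> 0 \<le> 2 * int p + u \<and> 2 * int p + u < 4 * int p + int \<alpha> \<and>
      0 \<le> 2 * int p + v \<and> 2 * int p + v \<le> 4 * int p + int \<alpha>"
  shows "decay_ratfun_on S (\<lambda>p. edge_prob (4 * p + \<alpha>) (nat (2 * int p + u)) (nat (2 * int p + v)) - 1 / 4)"
proof -
  let ?E = "\<lambda>u v p. edge_prob (4 * p + \<alpha>) (nat (2 * int p + u)) (nat (2 * int p + v))"
  define u' where "u' = int \<alpha> - 1 - u"
  define v' where "v' = int \<alpha> - v"
  have "decay_ratfun_on S (\<lambda>p. (1 / 4) * ((?E u v p - ?E u' v p) + ((?E u v p - ?E u v' p) + (?E u v p - ?E u' v' p))))"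
    by (intro decay_ratfun_on_cmult decay_ratfun_on_add decay_ratfun_on_edge_diff) (use S in \<open>force simp: u'_def v'_def\<close>)+
  moreover have "(1 / 4) * ((?E u v p - ?E u' v p) + ((?E u v p - ?E u v' p) + (?E u v p - ?E u' v' p))) = ?E u v p - 1 / 4"
    if p: "p \<in> S" for p
  proof -
    have e: "nat (2 * int p + u') = 4 * p + \<alpha> - 1 - nat (2 * int p + u)" "nat (2 * int p + v') = 4 * p + \<alpha> - nat (2 * int p + v)"
      using S[OF p] by (auto simp: u'_def v'_def)
    have "nat (2 * int p + u) < 4 * p + \<alpha>" "nat (2 * int p + v) \<le> 4 * p + \<alpha>" using S[OF p] by auto
    from edge_prob_sum[OF this] show ?thesis unfolding e by (simp add: field_simps)
  qed
  ultimately show ?thesis by (subst (asm) decay_ratfun_on_cong) auto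
qed

section \<open>The number of tilings\<close>

lemma ratfun_on_fract:
  assumes "ratfun_on S f"
  shows "\<exists>g :: rat poly fract. \<forall>p\<in>S. ratfun_defined_at g (of_nat p) \<and> ratfun_eval g (of_nat p) = f p"
proof -
  obtain a b :: "rat poly" where ab: "\<And>p. p \<in> S \<Longrightarrow> poly b (of_nat p) \<noteq> 0 \<and> f p = poly a (of_nat p) / poly b (of_nat p)"
    using assms by (auto simp: ratfun_on_def)
  have "ratfun_defined_at (Fract a b) (of_nat p) \<and> ratfun_eval (Fract a b) (of_nat p) = f p" if "p \<in> S" for p
    using ab[OF that] by (auto simp: ratfun_defined_at_def ratfun_eval_Fract)
  then show ?thesis by blast
qed

text \<open>With \<open>E = 1 / 4 + decay * \<rho>\<close> for each factor, \<open>g\<close> comes from the terms that are linear in the \<open>\<rho>\<close>'s and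
\<open>h\<close> from the quadratic ones. The powers of \<open>2 ^ \<alpha>\<close> compensate the exponents in the
statement.\<close>

lemma decay_ratfun_on_pair_products:
  assumes E: "decay_ratfun_on S (\<lambda>p. e1 p - 1 / 4)" "decay_ratfun_on S (\<lambda>p. e2 p - 1 / 4)" "decay_ratfun_on S (\<lambda>p. e3 p - 1 / 4)" "decay_ratfun_on S (\<lambda>p. e4 p - 1 / 4)"
    and S: "\<And>p. p \<in> S \<Longrightarrow> 1 \<le> p"
  shows "\<exists>g h :: rat poly fract. \<forall>p\<in>S.
      ratfun_defined_at g (of_nat p) \<and> ratfun_defined_at h (of_nat p) \<and>
      e1 p * e2 p + e3 p * e4 p =
        1 / 8
         + 2 powi (- 4 * int p - int \<alpha> - 2) * of_nat ((2 * p - 1) choose p) ^ 2 * ratfun_eval g (of_nat p)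
         + 2 powi (- 8 * int p - 2 * int \<alpha>) * of_nat ((2 * p - 1) choose p) ^ 4 * ratfun_eval h (of_nat p)"
proof -
  define \<rho> where "\<rho> e p = (e p - 1 / 4) / decay p" for e :: "nat \<Rightarrow> rat" and p
  have rf: "ratfun_on S (\<rho> e1)" "ratfun_on S (\<rho> e2)" "ratfun_on S (\<rho> e3)" "ratfun_on S (\<rho> e4)"
    using E unfolding decay_ratfun_on_def \<rho>_def .
  have "ratfun_on S (\<lambda>p. 2 ^ \<alpha> * (\<rho> e1 p + (\<rho> e2 p + (\<rho> e3 p + \<rho> e4 p))))"
    by (intro ratfun_on_mult ratfun_on_add ratfun_on_const rf)
  then obtain g where g: "\<And>p. p \<in> S \<Longrightarrow> ratfun_defined_at g (of_nat p)"
     "\<And>p. p \<in> S \<Longrightarrow> ratfun_eval g (of_nat p) = 2 ^ \<alpha> * (\<rho> e1 p + (\<rho> e2 p + (\<rho> e3 p + \<rho> e4 p)))"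
    using ratfun_on_fract by blast
  have "ratfun_on S (\<lambda>p. 2 ^ (2 * \<alpha>) * (\<rho> e1 p * \<rho> e2 p + \<rho> e3 p * \<rho> e4 p))"
    by (intro ratfun_on_mult ratfun_on_add ratfun_on_const rf)
  then obtain h where h: "\<And>p. p \<in> S \<Longrightarrow> ratfun_defined_at h (of_nat p)"
     "\<And>p. p \<in> S \<Longrightarrow> ratfun_eval h (of_nat p) = 2 ^ (2 * \<alpha>) * (\<rho> e1 p * \<rho> e2 p + \<rho> e3 p * \<rho> e4 p)"
    using ratfun_on_fract by blast
  have "e1 p * e2 p + e3 p * e4 p =
        1 / 8
         + 2 powi (- 4 * int p - int \<alpha> - 2) * of_nat ((2 * p - 1) choose p) ^ 2 * ratfun_eval g (of_nat p)
         + 2 powi (- 8 * int p - 2 * int \<alpha>) * of_nat ((2 * p - 1) choose p) ^ 4 * ratfun_eval h (of_nat p)"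
    if p: "p \<in> S" for p
  proof -
    have "decay p \<noteq> 0" using central_binom_pos[OF S[OF p]] by (simp add: decay_def)
    then have e: "e p = 1 / 4 + decay p * \<rho> e p" for e by (simp add: \<rho>_def)
    have "- 4 * int p - int \<alpha> - 2 = - int (4 * p + \<alpha> + 2)" by simp
    then have "(2 :: rat) powi (- 4 * int p - int \<alpha> - 2) = 2 powi (- int (4 * p + \<alpha> + 2))" by (simp only:)
    also have "\<dots> = 1 / 2 ^ (4 * p + \<alpha> + 2)" by (simp only: power_int_minus power_int_of_nat inverse_eq_divide)
    also have "\<dots> = 1 / (4 * 2 ^ \<alpha> * 2 ^ (4 * p))" by (simp add: power_add)
    finally have g1: "(2 :: rat) powi (- 4 * int p - int \<alpha> - 2) = 1 / (4 * 2 ^ \<alpha> * 2 ^ (4 * p))" .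
    have g2: "2 powi (- 4 * int p - int \<alpha> - 2) * of_nat ((2 * p - 1) choose p) ^ 2 * ratfun_eval g (of_nat p)
        = decay p * (\<rho> e1 p + (\<rho> e2 p + (\<rho> e3 p + \<rho> e4 p))) / 4"
      unfolding g1 g(2)[OF p] central_binom_def[symmetric] decay_def by (simp add: field_simps)
    have "- 8 * int p - 2 * int \<alpha> = - int (8 * p + 2 * \<alpha>)" by simp
    then have "(2 :: rat) powi (- 8 * int p - 2 * int \<alpha>) = 2 powi (- int (8 * p + 2 * \<alpha>))" by (simp only:)
    also have "\<dots> = 1 / 2 ^ (8 * p + 2 * \<alpha>)" by (simp only: power_int_minus power_int_of_nat inverse_eq_divide)
    also have "\<dots> = 1 / (2 ^ (2 * \<alpha>) * (2 ^ (4 * p) * 2 ^ (4 * p)))" by (simp flip: power_add)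
    finally have h1: "(2 :: rat) powi (- 8 * int p - 2 * int \<alpha>) = 1 / (2 ^ (2 * \<alpha>) * (2 ^ (4 * p) * 2 ^ (4 * p)))" .
    have h2: "2 powi (- 8 * int p - 2 * int \<alpha>) * of_nat ((2 * p - 1) choose p) ^ 4 * ratfun_eval h (of_nat p)
        = decay p * decay p * (\<rho> e1 p * \<rho> e2 p + \<rho> e3 p * \<rho> e4 p)"
      unfolding h1 h(2)[OF p] central_binom_def[symmetric] decay_def
      by (simp add: field_simps power2_eq_square power4_eq_xxxx)
    show ?thesis unfolding g2 h2 e[of e1] e[of e2] e[of e3] e[of e4]
      by (simp add: algebra_simps)
  qed
  then show ?thesis using g(1) h(1) by blast
qed

theorem corollary6p1:
  fixes \<alpha> :: nat and l m :: int
  assumes "\<alpha> \<in> {0, 1, 2, 3}"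
  shows "\<exists>g h :: rat poly fract. \<forall>p::nat.
    p \<ge> 1 \<and> block l m \<subseteq> aztec_diamond (4 * p + \<alpha>) \<longrightarrow>
      ratfun_defined_at g (of_nat p) \<and> ratfun_defined_at h (of_nat p) \<and>
      of_nat (card (domino_tilings (holey_aztec_diamond (4 * p + \<alpha>) l m))) =
        (2::rat) ^ ((4 * p + \<alpha> + 1) * (4 * p + \<alpha>) div 2) *
        (1 / 8
         + 2 powi (- 4 * int p - int \<alpha> - 2) * of_nat ((2 * p - 1) choose p) ^ 2
             * ratfun_eval g (of_nat p)
         + 2 powi (- 8 * int p - 2 * int \<alpha>) * of_nat ((2 * p - 1) choose p) ^ 4
             * ratfun_eval h (of_nat p))"
proof -
  define S where "S = {p. 1 \<le> p \<and> block l m \<subseteq> aztec_diamond (4 * p + \<alpha>)}"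
  have S1: "1 \<le> p" if "p \<in> S" for p using that by (simp add: S_def)
  have bound: "\<bar>l\<bar> + \<bar>m\<bar> \<le> 4 * int p + int \<alpha> - 1" if "p \<in> S" for p
  proof -
    have "block_cells l m \<subseteq> aztec_cells (4 * p + \<alpha>)" using that by (simp add: S_def block_subset_iff)
    from block_cells_bound[OF this] show ?thesis by simp
  qed
  have two: "(4 * p + \<alpha> + 1) * (4 * p + \<alpha>) = (4 * p + \<alpha>) * Suc (4 * p + \<alpha>)" for p by (simp add: mult.commute)
  let ?n = "\<lambda>p. 4 * p + \<alpha>"
  have "\<exists>e1 e2 e3 e4. decay_ratfun_on S (\<lambda>p. e1 p - 1 / 4) \<and> decay_ratfun_on S (\<lambda>p. e2 p - 1 / 4) \<and> decay_ratfun_on S (\<lambda>p. e3 p - 1 / 4) \<and>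
      decay_ratfun_on S (\<lambda>p. e4 p - 1 / 4) \<and> (\<forall>p\<in>S. of_nat (card (domino_tilings (holey_aztec_diamond (?n p) l m))) =
        (2::rat) ^ (?n p * Suc (?n p) div 2) * (e1 p * e2 p + e3 p * e4 p))"
  proof (cases "odd (l + m + int \<alpha>)")
    case True
    define a b where "a = (l + m + int \<alpha> - 1) div 2" and "b = (l - m + int \<alpha> - 1) div 2"
    \<comment> \<open>The mirror images: \<open>n - 1 - (2 * p + a) = 2 * p + a'\<close> for \<open>n = 4 * p + \<alpha>\<close>.\<close>
    define a' b' where "a' = int \<alpha> - 1 - a" and "b' = int \<alpha> - 1 - b"
    have ab: "2 * a = l + m + int \<alpha> - 1" "2 * b = l - m + int \<alpha> - 1" using True unfolding a_def b_def by presburger+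
    have rng: "1 \<le> p \<and> 0 \<le> 2 * int p + u \<and> 2 * int p + u < 4 * int p + int \<alpha> \<and>
      0 \<le> 2 * int p + v \<and> 2 * int p + v \<le> 4 * int p + int \<alpha>"
      if p: "p \<in> S" and uv: "u = a \<or> u = a'" "v = b \<or> v = b'" for p u v
      using ab uv bound[OF p] S1[OF p] unfolding a'_def b'_def by linarith
    let ?E = "\<lambda>u v p. edge_prob (?n p) (nat (2 * int p + u)) (nat (2 * int p + v))"
    have "decay_ratfun_on S (\<lambda>p. ?E u v p - 1 / 4)" if "u = a \<or> u = a'" "v = b \<or> v = b'" for u v
      by (rule decay_ratfun_on_edge_quarter) (use rng[OF _ that] in blast)
    moreover have "of_nat (card (domino_tilings (holey_aztec_diamond (?n p) l m))) =
        (2::rat) ^ (?n p * Suc (?n p) div 2) * (?E a b' p * ?E a' b p + ?E a b p * ?E a' b' p)" if p: "p \<in> S" for p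
    proof -
      have o: "odd (l + m + int (?n p))" using True by simp
      have bd: "\<bar>l\<bar> + \<bar>m\<bar> \<le> int (?n p) - 1" using bound[OF p] by simp
      have I: "(l + m + int (?n p) - 1) div 2 = 2 * int p + a" "(l - m + int (?n p) - 1) div 2 = 2 * int p + b"
        using ab by (simp_all add: algebra_simps)
      have I': "int (?n p) - 1 - (2 * int p + a) = 2 * int p + a'" "int (?n p) - 1 - (2 * int p + b) = 2 * int p + b'"
        by (simp_all add: a'_def b'_def)
      show ?thesis using card_tilings_holey_odd[OF bd o] unfolding I I' .
    qed
    ultimately show ?thesis
      by (intro exI[of _ "?E a b'"] exI[of _ "?E a' b"] exI[of _ "?E a b"] exI[of _ "?E a' b'"] conjI ballI) simp_all
  next
    case False
    define a b where "a = (l + m + int \<alpha>) div 2" and "b = (l - m + int \<alpha>) div 2"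
    define a' b' where "a' = int \<alpha> - a" and "b' = int \<alpha> - b"
    have ab: "2 * a = l + m + int \<alpha>" "2 * b = l - m + int \<alpha>" using False unfolding a_def b_def by presburger+
    have rng: "1 \<le> p \<and> 0 \<le> 2 * int p + u \<and> 2 * int p + u < 4 * int p + int \<alpha> \<and>
      0 \<le> 2 * int p + v \<and> 2 * int p + v \<le> 4 * int p + int \<alpha>"
      if p: "p \<in> S" and uv: "u = a \<or> u = a'" "v = b \<or> v = b'" for p u v
      using ab uv bound[OF p] S1[OF p] unfolding a'_def b'_def by linarith
    let ?E = "\<lambda>u v p. edge_prob (?n p) (nat (2 * int p + u)) (nat (2 * int p + v))"
    have "decay_ratfun_on S (\<lambda>p. ?E u v p - 1 / 4)" if "u = a \<or> u = a'" "v = b \<or> v = b'" for u v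
      by (rule decay_ratfun_on_edge_quarter) (use rng[OF _ that] in blast)
    moreover have "of_nat (card (domino_tilings (holey_aztec_diamond (?n p) l m))) =
        (2::rat) ^ (?n p * Suc (?n p) div 2) * (?E a' b p * ?E a b' p + ?E a b p * ?E a' b' p)" if p: "p \<in> S" for p
    proof -
      have o: "even (l + m + int (?n p))" using False by simp
      have bd: "\<bar>l\<bar> + \<bar>m\<bar> \<le> int (?n p) - 1" using bound[OF p] by simp
      have I: "(l + m + int (?n p)) div 2 = 2 * int p + a" "(l - m + int (?n p)) div 2 = 2 * int p + b"
        using ab by (simp_all add: algebra_simps)
      have I': "int (?n p) - (2 * int p + a) = 2 * int p + a'" "int (?n p) - (2 * int p + b) = 2 * int p + b'"
        by (simp_all add: a'_def b'_def)
      show ?thesis using card_tilings_holey_even[OF bd o] unfolding I I' .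
    qed
    ultimately show ?thesis
      by (intro exI[of _ "?E a' b"] exI[of _ "?E a b'"] exI[of _ "?E a b"] exI[of _ "?E a' b'"] conjI ballI) simp_all
  qed
  then obtain e1 e2 e3 e4 where e: "decay_ratfun_on S (\<lambda>p. e1 p - 1 / 4)" "decay_ratfun_on S (\<lambda>p. e2 p - 1 / 4)"
      "decay_ratfun_on S (\<lambda>p. e3 p - 1 / 4)" "decay_ratfun_on S (\<lambda>p. e4 p - 1 / 4)"
    and count: "\<And>p. p \<in> S \<Longrightarrow> of_nat (card (domino_tilings (holey_aztec_diamond (?n p) l m))) =
        (2::rat) ^ (?n p * Suc (?n p) div 2) * (e1 p * e2 p + e3 p * e4 p)" by blast
  from decay_ratfun_on_pair_products[OF e S1] obtain g h :: "rat poly fract" where gh: "\<And>p. p \<in> S \<Longrightarrow>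
      ratfun_defined_at g (of_nat p) \<and> ratfun_defined_at h (of_nat p) \<and>
      e1 p * e2 p + e3 p * e4 p =
        1 / 8
         + 2 powi (- 4 * int p - int \<alpha> - 2) * of_nat ((2 * p - 1) choose p) ^ 2 * ratfun_eval g (of_nat p)
         + 2 powi (- 8 * int p - 2 * int \<alpha>) * of_nat ((2 * p - 1) choose p) ^ 4 * ratfun_eval h (of_nat p)"
    by blast
  show ?thesis
  proof (rule exI[of _ g], rule exI[of _ h], intro allI impI)
    fix p assume "1 \<le> p \<and> block l m \<subseteq> aztec_diamond (4 * p + \<alpha>)"
    then have p: "p \<in> S" by (simp add: S_def)
    show "ratfun_defined_at g (of_nat p) \<and> ratfun_defined_at h (of_nat p) \<and>
      of_nat (card (domino_tilings (holey_aztec_diamond (4 * p + \<alpha>) l m))) =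
        (2::rat) ^ ((4 * p + \<alpha> + 1) * (4 * p + \<alpha>) div 2) *
        (1 / 8
         + 2 powi (- 4 * int p - int \<alpha> - 2) * of_nat ((2 * p - 1) choose p) ^ 2
             * ratfun_eval g (of_nat p)
         + 2 powi (- 8 * int p - 2 * int \<alpha>) * of_nat ((2 * p - 1) choose p) ^ 4
             * ratfun_eval h (of_nat p))"
      unfolding two count[OF p] using gh[OF p] by simp
  qed
qed

end
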